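(* Let $\mathcal{C}$ be a category and let $F\colon\mathcal{C}\to\mathcal{D}$ be a fully faithful functor into a precoherent category $\mathcal{D}$ such that 1) $F$ preserves and reflects finite effective epimorphic families, and 2) for every object $Y$ of $\mathcal{D}$ there exist an object $X$ of $\mathcal{C}$ and an effective epimorphism $F(X)\to Y$. Then: (a) $\mathcal{C}$ is precoherent. (b) For every sheaf $G$ (of sets) for the coherent topology on $\mathcal{D}$, the presheaf $G\circ F^{\mathrm{op}}$ is a sheaf for the coherent topology on $\mathcal{C}$. (c) Precomposition with $F$ induces an equivalence between the categories of sheaves (of sets) for the coherent topology on $\mathcal{D}$ and on $\mathcal{C}$.
   Context: A morphism $f\colon Y\to X$ is an effective epimorphism if for every $e\colon Y\to W$ such that $e\circ g_1=e\circ g_2$ for all $g_1,g_2\colon Z\to Y$ with $f\circ g_1=f\circ g_2$, there is a unique $d\colon X\to W$ with $d\circ f=e$. A family of morphisms $(f_i\colon X_i\to B)_{i\in I}$ is effective epimorphic if for every object $W$ and every family $(e_i\colon X_i\to W)_{i\in I}$ such that $e_i\circ g_i=e_j\circ g_j$ whenever $i,j\in I$, $g_i\colon Z\to X_i$, $g_j\colon Z\to X_j$ satisfy $f_i\circ g_i=f_j\circ g_j$, there is a unique $d\colon B\to W$ with $d\circ f_i=e_i$ for all $i$. $F$ preserves (resp. reflects) finite effective epimorphic families if for every finite family $(\pi_i\colon X_i\to B)_i$ in $\mathcal{C}$, $(\pi_i)_i$ being effective epimorphic implies (resp. is implied by) $(F(\pi_i))_i$ being effective epimorphic in $\mathcal{D}$.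 A category is precoherent if for every finite effective epimorphic family $(\pi_i\colon X_i\to B)_{i\in I}$ and every morphism $f\colon B'\to B$ there is a finite effective epimorphic family $(\pi'_j\colon X'_j\to B')_{j\in J}$ such that each $f\circ\pi'_j$ factors through some $\pi_i$. The coherent topology on a precoherent category is the smallest Grothendieck topology in which the sieve generated by each finite effective epimorphic family is a covering sieve. Size convention: "set" is understood relative to a sufficiently large universe. *)

theory Defs
  imports Main "HOL-Library.FuncSet"
begin

section \<open>Categories, functors, natural transformations\<close>

record ('o, 'm) cat =
  Ob :: "'o set"
  Ar :: "'m set"
  Dom :: "'m \<Rightarrow> 'o"
  Cod :: "'m \<Rightarrow> 'o"
  Idn :: "'o \<Rightarrow> 'm"
  Comp :: "'m \<Rightarrow> 'm \<Rightarrow> 'm"  (infixl "\<cdot>\<index>" 70)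

definition hom :: "('o, 'm) cat \<Rightarrow> 'o \<Rightarrow> 'o \<Rightarrow> 'm set" where
  "hom C X Y = {f \<in> Ar C. Dom C f = X \<and> Cod C f = Y}"

locale category =
  fixes C :: "('o, 'm) cat" (structure)
  assumes Dom_in_Ob: "f \<in> Ar C \<Longrightarrow> Dom C f \<in> Ob C"
    and Cod_in_Ob: "f \<in> Ar C \<Longrightarrow> Cod C f \<in> Ob C"
    and Idn_in_hom: "X \<in> Ob C \<Longrightarrow> Idn C X \<in> hom C X X"
    and Comp_in_hom: "\<lbrakk>g \<in> hom C Y Z; f \<in> hom C X Y\<rbrakk> \<Longrightarrow> g \<cdot> f \<in> hom C X Z"
    and Comp_assoc:
      "\<lbrakk>h \<in> hom C Y Z; g \<in> hom C X Y; f \<in> hom C W X\<rbrakk> \<Longrightarrow> (h \<cdot> g) \<cdot> f = h \<cdot> (g \<cdot> f)"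
    and Idn_left: "f \<in> hom C X Y \<Longrightarrow> Idn C Y \<cdot> f = f"
    and Idn_right: "f \<in> hom C X Y \<Longrightarrow> f \<cdot> Idn C X = f"

definition op_cat :: "('o, 'm) cat \<Rightarrow> ('o, 'm) cat" where
  "op_cat C = \<lparr>Ob = Ob C, Ar = Ar C, Dom = Cod C, Cod = Dom C, Idn = Idn C,
               Comp = (\<lambda>g f. f \<cdot>\<^bsub>C\<^esub> g)\<rparr>"

definition full_subcat :: "('o, 'm) cat \<Rightarrow> 'o set \<Rightarrow> ('o, 'm) cat" where
  "full_subcat C P = C\<lparr>Ob := Ob C \<inter> P, Ar := {f \<in> Ar C. Dom C f \<in> P \<and> Cod C f \<in> P}\<rparr>"

definition is_iso :: "('o, 'm) cat \<Rightarrow> 'm \<Rightarrow> bool" where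
  "is_iso C f \<longleftrightarrow> f \<in> Ar C \<and>
     (\<exists>g \<in> hom C (Cod C f) (Dom C f).
        g \<cdot>\<^bsub>C\<^esub> f = Idn C (Dom C f) \<and> f \<cdot>\<^bsub>C\<^esub> g = Idn C (Cod C f))"

record ('o1, 'm1, 'o2, 'm2) ftr =
  fobj :: "'o1 \<Rightarrow> 'o2"
  fmap :: "'m1 \<Rightarrow> 'm2"

text \<open>Functors are extensional (undefined off the objects and arrows of the source), so that
  two functors are equal as records exactly if they agree on objects and arrows.\<close>

locale cat_functor = C: category C + D: category D
  for C :: "('o1, 'm1) cat" and D :: "('o2, 'm2) cat" +
  fixes F :: "('o1, 'm1, 'o2, 'm2) ftr"
  assumes fobj_in_Ob: "X \<in> Ob C \<Longrightarrow> fobj F X \<in> Ob D"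
    and fmap_in_hom: "f \<in> hom C X Y \<Longrightarrow> fmap F f \<in> hom D (fobj F X) (fobj F Y)"
    and fmap_Idn: "X \<in> Ob C \<Longrightarrow> fmap F (Idn C X) = Idn D (fobj F X)"
    and fmap_Comp:
      "\<lbrakk>g \<in> hom C Y Z; f \<in> hom C X Y\<rbrakk> \<Longrightarrow> fmap F (g \<cdot>\<^bsub>C\<^esub> f) = fmap F g \<cdot>\<^bsub>D\<^esub> fmap F f"
    and fobj_extensional: "fobj F \<in> extensional (Ob C)"
    and fmap_extensional: "fmap F \<in> extensional (Ar C)"

definition id_ftr :: "('o, 'm) cat \<Rightarrow> ('o, 'm, 'o, 'm) ftr" where
  "id_ftr C = \<lparr>fobj = (\<lambda>X \<in> Ob C. X), fmap = (\<lambda>f \<in> Ar C. f)\<rparr>"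

text \<open>The composite \<open>G \<circ> F\<close>, where \<open>C\<close> is the source of \<open>F\<close>. As \<open>F\<close> and its opposite functor
  have the same underlying maps, and \<open>C\<close> and its opposite the same objects and arrows,
  \<open>comp_ftr C G F\<close> also denotes the presheaf \<open>G \<circ> F\<^sup>o\<^sup>p\<close>.\<close>

definition comp_ftr ::
    "('o1, 'm1) cat \<Rightarrow> ('o2, 'm2, 'o3, 'm3) ftr \<Rightarrow> ('o1, 'm1, 'o2, 'm2) ftr
       \<Rightarrow> ('o1, 'm1, 'o3, 'm3) ftr" where
  "comp_ftr C G F = \<lparr>fobj = (\<lambda>X \<in> Ob C. fobj G (fobj F X)), fmap = (\<lambda>f \<in> Ar C. fmap G (fmap F f))\<rparr>"

definition fully_faithful ::
    "('o1, 'm1) cat \<Rightarrow> ('o2, 'm2) cat \<Rightarrow> ('o1, 'm1, 'o2, 'm2) ftr \<Rightarrow> bool" where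
  "fully_faithful C D F \<longleftrightarrow>
     (\<forall>X \<in> Ob C. \<forall>Y \<in> Ob C. bij_betw (fmap F) (hom C X Y) (hom D (fobj F X) (fobj F Y)))"

definition nat_trans ::
    "('o1, 'm1) cat \<Rightarrow> ('o2, 'm2) cat \<Rightarrow> ('o1, 'm1, 'o2, 'm2) ftr \<Rightarrow> ('o1, 'm1, 'o2, 'm2) ftr
       \<Rightarrow> ('o1 \<Rightarrow> 'm2) \<Rightarrow> bool" where
  "nat_trans C D F G \<tau> \<longleftrightarrow>
     cat_functor C D F \<and> cat_functor C D G \<and> \<tau> \<in> extensional (Ob C) \<and>
     (\<forall>X \<in> Ob C. \<tau> X \<in> hom D (fobj F X) (fobj G X)) \<and>
     (\<forall>f \<in> Ar C. \<tau> (Cod C f) \<cdot>\<^bsub>D\<^esub> fmap F f = fmap G f \<cdot>\<^bsub>D\<^esub> \<tau> (Dom C f))"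

definition nat_iso ::
    "('o1, 'm1) cat \<Rightarrow> ('o2, 'm2) cat \<Rightarrow> ('o1, 'm1, 'o2, 'm2) ftr \<Rightarrow> ('o1, 'm1, 'o2, 'm2) ftr
       \<Rightarrow> ('o1 \<Rightarrow> 'm2) \<Rightarrow> bool" where
  "nat_iso C D F G \<tau> \<longleftrightarrow> nat_trans C D F G \<tau> \<and> (\<forall>X \<in> Ob C. is_iso D (\<tau> X))"

definition is_equivalence ::
    "('o1, 'm1) cat \<Rightarrow> ('o2, 'm2) cat \<Rightarrow> ('o1, 'm1, 'o2, 'm2) ftr \<Rightarrow> bool" where
  "is_equivalence C D F \<longleftrightarrow> cat_functor C D F \<and>
     (\<exists>G. cat_functor D C G \<and>
        (\<exists>\<eta>. nat_iso C C (id_ftr C) (comp_ftr C G F) \<eta>) \<and>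
        (\<exists>\<epsilon>. nat_iso D D (comp_ftr D F G) (id_ftr D) \<epsilon>))"

text \<open>An arrow carries its source and target functors besides its components.\<close>

definition functor_cat ::
    "('o1, 'm1) cat \<Rightarrow> ('o2, 'm2) cat \<Rightarrow>
     (('o1, 'm1, 'o2, 'm2) ftr,
      ('o1, 'm1, 'o2, 'm2) ftr \<times> ('o1, 'm1, 'o2, 'm2) ftr \<times> ('o1 \<Rightarrow> 'm2)) cat" where
  "functor_cat C D =
     \<lparr>Ob = {F. cat_functor C D F},
      Ar = {(F, G, \<tau>). nat_trans C D F G \<tau>},
      Dom = (\<lambda>(F, G, \<tau>). F),
      Cod = (\<lambda>(F, G, \<tau>). G),
      Idn = (\<lambda>F. (F, F, \<lambda>X \<in> Ob C. Idn D (fobj F X))),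
      Comp = (\<lambda>(G, H, \<sigma>) (F, G', \<tau>). (F, H, \<lambda>X \<in> Ob C. \<sigma> X \<cdot>\<^bsub>D\<^esub> \<tau> X))\<rparr>"

section \<open>Presheaves of sets\<close>

text \<open>The category of all subsets of \<open>'v\<close> and all maps between them; the type \<open>'v\<close>, which is
  arbitrary, bounds the size of the sets under consideration. A map is stored with its source
  and target.\<close>

type_synonym 'v set_map = "'v set \<times> 'v set \<times> ('v \<Rightarrow> 'v)"

definition set_cat :: "('v set, 'v set_map) cat" where
  "set_cat =
     \<lparr>Ob = UNIV,
      Ar = {(A, B, f). f \<in> A \<rightarrow>\<^sub>E B},
      Dom = (\<lambda>(A, B, f). A),
      Cod = (\<lambda>(A, B, f). B),
      Idn = (\<lambda>A. (A, A, \<lambda>x \<in> A. x)),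
      Comp = (\<lambda>(B, E, g) (A, B', f). (A, E, compose A g f))\<rparr>"

definition app :: "'v set_map \<Rightarrow> 'v \<Rightarrow> 'v" where
  "app = (\<lambda>(A, B, f). f)"

type_synonym ('o, 'm, 'v) presheaf = "('o, 'm, 'v set, 'v set_map) ftr"

definition is_presheaf :: "('o, 'm) cat \<Rightarrow> ('o, 'm, 'v) presheaf \<Rightarrow> bool" where
  "is_presheaf C G \<longleftrightarrow> cat_functor (op_cat C) set_cat G"

section \<open>Effective epimorphisms and precoherent categories\<close>

definition effective_epi :: "('o, 'm) cat \<Rightarrow> 'm \<Rightarrow> bool" where
  "effective_epi C f \<longleftrightarrow> f \<in> Ar C \<and>
     (\<forall>W \<in> Ob C. \<forall>e \<in> hom C (Dom C f) W.
        (\<forall>Z \<in> Ob C. \<forall>g1 \<in> hom C Z (Dom C f). \<forall>g2 \<in> hom C Z (Dom C f).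
           f \<cdot>\<^bsub>C\<^esub> g1 = f \<cdot>\<^bsub>C\<^esub> g2 \<longrightarrow> e \<cdot>\<^bsub>C\<^esub> g1 = e \<cdot>\<^bsub>C\<^esub> g2) \<longrightarrow>
        (\<exists>!d. d \<in> hom C (Cod C f) W \<and> d \<cdot>\<^bsub>C\<^esub> f = e))"

text \<open>A family \<open>(\<pi>\<^sub>i : X\<^sub>i \<rightarrow> B)\<close>, \<open>i \<in> I\<close>, is given by \<open>B\<close>, \<open>I\<close> and \<open>\<pi>\<close>, with \<open>X\<^sub>i = Dom C (\<pi> i)\<close>;
  \<open>B\<close> has to be recorded since \<open>I\<close> may be empty.\<close>

definition family_over :: "('o, 'm) cat \<Rightarrow> 'o \<Rightarrow> 'i set \<Rightarrow> ('i \<Rightarrow> 'm) \<Rightarrow> bool" where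
  "family_over C B I \<pi> \<longleftrightarrow> B \<in> Ob C \<and> (\<forall>i \<in> I. \<pi> i \<in> Ar C \<and> Cod C (\<pi> i) = B)"

definition effective_epi_family :: "('o, 'm) cat \<Rightarrow> 'o \<Rightarrow> 'i set \<Rightarrow> ('i \<Rightarrow> 'm) \<Rightarrow> bool" where
  "effective_epi_family C B I \<pi> \<longleftrightarrow> family_over C B I \<pi> \<and>
     (\<forall>W \<in> Ob C. \<forall>e. (\<forall>i \<in> I. e i \<in> hom C (Dom C (\<pi> i)) W) \<longrightarrow>
        (\<forall>i \<in> I. \<forall>j \<in> I. \<forall>Z \<in> Ob C.
           \<forall>g \<in> hom C Z (Dom C (\<pi> i)). \<forall>h \<in> hom C Z (Dom C (\<pi> j)).
             \<pi> i \<cdot>\<^bsub>C\<^esub> g = \<pi> j \<cdot>\<^bsub>C\<^esub> h \<longrightarrow> e i \<cdot>\<^bsub>C\<^esub> g = e j \<cdot>\<^bsub>C\<^esub> h) \<longrightarrow>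
        (\<exists>!d. d \<in> hom C B W \<and> (\<forall>i \<in> I. d \<cdot>\<^bsub>C\<^esub> \<pi> i = e i)))"

text \<open>Finite families are indexed by finite sets of natural numbers, which is no restriction
  because every finite index set is in bijection with such a set.\<close>

definition preserves_finite_eff_epi_families ::
    "('o1, 'm1) cat \<Rightarrow> ('o2, 'm2) cat \<Rightarrow> ('o1, 'm1, 'o2, 'm2) ftr \<Rightarrow> bool" where
  "preserves_finite_eff_epi_families C D F \<longleftrightarrow>
     (\<forall>B. \<forall>I :: nat set. \<forall>\<pi>. finite I \<and> family_over C B I \<pi> \<longrightarrow>
        effective_epi_family C B I \<pi> \<longrightarrow>
        effective_epi_family D (fobj F B) I (\<lambda>i. fmap F (\<pi> i)))"

definition reflects_finite_eff_epi_families ::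
    "('o1, 'm1) cat \<Rightarrow> ('o2, 'm2) cat \<Rightarrow> ('o1, 'm1, 'o2, 'm2) ftr \<Rightarrow> bool" where
  "reflects_finite_eff_epi_families C D F \<longleftrightarrow>
     (\<forall>B. \<forall>I :: nat set. \<forall>\<pi>. finite I \<and> family_over C B I \<pi> \<longrightarrow>
        effective_epi_family D (fobj F B) I (\<lambda>i. fmap F (\<pi> i)) \<longrightarrow>
        effective_epi_family C B I \<pi>)"

definition precoherent :: "('o, 'm) cat \<Rightarrow> bool" where
  "precoherent C \<longleftrightarrow> category C \<and>
     (\<forall>B. \<forall>I :: nat set. \<forall>\<pi>. finite I \<and> effective_epi_family C B I \<pi> \<longrightarrow>
        (\<forall>f \<in> Ar C. Cod C f = B \<longrightarrow>
           (\<exists>J :: nat set. \<exists>\<pi>'. finite J \<and> effective_epi_family C (Dom C f) J \<pi>' \<and>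
              (\<forall>j \<in> J. \<exists>i \<in> I. \<exists>h \<in> hom C (Dom C (\<pi>' j)) (Dom C (\<pi> i)).
                 f \<cdot>\<^bsub>C\<^esub> \<pi>' j = \<pi> i \<cdot>\<^bsub>C\<^esub> h))))"

section \<open>Grothendieck topologies, the coherent topology, sheaves\<close>

definition is_sieve :: "('o, 'm) cat \<Rightarrow> 'o \<Rightarrow> 'm set \<Rightarrow> bool" where
  "is_sieve C X S \<longleftrightarrow> S \<subseteq> {f \<in> Ar C. Cod C f = X} \<and>
     (\<forall>f \<in> S. \<forall>g \<in> Ar C. Cod C g = Dom C f \<longrightarrow> f \<cdot>\<^bsub>C\<^esub> g \<in> S)"

definition pullback_sieve :: "('o, 'm) cat \<Rightarrow> 'm \<Rightarrow> 'm set \<Rightarrow> 'm set" where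
  "pullback_sieve C f S = {g \<in> Ar C. Cod C g = Dom C f \<and> f \<cdot>\<^bsub>C\<^esub> g \<in> S}"

definition generated_sieve :: "('o, 'm) cat \<Rightarrow> 'o \<Rightarrow> 'i set \<Rightarrow> ('i \<Rightarrow> 'm) \<Rightarrow> 'm set" where
  "generated_sieve C B I \<pi> =
     {f \<in> Ar C. Cod C f = B \<and> (\<exists>i \<in> I. \<exists>h \<in> hom C (Dom C f) (Dom C (\<pi> i)). f = \<pi> i \<cdot>\<^bsub>C\<^esub> h)}"

definition grothendieck_topology :: "('o, 'm) cat \<Rightarrow> ('o \<Rightarrow> 'm set set) \<Rightarrow> bool" where
  "grothendieck_topology C J \<longleftrightarrow>
     (\<forall>X \<in> Ob C. \<forall>S \<in> J X. is_sieve C X S) \<and>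
     (\<forall>X \<in> Ob C. {f \<in> Ar C. Cod C f = X} \<in> J X) \<and>
     (\<forall>f \<in> Ar C. \<forall>S \<in> J (Cod C f). pullback_sieve C f S \<in> J (Dom C f)) \<and>
     (\<forall>X \<in> Ob C. \<forall>S \<in> J X. \<forall>R. is_sieve C X R \<and>
        (\<forall>f \<in> S. pullback_sieve C f R \<in> J (Dom C f)) \<longrightarrow> R \<in> J X)"

text \<open>The smallest topology is the intersection of all topologies with the required property;
  these include the topology in which all sieves cover.\<close>

definition coherent_topology :: "('o, 'm) cat \<Rightarrow> 'o \<Rightarrow> 'm set set" where
  "coherent_topology C X =
     \<Inter> {J X | J. grothendieck_topology C J \<and>
          (\<forall>B. \<forall>I :: nat set. \<forall>\<pi>. finite I \<and> effective_epi_family C B I \<pi> \<longrightarrow>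
             generated_sieve C B I \<pi> \<in> J B)}"

definition matching_family ::
    "('o, 'm) cat \<Rightarrow> ('o, 'm, 'v) presheaf \<Rightarrow> 'm set \<Rightarrow> ('m \<Rightarrow> 'v) \<Rightarrow> bool" where
  "matching_family C G S x \<longleftrightarrow>
     (\<forall>f \<in> S. x f \<in> fobj G (Dom C f)) \<and>
     (\<forall>f \<in> S. \<forall>g \<in> Ar C. Cod C g = Dom C f \<longrightarrow> app (fmap G g) (x f) = x (f \<cdot>\<^bsub>C\<^esub> g))"

definition is_sheaf ::
    "('o, 'm) cat \<Rightarrow> ('o \<Rightarrow> 'm set set) \<Rightarrow> ('o, 'm, 'v) presheaf \<Rightarrow> bool" where
  "is_sheaf C J G \<longleftrightarrow> is_presheaf C G \<and>
     (\<forall>X \<in> Ob C. \<forall>S \<in> J X. \<forall>x. matching_family C G S x \<longrightarrow>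
        (\<exists>!a. a \<in> fobj G X \<and> (\<forall>f \<in> S. app (fmap G f) a = x f)))"

type_synonym ('o, 'm, 'v) presheaf_map =
  "('o, 'm, 'v) presheaf \<times> ('o, 'm, 'v) presheaf \<times> ('o \<Rightarrow> 'v set_map)"

definition sheaf_cat ::
    "('o, 'm) cat \<Rightarrow> ('o \<Rightarrow> 'm set set) \<Rightarrow>
     (('o, 'm, 'v) presheaf, ('o, 'm, 'v) presheaf_map) cat" where
  "sheaf_cat C J = full_subcat (functor_cat (op_cat C) set_cat) {G. is_sheaf C J G}"

text \<open>Precomposition with (the opposite of) a functor \<open>F\<close> with source \<open>C\<close>, on a category \<open>A\<close>
  of presheaves on the target of \<open>F\<close>.\<close>

definition precomp_ftr ::
    "('o1, 'm1) cat \<Rightarrow> (('o2, 'm2, 'v) presheaf, ('o2, 'm2, 'v) presheaf_map) cat \<Rightarrow>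
     ('o1, 'm1, 'o2, 'm2) ftr \<Rightarrow>
     (('o2, 'm2, 'v) presheaf, ('o2, 'm2, 'v) presheaf_map,
      ('o1, 'm1, 'v) presheaf, ('o1, 'm1, 'v) presheaf_map) ftr" where
  "precomp_ftr C A F =
     \<lparr>fobj = (\<lambda>G \<in> Ob A. comp_ftr C G F),
      fmap = restrict (\<lambda>(G, H, \<tau>). (comp_ftr C G F, comp_ftr C H F, \<lambda>X \<in> Ob C. \<tau> (fobj F X))) (Ar A)\<rparr>"

end

theory Submission
  imports Defs
begin

text \<open>Everything is controlled by one observation: for a presheaf on a precoherent category, the
  sheaf condition for the coherent topology can be tested on finite effective epimorphic families
  (\<open>sheaf_if_sheaf_for_families\<close>). Since effective epimorphic families are those for which all
  representable presheaves satisfy the sheaf condition, the coherent topology is subcanonical, and a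
  family that generates a covering sieve is effective epimorphic
  (\<open>effective_epi_family_if_covering\<close>). In particular finite effective epimorphic families
  can be composed with effective epimorphisms (\<open>effective_epi_family_composite\<close>), because covering
  sieves can.

  Now let \<open>F : C \<rightarrow> D\<close> be as in the theorem. Given an arrow \<open>F X \<rightarrow> Y\<close> and a
  finite effective epimorphic family over \<open>Y\<close>, precoherence of \<open>D\<close> gives a family over
  \<open>F X\<close> that factors through it; covering the sources by objects \<open>F X\<^sub>j\<close> and
  composing yields a family of arrows \<open>F X\<^sub>j \<rightarrow> F X\<close>, which comes from \<open>C\<close> because
  \<open>F\<close> is full, and is effective epimorphic there because \<open>F\<close> reflects such families
  (\<open>effective_epi_family_lift\<close>). Two consequences: \<open>C\<close> is precoherent
  (\<open>precoherent_C\<close>), and covering sieves of \<open>D\<close> pull back to covering sieves of \<open>C\<close>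
  (\<open>preimage_sieve_covering\<close>). That restricting along \<open>F\<close> preserves sheaves
  (\<open>is_sheaf_comp_ftr\<close>) is tested on families, which \<open>F\<close> preserves; the arrows of \<open>D\<close> that
  occur in the compatibility condition are first covered by arrows of \<open>C\<close>.

  For the equivalence, compare a sheaf \<open>G\<close> on \<open>D\<close> with the right Kan extension of its restriction
  \<open>H\<close>: an element of the latter at \<open>Y\<close> is a natural family assigning to each
  \<open>p : F X \<rightarrow> Y\<close> an element of \<open>H X\<close> (\<open>ran_element\<close>). By covering
  \<open>Y\<close> with a single \<open>F X \<rightarrow> Y\<close> one sees that every such family comes from a unique
  element of \<open>G Y\<close> (\<open>ran_element_represented\<close>), so that maps between restrictions extend uniquely:
  restriction is fully faithful. Conversely the right Kan extension of a sheaf \<open>H\<close> on \<open>C\<close> is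
  a sheaf on \<open>D\<close> whose restriction is isomorphic to \<open>H\<close>
  (\<open>restriction_essentially_surjective\<close>). Here the values must be subsets of the given type
  \<open>'v\<close>. They are, up to bijection: a natural family is determined by its value at one chosen
  effective epimorphism \<open>F X \<rightarrow> Y\<close>, so that the values of the Kan extension embed into those of
  \<open>H\<close>.\<close>

section \<open>Categories, functors and equivalences\<close>

lemma homD:
  assumes "f \<in> hom C X Y"
  shows "f \<in> Ar C" "Dom C f = X" "Cod C f = Y"
  using assms by (simp_all add: hom_def)

context category
begin

lemma hom_Ob:
  assumes "f \<in> hom C X Y"
  shows "X \<in> Ob C" "Y \<in> Ob C"
  using assms Dom_in_Ob Cod_in_Ob by (auto simp: hom_def)

lemma Idn_simps:
  assumes "X \<in> Ob C"
  shows "Idn C X \<in> Ar C" "Dom C (Idn C X) = X" "Cod C (Idn C X) = X"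
  using Idn_in_hom[OF assms] by (simp_all add: hom_def)

lemma Comp_simps:
  assumes "g \<in> Ar C" "f \<in> Ar C" "Cod C f = Dom C g"
  shows "g \<cdot> f \<in> Ar C" "Dom C (g \<cdot> f) = Dom C f" "Cod C (g \<cdot> f) = Cod C g"
  using Comp_in_hom[of g "Dom C g" "Cod C g" f "Dom C f"] assms by (simp_all add: hom_def)

lemma Comp_assoc_Ar:
  assumes "h \<in> Ar C" "g \<in> Ar C" "f \<in> Ar C" "Cod C g = Dom C h" "Cod C f = Dom C g"
  shows "(h \<cdot> g) \<cdot> f = h \<cdot> (g \<cdot> f)"
  using Comp_assoc[of h "Dom C h" "Cod C h" g "Dom C g" f "Dom C f"] assms
  by (simp add: hom_def)

lemma Idn_Comp: "\<lbrakk>f \<in> Ar C; Cod C f = Y\<rbrakk> \<Longrightarrow> Idn C Y \<cdot> f = f"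
  using Idn_left[of f "Dom C f" Y] by (simp add: hom_def)

lemma Comp_Idn: "\<lbrakk>f \<in> Ar C; Dom C f = X\<rbrakk> \<Longrightarrow> f \<cdot> Idn C X = f"
  using Idn_right[of f X "Cod C f"] by (simp add: hom_def)

lemmas cat_simps =
  Dom_in_Ob Cod_in_Ob Idn_simps Comp_simps Comp_assoc_Ar Idn_Comp Comp_Idn

lemma category_op_cat: "category (op_cat C)"
  by unfold_locales (auto simp: op_cat_def hom_def cat_simps)

lemma category_full_subcat: "category (full_subcat C P)"
  by unfold_locales (auto simp: full_subcat_def hom_def cat_simps)

lemma is_isoI:
  assumes "f \<in> hom C X Y" "g \<in> hom C Y X" "g \<cdot> f = Idn C X" "f \<cdot> g = Idn C Y"
  shows "is_iso C f"
  using assms by (auto simp: is_iso_def hom_def)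

end

lemma category_set_cat: "category (set_cat :: ('v set, 'v set_map) cat)"
  by unfold_locales
    (auto simp: set_cat_def hom_def compose_def PiE_iff extensional_def restrict_def fun_eq_iff)

lemma category_functor_cat:
  assumes "category A" "category B"
  shows "category (functor_cat A B)"
proof -
  interpret A: category A by fact
  interpret B: category B by fact
  have comp: "nat_trans A B F H (\<lambda>X \<in> Ob A. \<sigma> X \<cdot>\<^bsub>B\<^esub> \<tau> X)"
    if \<sigma>: "nat_trans A B G H \<sigma>" and \<tau>: "nat_trans A B F G \<tau>" for F G H \<sigma> \<tau>
  proof -
    have F: "cat_functor A B F" and G: "cat_functor A B G" and H: "cat_functor A B H"
      using \<sigma> \<tau> by (simp_all add: nat_trans_def)
    have "\<sigma> (Cod A f) \<cdot>\<^bsub>B\<^esub> \<tau> (Cod A f) \<cdot>\<^bsub>B\<^esub> fmap F f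
        = fmap H f \<cdot>\<^bsub>B\<^esub> (\<sigma> (Dom A f) \<cdot>\<^bsub>B\<^esub> \<tau> (Dom A f))" if f: "f \<in> Ar A" for f
    proof -
      let ?X = "Dom A f" and ?Y = "Cod A f"
      have X: "?X \<in> Ob A" "?Y \<in> Ob A" and fh: "f \<in> hom A ?X ?Y"
        using f by (simp_all add: A.cat_simps hom_def)
      have s: "\<sigma> ?X \<in> hom B (fobj G ?X) (fobj H ?X)" "\<sigma> ?Y \<in> hom B (fobj G ?Y) (fobj H ?Y)"
        and t: "\<tau> ?X \<in> hom B (fobj F ?X) (fobj G ?X)" "\<tau> ?Y \<in> hom B (fobj F ?Y) (fobj G ?Y)"
        using \<sigma> \<tau> X by (simp_all add: nat_trans_def)
      note m = cat_functor.fmap_in_hom[OF F fh] cat_functor.fmap_in_hom[OF G fh]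
        cat_functor.fmap_in_hom[OF H fh]
      have "\<sigma> ?Y \<cdot>\<^bsub>B\<^esub> \<tau> ?Y \<cdot>\<^bsub>B\<^esub> fmap F f = \<sigma> ?Y \<cdot>\<^bsub>B\<^esub> (fmap G f \<cdot>\<^bsub>B\<^esub> \<tau> ?X)"
        using B.Comp_assoc[OF s(2) t(2) m(1)] \<tau> f by (simp add: nat_trans_def)
      also have "\<dots> = fmap H f \<cdot>\<^bsub>B\<^esub> \<sigma> ?X \<cdot>\<^bsub>B\<^esub> \<tau> ?X"
        using B.Comp_assoc[OF s(2) m(2) t(1)] \<sigma> f by (simp add: nat_trans_def)
      also have "\<dots> = fmap H f \<cdot>\<^bsub>B\<^esub> (\<sigma> ?X \<cdot>\<^bsub>B\<^esub> \<tau> ?X)"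
        using B.Comp_assoc[OF m(3) s(1) t(1)] .
      finally show ?thesis .
    qed
    then show ?thesis
      using \<sigma> \<tau> by (auto simp: nat_trans_def A.cat_simps intro: B.Comp_in_hom)
  qed
  have idn: "nat_trans A B F F (\<lambda>X \<in> Ob A. Idn B (fobj F X))" if "cat_functor A B F" for F
  proof -
    interpret F: cat_functor A B F by fact
    show ?thesis
      using F.fmap_in_hom that
      by (auto simp: nat_trans_def A.cat_simps B.cat_simps F.fobj_in_Ob hom_def)
  qed
  show ?thesis
  proof
    fix f assume "f \<in> Ar (functor_cat A B)"
    then show "Dom (functor_cat A B) f \<in> Ob (functor_cat A B)"
      and "Cod (functor_cat A B) f \<in> Ob (functor_cat A B)"
      by (auto simp: functor_cat_def nat_trans_def)
  next
    fix F assume "F \<in> Ob (functor_cat A B)"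
    then show "Idn (functor_cat A B) F \<in> hom (functor_cat A B) F F"
      using idn by (auto simp: functor_cat_def hom_def)
  next
    fix g f X Y Z
    assume "g \<in> hom (functor_cat A B) Y Z" "f \<in> hom (functor_cat A B) X Y"
    then show "g \<cdot>\<^bsub>functor_cat A B\<^esub> f \<in> hom (functor_cat A B) X Z"
      using comp by (auto simp: functor_cat_def hom_def)
  next
    fix h g f X Y Z W
    assume "h \<in> hom (functor_cat A B) Y Z" "g \<in> hom (functor_cat A B) X Y"
      "f \<in> hom (functor_cat A B) W X"
    then show "h \<cdot>\<^bsub>functor_cat A B\<^esub> g \<cdot>\<^bsub>functor_cat A B\<^esub> f
        = h \<cdot>\<^bsub>functor_cat A B\<^esub> (g \<cdot>\<^bsub>functor_cat A B\<^esub> f)"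
      by (auto simp: functor_cat_def hom_def nat_trans_def restrict_def fun_eq_iff
          intro!: B.Comp_assoc)
  next
    fix f X Y
    assume "f \<in> hom (functor_cat A B) X Y"
    then show "Idn (functor_cat A B) Y \<cdot>\<^bsub>functor_cat A B\<^esub> f = f"
      and "f \<cdot>\<^bsub>functor_cat A B\<^esub> Idn (functor_cat A B) X = f"
      by (auto simp: functor_cat_def hom_def nat_trans_def fun_eq_iff restrict_def
          extensional_def B.cat_simps)
  qed
qed

context cat_functor
begin

lemma fmap_simps:
  assumes "f \<in> Ar C"
  shows "fmap F f \<in> Ar D" "Dom D (fmap F f) = fobj F (Dom C f)"
    "Cod D (fmap F f) = fobj F (Cod C f)"
  using fmap_in_hom[of f "Dom C f" "Cod C f"] assms by (simp_all add: hom_def)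

lemma fmap_Comp_Ar:
  assumes "g \<in> Ar C" "f \<in> Ar C" "Cod C f = Dom C g"
  shows "fmap F (g \<cdot>\<^bsub>C\<^esub> f) = fmap F g \<cdot>\<^bsub>D\<^esub> fmap F f"
  using fmap_Comp[of g "Dom C g" "Cod C g" f "Dom C f"] assms by (simp add: hom_def)

lemmas ftr_simps = fobj_in_Ob fmap_simps fmap_Comp_Ar fmap_Idn

lemma ff_lift:
  assumes "fully_faithful C D F" "X \<in> Ob C" "Y \<in> Ob C" "h \<in> hom D (fobj F X) (fobj F Y)"
  obtains f where "f \<in> hom C X Y" "fmap F f = h"
proof -
  have "h \<in> fmap F ` hom C X Y"
    using assms unfolding fully_faithful_def bij_betw_def by blast
  then show thesis using that by blast
qed

lemma ff_eq:
  assumes "fully_faithful C D F" "f \<in> hom C X Y" "g \<in> hom C X Y" "fmap F f = fmap F g"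
  shows "f = g"
  using assms C.hom_Ob[OF assms(2)] unfolding fully_faithful_def bij_betw_def
  by (meson inj_onD)

end

text \<open>Choosing for every object of the target an object of the source together with an
  isomorphism onto it from its image, conjugation by these isomorphisms turns arrows of the target
  into arrows between images, which lift uniquely; this is the inverse functor.\<close>

lemma is_equivalence_if_fully_faithful_ess_surj:
  assumes F: "cat_functor C D F" and ff: "fully_faithful C D F"
    and ess: "\<And>Y. Y \<in> Ob D \<Longrightarrow> \<exists>X \<in> Ob C. \<exists>e \<in> hom D (fobj F X) Y. is_iso D e"
  shows "is_equivalence C D F"
proof -
  interpret cat_functor C D F by fact
  have "\<forall>Y \<in> Ob D. \<exists>X e e'. X \<in> Ob C \<and> e \<in> hom D (fobj F X) Y \<and> e' \<in> hom D Y (fobj F X) \<and>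
      e' \<cdot>\<^bsub>D\<^esub> e = Idn D (fobj F X) \<and> e \<cdot>\<^bsub>D\<^esub> e' = Idn D Y"
  proof
    fix Y assume "Y \<in> Ob D"
    then obtain X e where X: "X \<in> Ob C" and e: "e \<in> hom D (fobj F X) Y" and i: "is_iso D e"
      using ess by blast
    have "Dom D e = fobj F X" "Cod D e = Y" using e by (auto simp: hom_def)
    then show "\<exists>X e e'. X \<in> Ob C \<and> e \<in> hom D (fobj F X) Y \<and> e' \<in> hom D Y (fobj F X) \<and>
      e' \<cdot>\<^bsub>D\<^esub> e = Idn D (fobj F X) \<and> e \<cdot>\<^bsub>D\<^esub> e' = Idn D Y"
      using X e i unfolding is_iso_def by metis
  qed
  then obtain K e e' where choice:
    "\<forall>Y \<in> Ob D. K Y \<in> Ob C \<and> e Y \<in> hom D (fobj F (K Y)) Y \<and> e' Y \<in> hom D Y (fobj F (K Y)) \<and>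
      e' Y \<cdot>\<^bsub>D\<^esub> e Y = Idn D (fobj F (K Y)) \<and> e Y \<cdot>\<^bsub>D\<^esub> e' Y = Idn D Y"
    by metis
  have K: "K Y \<in> Ob C" and e: "e Y \<in> Ar D" "Dom D (e Y) = fobj F (K Y)" "Cod D (e Y) = Y"
    and e': "e' Y \<in> Ar D" "Dom D (e' Y) = Y" "Cod D (e' Y) = fobj F (K Y)"
    and e'e: "e' Y \<cdot>\<^bsub>D\<^esub> e Y = Idn D (fobj F (K Y))" and ee': "e Y \<cdot>\<^bsub>D\<^esub> e' Y = Idn D Y"
    if "Y \<in> Ob D" for Y
    using choice that by (auto simp: hom_def)
  have ee'_left: "e Y \<cdot>\<^bsub>D\<^esub> (e' Y \<cdot>\<^bsub>D\<^esub> g) = g" if "Y \<in> Ob D" "g \<in> Ar D" "Cod D g = Y" for Y g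
    using D.Comp_assoc_Ar[of "e Y" "e' Y" g] that e e' ee' by (simp add: D.cat_simps)
  have e'e_left: "e' Y \<cdot>\<^bsub>D\<^esub> (e Y \<cdot>\<^bsub>D\<^esub> g) = g"
    if "Y \<in> Ob D" "g \<in> Ar D" "Cod D g = fobj F (K Y)" for Y g
    using D.Comp_assoc_Ar[of "e' Y" "e Y" g] that e e' e'e by (simp add: D.cat_simps)
  define lift where "lift X X' = inv_into (hom C X X') (fmap F)" for X X'
  have lift: "lift X X' h \<in> hom C X X'" "fmap F (lift X X' h) = h"
    if "X \<in> Ob C" "X' \<in> Ob C" "h \<in> hom D (fobj F X) (fobj F X')" for X X' h
  proof -
    have "h \<in> fmap F ` hom C X X'"
      using ff that unfolding fully_faithful_def bij_betw_def by blast
    then show "lift X X' h \<in> hom C X X'" "fmap F (lift X X' h) = h"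
      unfolding lift_def by (rule inv_into_into, rule f_inv_into_f)
  qed
  define G where "G = \<lparr>fobj = (\<lambda>Y \<in> Ob D. K Y),
    fmap = (\<lambda>f \<in> Ar D. lift (K (Dom D f)) (K (Cod D f)) (e' (Cod D f) \<cdot>\<^bsub>D\<^esub> (f \<cdot>\<^bsub>D\<^esub> e (Dom D f))))\<rparr>"
  have Gobj: "fobj G Y = K Y" if "Y \<in> Ob D" for Y using that by (simp add: G_def)
  have Gmap: "fmap G f \<in> hom C (K (Dom D f)) (K (Cod D f)) \<and>
      fmap F (fmap G f) = e' (Cod D f) \<cdot>\<^bsub>D\<^esub> (f \<cdot>\<^bsub>D\<^esub> e (Dom D f))"
    if "f \<in> Ar D" for f
    using lift[of "K (Dom D f)" "K (Cod D f)" "e' (Cod D f) \<cdot>\<^bsub>D\<^esub> (f \<cdot>\<^bsub>D\<^esub> e (Dom D f))"] that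
    by (simp add: G_def D.cat_simps K e e' hom_def)
  have Gmap_simps: "fmap G f \<in> Ar C" "Dom C (fmap G f) = K (Dom D f)"
      "Cod C (fmap G f) = K (Cod D f)"
      "fmap F (fmap G f) = e' (Cod D f) \<cdot>\<^bsub>D\<^esub> (f \<cdot>\<^bsub>D\<^esub> e (Dom D f))"
    if "f \<in> Ar D" for f
    using Gmap[OF that] by (auto simp: hom_def)
  have eqI: "f = g" if "f \<in> Ar C" "g \<in> Ar C" "Dom C f = Dom C g" "Cod C f = Cod C g"
    "fmap F f = fmap F g" for f g
    using ff_eq[OF ff, of f "Dom C f" "Cod C f" g] that by (simp add: hom_def)
  note s = hom_def Gobj Gmap_simps C.cat_simps D.cat_simps ftr_simps K e e' e'e ee' ee'_left
    e'e_left
  have G: "cat_functor D C G"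
  proof
    show "fobj G Y \<in> Ob C" if "Y \<in> Ob D" for Y using that by (simp add: s)
    show "fmap G f \<in> hom C (fobj G X) (fobj G Y)" if "f \<in> hom D X Y" for f X Y
      using that by (auto simp: s)
    show "fmap G (Idn D X) = Idn C (fobj G X)" if "X \<in> Ob D" for X
      using that by (auto intro!: eqI simp: s)
    show "fmap G (g \<cdot>\<^bsub>D\<^esub> f) = fmap G g \<cdot>\<^bsub>C\<^esub> fmap G f"
      if "g \<in> hom D Y Z" "f \<in> hom D X Y" for g f X Y Z
      using that by (auto intro!: eqI simp: s)
  qed (simp_all add: G_def)
  have \<epsilon>: "nat_iso D D (comp_ftr D F G) (id_ftr D) (\<lambda>Y \<in> Ob D. e Y)"
  proof -
    have "cat_functor D D (comp_ftr D F G)"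
      by unfold_locales (auto simp: comp_ftr_def s)
    moreover have "cat_functor D D (id_ftr D)"
      by unfold_locales (auto simp: id_ftr_def s)
    moreover have "is_iso D (e Y)" if "Y \<in> Ob D" for Y
      using D.is_isoI[of "e Y" "fobj F (K Y)" Y "e' Y"] that by (simp add: s)
    ultimately show ?thesis
      by (auto simp: nat_iso_def nat_trans_def comp_ftr_def id_ftr_def s)
  qed
  define \<eta> where "\<eta> X = lift X (K (fobj F X)) (e' (fobj F X))" for X
  define \<eta>' where "\<eta>' X = lift (K (fobj F X)) X (e (fobj F X))" for X
  have \<eta>: "\<eta> X \<in> Ar C" "Dom C (\<eta> X) = X" "Cod C (\<eta> X) = K (fobj F X)"
      "fmap F (\<eta> X) = e' (fobj F X)"
    if "X \<in> Ob C" for X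
    using lift[of X "K (fobj F X)" "e' (fobj F X)"] that by (auto simp: \<eta>_def s)
  have \<eta>': "\<eta>' X \<in> Ar C" "Cod C (\<eta>' X) = X" "Dom C (\<eta>' X) = K (fobj F X)"
      "fmap F (\<eta>' X) = e (fobj F X)"
    if "X \<in> Ob C" for X
    using lift[of "K (fobj F X)" X "e (fobj F X)"] that by (auto simp: \<eta>'_def s)
  have "nat_iso C C (id_ftr C) (comp_ftr C G F) (\<lambda>X \<in> Ob C. \<eta> X)"
  proof -
    have "cat_functor C C (comp_ftr C G F)"
    proof
      show "fmap (comp_ftr C G F) (g \<cdot>\<^bsub>C\<^esub> f)
          = fmap (comp_ftr C G F) g \<cdot>\<^bsub>C\<^esub> fmap (comp_ftr C G F) f"
        if "g \<in> hom C Y Z" "f \<in> hom C X Y" for g f X Y Z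
        using that cat_functor.fmap_Comp_Ar[OF G] by (auto simp: comp_ftr_def s)
    qed (use cat_functor.fmap_Idn[OF G] in \<open>auto simp: comp_ftr_def s\<close>)
    moreover have "cat_functor C C (id_ftr C)"
      by unfold_locales (auto simp: id_ftr_def s)
    moreover have "is_iso C (\<eta> X)" if "X \<in> Ob C" for X
      using that by (intro C.is_isoI[of "\<eta> X" X "K (fobj F X)" "\<eta>' X"] eqI)
        (simp_all add: s \<eta> \<eta>')
    moreover have "\<eta> (Cod C f) \<cdot>\<^bsub>C\<^esub> f = fmap G (fmap F f) \<cdot>\<^bsub>C\<^esub> \<eta> (Dom C f)"
      if "f \<in> Ar C" for f
      using that by (intro eqI) (simp_all add: s \<eta>)
    ultimately show ?thesis
      by (auto simp: nat_iso_def nat_trans_def comp_ftr_def id_ftr_def s \<eta>)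
  qed
  then show ?thesis
    using F G \<epsilon> unfolding is_equivalence_def by blast
qed

section \<open>Presheaves of sets\<close>

lemma set_cat_hom: "m \<in> hom set_cat A B \<longleftrightarrow> (\<exists>f \<in> A \<rightarrow>\<^sub>E B. m = (A, B, f))"
  by (auto simp: set_cat_def hom_def)

lemma set_map_app_in: "\<lbrakk>m \<in> hom set_cat A B; a \<in> A\<rbrakk> \<Longrightarrow> app m a \<in> B"
  by (auto simp: set_cat_hom app_def)

lemma set_map_eqI:
  assumes "m \<in> hom set_cat A B" "n \<in> hom set_cat A B" "\<And>a. a \<in> A \<Longrightarrow> app m a = app n a"
  shows "m = n"
  using assms by (auto simp: set_cat_hom app_def intro: PiE_ext)

lemma app_set_cat_Comp:
  assumes "m \<in> hom set_cat A B" "n \<in> hom set_cat B E" "a \<in> A"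
  shows "app (n \<cdot>\<^bsub>set_cat\<^esub> m) a = app n (app m a)"
proof -
  obtain f g where "m = (A, B, f)" "n = (B, E, g)" using assms by (auto simp: set_cat_hom)
  then show ?thesis using assms(3) by (simp add: app_def set_cat_def compose_def)
qed

lemma app_set_cat_Idn: "a \<in> A \<Longrightarrow> app (Idn set_cat A) a = a"
  by (simp add: set_cat_def app_def)

context category
begin

lemma op_cat_simps:
  "Ob (op_cat C) = Ob C" "Ar (op_cat C) = Ar C" "Dom (op_cat C) = Cod C" "Cod (op_cat C) = Dom C"
  "Idn (op_cat C) = Idn C" "g \<cdot>\<^bsub>op_cat C\<^esub> f = f \<cdot> g" "hom (op_cat C) X Y = hom C Y X"
  by (auto simp: op_cat_def hom_def)

lemma presheaf_map_in_hom:
  assumes "is_presheaf C G" "f \<in> Ar C"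
  shows "fmap G f \<in> hom set_cat (fobj G (Cod C f)) (fobj G (Dom C f))"
  using cat_functor.fmap_in_hom[of "op_cat C" set_cat G f "Cod C f" "Dom C f"] assms
  by (simp add: is_presheaf_def op_cat_simps hom_def)

lemma restr_in:
  assumes "is_presheaf C G" "f \<in> Ar C" "a \<in> fobj G (Cod C f)"
  shows "app (fmap G f) a \<in> fobj G (Dom C f)"
  using set_map_app_in[OF presheaf_map_in_hom[OF assms(1,2)] assms(3)] .

lemma restr_Idn:
  assumes "is_presheaf C G" "X \<in> Ob C" "a \<in> fobj G X"
  shows "app (fmap G (Idn C X)) a = a"
  using cat_functor.fmap_Idn[of "op_cat C" set_cat G X] assms
  by (simp add: is_presheaf_def op_cat_simps app_set_cat_Idn)

lemma restr_Comp:
  assumes "is_presheaf C G" "g \<in> Ar C" "f \<in> Ar C" "Cod C f = Dom C g" "a \<in> fobj G (Cod C g)"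
  shows "app (fmap G (g \<cdot> f)) a = app (fmap G f) (app (fmap G g) a)"
proof -
  have "fmap G (g \<cdot> f) = fmap G f \<cdot>\<^bsub>set_cat\<^esub> fmap G g"
    using cat_functor.fmap_Comp_Ar[of "op_cat C" set_cat G f g] assms
    by (simp add: is_presheaf_def op_cat_simps)
  then show ?thesis
    using app_set_cat_Comp[OF presheaf_map_in_hom[OF assms(1,2)], of "fmap G f" _ a]
      presheaf_map_in_hom[OF assms(1,3)] assms(4,5) by simp
qed

lemmas restr_simps = restr_in restr_Idn restr_Comp

end

definition mk_presheaf ::
    "('o, 'm) cat \<Rightarrow> ('o \<Rightarrow> 'v set) \<Rightarrow> ('m \<Rightarrow> 'v \<Rightarrow> 'v) \<Rightarrow> ('o, 'm, 'v) presheaf" where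
  "mk_presheaf C P r =
     \<lparr>fobj = (\<lambda>X \<in> Ob C. P X),
      fmap = (\<lambda>f \<in> Ar C. (P (Cod C f), P (Dom C f), \<lambda>a \<in> P (Cod C f). r f a))\<rparr>"

lemma mk_presheaf_simps:
  "X \<in> Ob C \<Longrightarrow> fobj (mk_presheaf C P r) X = P X"
  "\<lbrakk>f \<in> Ar C; a \<in> P (Cod C f)\<rbrakk> \<Longrightarrow> app (fmap (mk_presheaf C P r) f) a = r f a"
  by (simp_all add: mk_presheaf_def app_def)

lemma (in category) is_presheaf_mk_presheaf:
  assumes r: "\<And>f a. \<lbrakk>f \<in> Ar C; a \<in> P (Cod C f)\<rbrakk> \<Longrightarrow> r f a \<in> P (Dom C f)"
    and r_Idn: "\<And>X a. \<lbrakk>X \<in> Ob C; a \<in> P X\<rbrakk> \<Longrightarrow> r (Idn C X) a = a"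
    and r_Comp: "\<And>g f a. \<lbrakk>g \<in> Ar C; f \<in> Ar C; Cod C f = Dom C g; a \<in> P (Cod C g)\<rbrakk>
       \<Longrightarrow> r (g \<cdot> f) a = r f (r g a)"
  shows "is_presheaf C (mk_presheaf C P r)"
proof -
  interpret op: category "op_cat C" by (rule category_op_cat)
  interpret S: category set_cat by (rule category_set_cat)
  have r_in: "r f a \<in> P X" if "f \<in> Ar C" "a \<in> P (Cod C f)" "Dom C f = X" for f a X
    using r that by blast
  show ?thesis
    unfolding is_presheaf_def
  proof
    show "fobj (mk_presheaf C P r) X \<in> Ob set_cat" for X by (simp add: set_cat_def)
    show "fmap (mk_presheaf C P r) f
        \<in> hom set_cat (fobj (mk_presheaf C P r) X) (fobj (mk_presheaf C P r) Y)"
      if "f \<in> hom (op_cat C) X Y" for f X Y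
      using that r by (auto simp: op_cat_simps mk_presheaf_def hom_def cat_simps set_cat_def)
    show "fmap (mk_presheaf C P r) (Idn (op_cat C) X) = Idn set_cat (fobj (mk_presheaf C P r) X)"
      if "X \<in> Ob (op_cat C)" for X
      using that r_Idn
      by (auto simp: op_cat_simps mk_presheaf_def cat_simps set_cat_def restrict_def fun_eq_iff)
    show "fmap (mk_presheaf C P r) (g \<cdot>\<^bsub>op_cat C\<^esub> f)
        = fmap (mk_presheaf C P r) g \<cdot>\<^bsub>set_cat\<^esub> fmap (mk_presheaf C P r) f"
      if "g \<in> hom (op_cat C) Y Z" "f \<in> hom (op_cat C) X Y" for g f X Y Z
      using that r_Comp r_in
      by (auto simp: op_cat_simps mk_presheaf_def cat_simps set_cat_def restrict_def fun_eq_iff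
          hom_def compose_def)
  qed (simp_all add: mk_presheaf_def op_cat_simps)
qed

lemma is_presheaf_comp_ftr:
  assumes "cat_functor C D F" "is_presheaf D G"
  shows "is_presheaf C (comp_ftr C G F)"
proof -
  interpret cat_functor C D F by fact
  interpret op: category "op_cat C" by (rule C.category_op_cat)
  interpret S: category set_cat by (rule category_set_cat)
  interpret G: cat_functor "op_cat D" set_cat G using assms by (simp add: is_presheaf_def)
  show ?thesis
    unfolding is_presheaf_def
  proof
    show "fobj (comp_ftr C G F) X \<in> Ob set_cat" for X by (simp add: set_cat_def)
    show "fmap (comp_ftr C G F) f \<in> hom set_cat (fobj (comp_ftr C G F) X) (fobj (comp_ftr C G F) Y)"
      if "f \<in> hom (op_cat C) X Y" for f X Y
      using that D.presheaf_map_in_hom[OF assms(2), of "fmap F f"] 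
      by (auto simp: comp_ftr_def C.op_cat_simps hom_def ftr_simps C.cat_simps)
  next
    fix X assume "X \<in> Ob (op_cat C)"
    then show "fmap (comp_ftr C G F) (Idn (op_cat C) X) = Idn set_cat (fobj (comp_ftr C G F) X)"
      using G.fmap_Idn
      by (simp add: comp_ftr_def C.op_cat_simps D.op_cat_simps ftr_simps C.cat_simps)
  next
    fix g f X Y Z assume "g \<in> hom (op_cat C) Y Z" "f \<in> hom (op_cat C) X Y"
    then show "fmap (comp_ftr C G F) (g \<cdot>\<^bsub>op_cat C\<^esub> f)
        = fmap (comp_ftr C G F) g \<cdot>\<^bsub>set_cat\<^esub> fmap (comp_ftr C G F) f"
      using G.fmap_Comp_Ar[of "fmap F g" "fmap F f"]
      by (auto simp: comp_ftr_def C.op_cat_simps D.op_cat_simps hom_def ftr_simps C.cat_simps)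
  qed (simp_all add: comp_ftr_def C.op_cat_simps)
qed

context category
begin

lemma presheaf_nat_transI:
  assumes "is_presheaf C G" "is_presheaf C H" "\<tau> \<in> extensional (Ob C)"
    and \<tau>: "\<And>X. X \<in> Ob C \<Longrightarrow> \<tau> X \<in> hom set_cat (fobj G X) (fobj H X)"
    and nat: "\<And>f a. \<lbrakk>f \<in> Ar C; a \<in> fobj G (Cod C f)\<rbrakk> \<Longrightarrow>
      app (\<tau> (Dom C f)) (app (fmap G f) a) = app (fmap H f) (app (\<tau> (Cod C f)) a)"
  shows "nat_trans (op_cat C) set_cat G H \<tau>"
proof -
  interpret S: category set_cat by (rule category_set_cat)
  have "\<tau> (Dom C f) \<cdot>\<^bsub>set_cat\<^esub> fmap G f = fmap H f \<cdot>\<^bsub>set_cat\<^esub> \<tau> (Cod C f)" if f: "f \<in> Ar C" for f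
  proof (rule set_map_eqI)
    note m = presheaf_map_in_hom[OF assms(1) f] presheaf_map_in_hom[OF assms(2) f]
      \<tau>[OF Dom_in_Ob[OF f]] \<tau>[OF Cod_in_Ob[OF f]]
    show "\<tau> (Dom C f) \<cdot>\<^bsub>set_cat\<^esub> fmap G f \<in> hom set_cat (fobj G (Cod C f)) (fobj H (Dom C f))"
      "fmap H f \<cdot>\<^bsub>set_cat\<^esub> \<tau> (Cod C f) \<in> hom set_cat (fobj G (Cod C f)) (fobj H (Dom C f))"
      using m by (auto intro: S.Comp_in_hom)
    show "app (\<tau> (Dom C f) \<cdot>\<^bsub>set_cat\<^esub> fmap G f) a = app (fmap H f \<cdot>\<^bsub>set_cat\<^esub> \<tau> (Cod C f)) a"
      if "a \<in> fobj G (Cod C f)" for a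
      using nat[OF f that] app_set_cat_Comp[OF m(1,3) that] app_set_cat_Comp[OF m(4,2) that]
      by simp
  qed
  then show ?thesis
    using assms by (simp add: nat_trans_def is_presheaf_def op_cat_simps)
qed

lemma presheaf_nat_transD:
  assumes "nat_trans (op_cat C) set_cat G H \<tau>"
  shows "is_presheaf C G" "is_presheaf C H" "\<tau> \<in> extensional (Ob C)"
    "X \<in> Ob C \<Longrightarrow> \<tau> X \<in> hom set_cat (fobj G X) (fobj H X)"
    "\<lbrakk>X \<in> Ob C; a \<in> fobj G X\<rbrakk> \<Longrightarrow> app (\<tau> X) a \<in> fobj H X"
    "\<lbrakk>f \<in> Ar C; a \<in> fobj G (Cod C f)\<rbrakk> \<Longrightarrow>
      app (\<tau> (Dom C f)) (app (fmap G f) a) = app (fmap H f) (app (\<tau> (Cod C f)) a)"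
proof -
  show ps: "is_presheaf C G" "is_presheaf C H" and "\<tau> \<in> extensional (Ob C)"
    using assms by (simp_all add: nat_trans_def is_presheaf_def op_cat_simps)
  show \<tau>: "\<tau> X \<in> hom set_cat (fobj G X) (fobj H X)" if "X \<in> Ob C" for X
    using assms that by (simp add: nat_trans_def op_cat_simps)
  show "app (\<tau> X) a \<in> fobj H X" if "X \<in> Ob C" "a \<in> fobj G X"
    using set_map_app_in[OF \<tau>[OF that(1)] that(2)] .
  assume f: "f \<in> Ar C" and a: "a \<in> fobj G (Cod C f)"
  have "\<tau> (Dom C f) \<cdot>\<^bsub>set_cat\<^esub> fmap G f = fmap H f \<cdot>\<^bsub>set_cat\<^esub> \<tau> (Cod C f)"
    using assms f by (simp add: nat_trans_def op_cat_simps)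
  then show "app (\<tau> (Dom C f)) (app (fmap G f) a) = app (fmap H f) (app (\<tau> (Cod C f)) a)"
    using app_set_cat_Comp[OF presheaf_map_in_hom[OF ps(1) f] \<tau>[OF Dom_in_Ob[OF f]] a]
      app_set_cat_Comp[OF \<tau>[OF Cod_in_Ob[OF f]] presheaf_map_in_hom[OF ps(2) f] a] by simp
qed

lemma category_sheaf_cat: "category (sheaf_cat C J)"
  unfolding sheaf_cat_def
  by (intro category.category_full_subcat category_functor_cat category_op_cat category_set_cat)

end

lemma sheaf_cat_Ob: "G \<in> Ob (sheaf_cat C J) \<longleftrightarrow> is_sheaf C J G"
  by (auto simp: sheaf_cat_def full_subcat_def functor_cat_def is_sheaf_def is_presheaf_def)

lemma sheaf_cat_hom:
  "m \<in> hom (sheaf_cat C J) G H \<longleftrightarrow>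
     is_sheaf C J G \<and> is_sheaf C J H \<and> (\<exists>\<tau>. m = (G, H, \<tau>) \<and> nat_trans (op_cat C) set_cat G H \<tau>)"
  by (auto simp: sheaf_cat_def full_subcat_def functor_cat_def hom_def)

lemma sheaf_cat_Idn:
  "Idn (sheaf_cat C J) G = (G, G, \<lambda>X \<in> Ob C. Idn set_cat (fobj G X))"
  by (simp add: sheaf_cat_def full_subcat_def functor_cat_def op_cat_def)

lemma sheaf_cat_Comp:
  "(G', H, \<sigma>) \<cdot>\<^bsub>sheaf_cat C J\<^esub> (G, G'', \<tau>) = (G, H, \<lambda>X \<in> Ob C. \<sigma> X \<cdot>\<^bsub>set_cat\<^esub> \<tau> X)"
  by (simp add: sheaf_cat_def full_subcat_def functor_cat_def op_cat_def)

text \<open>Pointwise inverses of a natural map are natural, and every natural map between sheaves is an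
  arrow of the category of sheaves.\<close>

lemma (in category) sheaf_cat_iso_if_bij:
  assumes G: "is_sheaf C J G" and H: "is_sheaf C J H"
    and \<tau>: "nat_trans (op_cat C) set_cat G H \<tau>"
    and bij: "\<And>X. X \<in> Ob C \<Longrightarrow> bij_betw (app (\<tau> X)) (fobj G X) (fobj H X)"
  shows "is_iso (sheaf_cat C J) (G, H, \<tau>)"
proof -
  interpret S: category set_cat by (rule category_set_cat)
  interpret sh: category "sheaf_cat C J" by (rule category_sheaf_cat)
  note \<tau>D = presheaf_nat_transD[OF \<tau>]
  define inv_\<tau> where "inv_\<tau> X = inv_into (fobj G X) (app (\<tau> X))" for X
  have inv: "inv_\<tau> X b \<in> fobj G X" "app (\<tau> X) (inv_\<tau> X b) = b" if "X \<in> Ob C" "b \<in> fobj H X" for X b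
    using bij[OF that(1)] that(2)
    by (auto simp: inv_\<tau>_def bij_betw_def inv_into_into f_inv_into_f)
  have inv': "inv_\<tau> X (app (\<tau> X) a) = a" if "X \<in> Ob C" "a \<in> fobj G X" for X a
    using bij_betw_inv_into_left[OF bij[OF that(1)] that(2)] by (simp add: inv_\<tau>_def)
  define \<sigma> where "\<sigma> = (\<lambda>X \<in> Ob C. (fobj H X, fobj G X, \<lambda>b \<in> fobj H X. inv_\<tau> X b))"
  have app_\<sigma>: "app (\<sigma> X) b = inv_\<tau> X b" if "X \<in> Ob C" "b \<in> fobj H X" for X b
    using that by (simp add: \<sigma>_def app_def)
  have \<sigma>_hom: "\<sigma> X \<in> hom set_cat (fobj H X) (fobj G X)" if "X \<in> Ob C" for X
    using that inv by (auto simp: \<sigma>_def set_cat_hom)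
  have \<sigma>: "nat_trans (op_cat C) set_cat H G \<sigma>"
  proof (rule presheaf_nat_transI)
    fix f b assume f: "f \<in> Ar C" and b: "b \<in> fobj H (Cod C f)"
    let ?a = "inv_\<tau> (Cod C f) b"
    have a: "?a \<in> fobj G (Cod C f)" "app (\<tau> (Cod C f)) ?a = b"
      using inv f b by (simp_all add: cat_simps)
    have "inv_\<tau> (Dom C f) (app (fmap H f) b)
        = inv_\<tau> (Dom C f) (app (\<tau> (Dom C f)) (app (fmap G f) ?a))"
      using \<tau>D(6)[OF f a(1)] a(2) by simp
    also have "\<dots> = app (fmap G f) ?a"
      using f a \<tau>D(1) by (intro inv') (simp_all add: cat_simps restr_simps)
    finally show "app (\<sigma> (Dom C f)) (app (fmap H f) b) = app (fmap G f) (app (\<sigma> (Cod C f)) b)"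
      using f b \<tau>D(2) by (simp add: app_\<sigma> cat_simps restr_simps)
  qed (use \<tau>D \<sigma>_hom in \<open>simp_all add: \<sigma>_def\<close>)
  have "\<sigma> X \<cdot>\<^bsub>set_cat\<^esub> \<tau> X = Idn set_cat (fobj G X)" if X: "X \<in> Ob C" for X
  proof (rule set_map_eqI)
    show "\<sigma> X \<cdot>\<^bsub>set_cat\<^esub> \<tau> X \<in> hom set_cat (fobj G X) (fobj G X)"
      using \<tau>D(4)[OF X] \<sigma>_hom[OF X] by (rule S.Comp_in_hom[rotated])
    show "Idn set_cat (fobj G X) \<in> hom set_cat (fobj G X) (fobj G X)"
      by (rule S.Idn_in_hom) (simp add: set_cat_def)
    show "app (\<sigma> X \<cdot>\<^bsub>set_cat\<^esub> \<tau> X) a = app (Idn set_cat (fobj G X)) a" if "a \<in> fobj G X" for a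
      using app_set_cat_Comp[OF \<tau>D(4)[OF X] \<sigma>_hom[OF X] that] that X \<tau>D(5)
      by (simp add: app_set_cat_Idn app_\<sigma> inv')
  qed
  moreover have "\<tau> X \<cdot>\<^bsub>set_cat\<^esub> \<sigma> X = Idn set_cat (fobj H X)" if X: "X \<in> Ob C" for X
  proof (rule set_map_eqI)
    show "\<tau> X \<cdot>\<^bsub>set_cat\<^esub> \<sigma> X \<in> hom set_cat (fobj H X) (fobj H X)"
      using \<sigma>_hom[OF X] \<tau>D(4)[OF X] by (rule S.Comp_in_hom[rotated])
    show "Idn set_cat (fobj H X) \<in> hom set_cat (fobj H X) (fobj H X)"
      by (rule S.Idn_in_hom) (simp add: set_cat_def)
    show "app (\<tau> X \<cdot>\<^bsub>set_cat\<^esub> \<sigma> X) a = app (Idn set_cat (fobj H X)) a" if "a \<in> fobj H X" for a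
      using app_set_cat_Comp[OF \<sigma>_hom[OF X] \<tau>D(4)[OF X] that] that X
      by (simp add: app_set_cat_Idn app_\<sigma> inv)
  qed
  ultimately have "(H, G, \<sigma>) \<cdot>\<^bsub>sheaf_cat C J\<^esub> (G, H, \<tau>) = Idn (sheaf_cat C J) G"
    "(G, H, \<tau>) \<cdot>\<^bsub>sheaf_cat C J\<^esub> (H, G, \<sigma>) = Idn (sheaf_cat C J) H"
    by (auto simp: sheaf_cat_Comp sheaf_cat_Idn restrict_def fun_eq_iff)
  then show ?thesis
    using sh.is_isoI[of "(G, H, \<tau>)" G H "(H, G, \<sigma>)"] G H \<sigma> \<tau> by (simp add: sheaf_cat_hom)
qed

section \<open>Sieves and the sheaf condition\<close>

definition sheaf_for_sieve :: "('o, 'm) cat \<Rightarrow> ('o, 'm, 'v) presheaf \<Rightarrow> 'o \<Rightarrow> 'm set \<Rightarrow> bool" where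
  "sheaf_for_sieve C G X S \<longleftrightarrow> (\<forall>x. matching_family C G S x \<longrightarrow>
     (\<exists>!a. a \<in> fobj G X \<and> (\<forall>f \<in> S. app (fmap G f) a = x f)))"

lemma is_sheaf_iff:
  "is_sheaf C J G \<longleftrightarrow> is_presheaf C G \<and> (\<forall>X \<in> Ob C. \<forall>S \<in> J X. sheaf_for_sieve C G X S)"
  by (simp add: is_sheaf_def sheaf_for_sieve_def)

lemma matching_familyD:
  assumes "matching_family C G S x" "f \<in> S"
  shows "x f \<in> fobj G (Dom C f)"
    and "\<lbrakk>g \<in> Ar C; Cod C g = Dom C f\<rbrakk> \<Longrightarrow> app (fmap G g) (x f) = x (f \<cdot>\<^bsub>C\<^esub> g)"
  using assms by (simp_all add: matching_family_def)

text \<open>The sheaf condition for a family, phrased without sieves. For a representable presheaf it is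
  the universal property in the definition of effective epimorphic families.\<close>

definition sheaf_for_family ::
    "('o, 'm) cat \<Rightarrow> ('o, 'm, 'v) presheaf \<Rightarrow> 'o \<Rightarrow> 'i set \<Rightarrow> ('i \<Rightarrow> 'm) \<Rightarrow> bool" where
  "sheaf_for_family C G B I \<pi> \<longleftrightarrow>
     (\<forall>x. (\<forall>i \<in> I. x i \<in> fobj G (Dom C (\<pi> i))) \<longrightarrow>
        (\<forall>i \<in> I. \<forall>j \<in> I. \<forall>Z \<in> Ob C.
           \<forall>g \<in> hom C Z (Dom C (\<pi> i)). \<forall>h \<in> hom C Z (Dom C (\<pi> j)).
             \<pi> i \<cdot>\<^bsub>C\<^esub> g = \<pi> j \<cdot>\<^bsub>C\<^esub> h \<longrightarrow> app (fmap G g) (x i) = app (fmap G h) (x j)) \<longrightarrow>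
        (\<exists>!a. a \<in> fobj G B \<and> (\<forall>i \<in> I. app (fmap G (\<pi> i)) a = x i)))"

lemma sheaf_for_familyD:
  assumes "sheaf_for_family C G B I \<pi>"
    and x: "\<And>i. i \<in> I \<Longrightarrow> x i \<in> fobj G (Dom C (\<pi> i))"
    and compat: "\<And>i j Z g h. \<lbrakk>i \<in> I; j \<in> I; Z \<in> Ob C; g \<in> hom C Z (Dom C (\<pi> i));
      h \<in> hom C Z (Dom C (\<pi> j)); \<pi> i \<cdot>\<^bsub>C\<^esub> g = \<pi> j \<cdot>\<^bsub>C\<^esub> h\<rbrakk>
      \<Longrightarrow> app (fmap G g) (x i) = app (fmap G h) (x j)"
  shows "\<exists>!a. a \<in> fobj G B \<and> (\<forall>i \<in> I. app (fmap G (\<pi> i)) a = x i)"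
proof (rule assms(1)[unfolded sheaf_for_family_def, THEN spec[of _ x], THEN mp, THEN mp])
  show "\<forall>i \<in> I. x i \<in> fobj G (Dom C (\<pi> i))"
    using x by blast
  show "\<forall>i \<in> I. \<forall>j \<in> I. \<forall>Z \<in> Ob C.
      \<forall>g \<in> hom C Z (Dom C (\<pi> i)). \<forall>h \<in> hom C Z (Dom C (\<pi> j)).
        \<pi> i \<cdot>\<^bsub>C\<^esub> g = \<pi> j \<cdot>\<^bsub>C\<^esub> h \<longrightarrow> app (fmap G g) (x i) = app (fmap G h) (x j)"
    by (intro ballI impI) (rule compat)
qed

context category
begin

lemma is_sieve_pullback_sieve:
  assumes "is_sieve C X S" "f \<in> Ar C" "Cod C f = X"
  shows "is_sieve C (Dom C f) (pullback_sieve C f S)"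
proof -
  have S: "h \<cdot> k \<in> S" if "h \<in> S" "k \<in> Ar C" "Cod C k = Dom C h" for h k
    using assms that by (simp add: is_sieve_def)
  have "f \<cdot> (g \<cdot> k) \<in> S"
    if "f \<cdot> g \<in> S" "g \<in> Ar C" "Cod C g = Dom C f" "k \<in> Ar C" "Cod C k = Dom C g" for g k
    using S[OF that(1,4)] that(2-5) assms(2) by (simp add: Comp_simps Comp_assoc_Ar)
  then show ?thesis by (auto simp: is_sieve_def pullback_sieve_def Comp_simps)
qed

lemma is_sieve_maximal: "is_sieve C X {f \<in> Ar C. Cod C f = X}"
  by (auto simp: is_sieve_def cat_simps)

lemma generated_sieve_member:
  assumes "family_over C B I \<pi>" "i \<in> I" "h \<in> Ar C" "Cod C h = Dom C (\<pi> i)"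
  shows "\<pi> i \<cdot> h \<in> generated_sieve C B I \<pi>"
proof -
  have "\<pi> i \<in> Ar C" "Cod C (\<pi> i) = B" using assms by (simp_all add: family_over_def)
  moreover from this have "h \<in> hom C (Dom C (\<pi> i \<cdot> h)) (Dom C (\<pi> i))"
    using assms by (simp add: cat_simps hom_def)
  ultimately show ?thesis
    using assms unfolding generated_sieve_def by (auto simp: cat_simps)
qed

lemma generated_sieveE:
  assumes "f \<in> generated_sieve C B I \<pi>"
  obtains i h where "i \<in> I" "h \<in> Ar C" "Cod C h = Dom C (\<pi> i)" "f = \<pi> i \<cdot> h"
  using assms by (auto simp: generated_sieve_def hom_def)

lemma is_sieve_generated_sieve:
  assumes \<pi>: "family_over C B I \<pi>"
  shows "is_sieve C B (generated_sieve C B I \<pi>)"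
proof -
  have "f \<cdot> g \<in> generated_sieve C B I \<pi>"
    if f: "f \<in> generated_sieve C B I \<pi>" and g: "g \<in> Ar C" "Cod C g = Dom C f" for f g
  proof -
    obtain i h where ih: "i \<in> I" "h \<in> Ar C" "Cod C h = Dom C (\<pi> i)" "f = \<pi> i \<cdot> h"
      using f by (rule generated_sieveE)
    have "\<pi> i \<in> Ar C" using ih \<pi> by (simp add: family_over_def)
    then have "f \<cdot> g = \<pi> i \<cdot> (h \<cdot> g)" "h \<cdot> g \<in> Ar C" "Cod C (h \<cdot> g) = Dom C (\<pi> i)"
      using Comp_assoc_Ar[of "\<pi> i" h g] ih(2-4) g by (simp_all add: cat_simps)
    then show ?thesis using generated_sieve_member[OF \<pi> ih(1)] by simp
  qed
  then show ?thesis by (auto simp: is_sieve_def generated_sieve_def)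
qed

lemma pullback_sieve_Comp:
  assumes "f \<in> Ar C" "g \<in> Ar C" "Cod C g = Dom C f"
  shows "pullback_sieve C g (pullback_sieve C f S) = pullback_sieve C (f \<cdot> g) S"
  using assms by (auto simp: pullback_sieve_def Comp_simps Comp_assoc_Ar)

lemma pullback_sieve_Idn:
  assumes "is_sieve C X S" "X \<in> Ob C"
  shows "pullback_sieve C (Idn C X) S = S"
  using assms by (auto simp: pullback_sieve_def Idn_simps Idn_Comp is_sieve_def)

lemma pullback_sieve_member:
  assumes "is_sieve C X S" "f \<in> S"
  shows "pullback_sieve C f S = {g \<in> Ar C. Cod C g = Dom C f}"
  using assms by (auto simp: pullback_sieve_def is_sieve_def)

lemma generated_sieve_generator:
  assumes "family_over C B I \<pi>" "i \<in> I"
  shows "\<pi> i \<in> generated_sieve C B I \<pi>"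
  using generated_sieve_member[OF assms, of "Idn C (Dom C (\<pi> i))"] assms
  by (simp add: family_over_def cat_simps)

lemma generated_sieve_subset:
  assumes "is_sieve C B S" "\<And>i. i \<in> I \<Longrightarrow> \<pi> i \<in> S"
  shows "generated_sieve C B I \<pi> \<subseteq> S"
proof
  fix f assume "f \<in> generated_sieve C B I \<pi>"
  then obtain i h where "i \<in> I" "h \<in> hom C (Dom C f) (Dom C (\<pi> i))" "f = \<pi> i \<cdot> h"
    by (auto simp: generated_sieve_def)
  then show "f \<in> S" using assms by (auto simp: is_sieve_def hom_def)
qed

text \<open>A compatible family \<open>x\<close> is extended to the generated sieve by restricting \<open>x i\<close> along \<open>h\<close> at
  the arrow \<open>\<pi> i \<cdot> h\<close>; compatibility says exactly that this does not depend on how an arrow of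
  the sieve factors.\<close>

lemma sheaf_for_family_if_generated_sieve:
  assumes G: "is_presheaf C G" and \<pi>: "family_over C B I \<pi>"
    and S: "sheaf_for_sieve C G B (generated_sieve C B I \<pi>)"
  shows "sheaf_for_family C G B I \<pi>"
proof -
  let ?S = "generated_sieve C B I \<pi>"
  have \<pi>_Ar: "\<pi> i \<in> Ar C" "Cod C (\<pi> i) = B" if "i \<in> I" for i
    using \<pi> that by (auto simp: family_over_def)
  show ?thesis
    unfolding sheaf_for_family_def
  proof (intro allI impI)
    fix x
    assume x: "\<forall>i \<in> I. x i \<in> fobj G (Dom C (\<pi> i))"
      and compat: "\<forall>i \<in> I. \<forall>j \<in> I. \<forall>Z \<in> Ob C.
         \<forall>g \<in> hom C Z (Dom C (\<pi> i)). \<forall>h \<in> hom C Z (Dom C (\<pi> j)).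
           \<pi> i \<cdot> g = \<pi> j \<cdot> h \<longrightarrow> app (fmap G g) (x i) = app (fmap G h) (x j)"
    have "\<forall>f \<in> ?S. \<exists>p. fst p \<in> I \<and> snd p \<in> hom C (Dom C f) (Dom C (\<pi> (fst p))) \<and>
        f = \<pi> (fst p) \<cdot> snd p"
      by (force simp: generated_sieve_def)
    then obtain p where p: "\<forall>f \<in> ?S. fst (p f) \<in> I \<and>
        snd (p f) \<in> hom C (Dom C f) (Dom C (\<pi> (fst (p f)))) \<and> f = \<pi> (fst (p f)) \<cdot> snd (p f)"
      by (rule bchoice[THEN exE])
    \<comment> \<open>A chosen factorisation \<open>f = \<pi> (ix f) \<cdot> fac f\<close> of each arrow of the sieve.\<close>
    define ix fac where "ix f = fst (p f)" and "fac f = snd (p f)" for f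
    have fac: "ix f \<in> I" "fac f \<in> hom C (Dom C f) (Dom C (\<pi> (ix f)))" "f = \<pi> (ix f) \<cdot> fac f"
      if "f \<in> ?S" for f
      using p that unfolding ix_def fac_def by blast+
    define y where "y f = app (fmap G (fac f)) (x (ix f))" for f
    have y: "y (\<pi> i \<cdot> h) = app (fmap G h) (x i)"
      if "i \<in> I" "h \<in> Ar C" "Cod C h = Dom C (\<pi> i)" for i h
    proof -
      have f: "\<pi> i \<cdot> h \<in> ?S" using generated_sieve_member[OF \<pi> that] .
      have "h \<in> hom C (Dom C h) (Dom C (\<pi> i))" "Dom C (\<pi> i \<cdot> h) = Dom C h"
        using that \<pi>_Ar by (simp_all add: hom_def cat_simps)
      then show ?thesis
        using compat[rule_format, OF fac(1)[OF f] that(1) Dom_in_Ob[OF that(2)] _ _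
            fac(3)[OF f, symmetric]] fac(2)[OF f]
        by (simp add: y_def)
    qed
    have "matching_family C G ?S y"
      unfolding matching_family_def
    proof (intro conjI ballI impI)
      fix f assume f: "f \<in> ?S"
      have fac_f: "fac f \<in> Ar C" "Cod C (fac f) = Dom C (\<pi> (ix f))" "Dom C (fac f) = Dom C f"
        using fac(2)[OF f] by (auto simp: hom_def)
      show "y f \<in> fobj G (Dom C f)"
        using fac_f x fac(1)[OF f] restr_in[OF G, of "fac f" "x (ix f)"]
        by (simp add: y_def)
      fix g assume g: "g \<in> Ar C" "Cod C g = Dom C f"
      have "f \<cdot> g = \<pi> (ix f) \<cdot> (fac f \<cdot> g)"
        using fac(3)[OF f] fac_f g \<pi>_Ar[OF fac(1)[OF f]] by (metis Comp_assoc_Ar)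
      then show "app (fmap G g) (y f) = y (f \<cdot> g)"
        using y[OF fac(1)[OF f], of "fac f \<cdot> g"] fac_f g x fac(1)[OF f] G
        by (simp add: y_def cat_simps restr_simps)
    qed
    then have "\<exists>!a. a \<in> fobj G B \<and> (\<forall>f \<in> ?S. app (fmap G f) a = y f)"
      using S by (simp add: sheaf_for_sieve_def)
    moreover have "(\<forall>f \<in> ?S. app (fmap G f) a = y f) \<longleftrightarrow> (\<forall>i \<in> I. app (fmap G (\<pi> i)) a = x i)"
      if a: "a \<in> fobj G B" for a
    proof
      assume *: "\<forall>f \<in> ?S. app (fmap G f) a = y f"
      show "\<forall>i \<in> I. app (fmap G (\<pi> i)) a = x i"
      proof
        fix i assume i: "i \<in> I"
        then show "app (fmap G (\<pi> i)) a = x i"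
          using * generated_sieve_generator[OF \<pi> i] y[of i "Idn C (Dom C (\<pi> i))"] \<pi>_Ar x G
          by (simp add: cat_simps restr_simps)
      qed
    next
      assume *: "\<forall>i \<in> I. app (fmap G (\<pi> i)) a = x i"
      show "\<forall>f \<in> ?S. app (fmap G f) a = y f"
      proof
        fix f assume f: "f \<in> ?S"
        have "fac f \<in> Ar C" "Cod C (fac f) = Dom C (\<pi> (ix f))"
          using fac(2)[OF f] by (auto simp: hom_def)
        then have "app (fmap G (\<pi> (ix f) \<cdot> fac f)) a = y f"
          using restr_Comp[OF G, of "\<pi> (ix f)" "fac f" a] * a \<pi>_Ar fac(1)[OF f]
          by (simp add: y_def)
        then show "app (fmap G f) a = y f" unfolding fac(3)[OF f, symmetric] .
      qed
    qed
    ultimately show "\<exists>!a. a \<in> fobj G B \<and> (\<forall>i \<in> I. app (fmap G (\<pi> i)) a = x i)"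
      by (metis (no_types, lifting))
  qed
qed

text \<open>A matching family on the generated sieve is determined by its values at the generators.\<close>

lemma sheaf_for_generated_sieve_if_family:
  assumes G: "is_presheaf C G" and \<pi>: "family_over C B I \<pi>"
    and F: "sheaf_for_family C G B I \<pi>"
  shows "sheaf_for_sieve C G B (generated_sieve C B I \<pi>)"
proof -
  let ?S = "generated_sieve C B I \<pi>"
  have \<pi>_Ar: "\<pi> i \<in> Ar C" "Cod C (\<pi> i) = B" if "i \<in> I" for i
    using \<pi> that by (auto simp: family_over_def)
  show ?thesis
    unfolding sheaf_for_sieve_def
  proof (intro allI impI)
    fix y
    assume y: "matching_family C G ?S y"
    have y\<pi>: "y (\<pi> i \<cdot> h) = app (fmap G h) (y (\<pi> i))"
      if "i \<in> I" "h \<in> hom C Z (Dom C (\<pi> i))" for i h Z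
      using matching_familyD(2)[OF y generated_sieve_generator[OF \<pi> that(1)] homD(1,3)[OF that(2)]] by simp
    have "\<exists>!a. a \<in> fobj G B \<and> (\<forall>i \<in> I. app (fmap G (\<pi> i)) a = y (\<pi> i))"
    proof (rule sheaf_for_familyD[OF F, where x = "\<lambda>i. y (\<pi> i)"])
      show "y (\<pi> i) \<in> fobj G (Dom C (\<pi> i))" if "i \<in> I" for i
        using matching_familyD(1)[OF y generated_sieve_generator[OF \<pi> that]] .
      show "app (fmap G g) (y (\<pi> i)) = app (fmap G h) (y (\<pi> j))"
        if "i \<in> I" "j \<in> I" "g \<in> hom C Z (Dom C (\<pi> i))" "h \<in> hom C Z (Dom C (\<pi> j))"
          "\<pi> i \<cdot> g = \<pi> j \<cdot> h" for i j Z g h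
        using y\<pi>[OF that(1,3)] y\<pi>[OF that(2,4)] that(5) by simp
    qed
    moreover have "(\<forall>f \<in> ?S. app (fmap G f) a = y f) \<longleftrightarrow> (\<forall>i \<in> I. app (fmap G (\<pi> i)) a = y (\<pi> i))"
      if a: "a \<in> fobj G B" for a
    proof
      assume *: "\<forall>i \<in> I. app (fmap G (\<pi> i)) a = y (\<pi> i)"
      show "\<forall>f \<in> ?S. app (fmap G f) a = y f"
      proof
        fix f assume "f \<in> ?S"
        then obtain i h where ih: "i \<in> I" "h \<in> hom C (Dom C f) (Dom C (\<pi> i))" "f = \<pi> i \<cdot> h"
          by (auto simp: generated_sieve_def)
        have "app (fmap G (\<pi> i \<cdot> h)) a = y (\<pi> i \<cdot> h)"
          using restr_Comp[OF G, of "\<pi> i" h a] * a \<pi>_Ar ih(1,2) y\<pi>[OF ih(1,2)]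
          by (simp add: hom_def)
        then show "app (fmap G f) a = y f" using ih(3) by simp
      qed
    next
      assume "\<forall>f \<in> ?S. app (fmap G f) a = y f"
      then show "\<forall>i \<in> I. app (fmap G (\<pi> i)) a = y (\<pi> i)"
        using generated_sieve_generator[OF \<pi>] by simp
    qed
    ultimately show "\<exists>!a. a \<in> fobj G B \<and> (\<forall>f \<in> ?S. app (fmap G f) a = y f)"
      by (metis (no_types, lifting))
  qed
qed

text \<open>The restrictions of \<open>a\<close> to the sieve form a matching family, of which \<open>a\<close> and \<open>b\<close> are both
  amalgamations.\<close>

lemma sheaf_for_sieve_eq:
  assumes "sheaf_for_sieve C G X S" "is_presheaf C G" "is_sieve C X S"
    "a \<in> fobj G X" "b \<in> fobj G X"
    "\<And>f. f \<in> S \<Longrightarrow> app (fmap G f) a = app (fmap G f) b"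
  shows "a = b"
proof -
  have "matching_family C G S (\<lambda>f. app (fmap G f) a)"
    using assms(2-4) by (auto simp: matching_family_def is_sieve_def restr_simps subset_iff)
  then show ?thesis using assms unfolding sheaf_for_sieve_def by metis
qed

end

section \<open>Topologies\<close>

context category
begin

lemma is_sieveD:
  assumes "is_sieve C X S" "f \<in> S"
  shows "f \<in> Ar C" "Cod C f = X" "\<lbrakk>g \<in> Ar C; Cod C g = Dom C f\<rbrakk> \<Longrightarrow> f \<cdot> g \<in> S"
  using assms by (auto simp: is_sieve_def)

lemma pullback_sieve_iff:
  "g \<in> pullback_sieve C f S \<longleftrightarrow> g \<in> Ar C \<and> Cod C g = Dom C f \<and> f \<cdot> g \<in> S"
  by (simp add: pullback_sieve_def)

lemma topology_sieve:
  "\<lbrakk>grothendieck_topology C J; X \<in> Ob C; S \<in> J X\<rbrakk> \<Longrightarrow> is_sieve C X S"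
  by (simp add: grothendieck_topology_def)

lemma topology_maximal:
  "\<lbrakk>grothendieck_topology C J; X \<in> Ob C\<rbrakk> \<Longrightarrow> {f \<in> Ar C. Cod C f = X} \<in> J X"
  by (simp add: grothendieck_topology_def)

lemma topology_pullback:
  "\<lbrakk>grothendieck_topology C J; f \<in> Ar C; S \<in> J (Cod C f)\<rbrakk> \<Longrightarrow> pullback_sieve C f S \<in> J (Dom C f)"
  by (simp add: grothendieck_topology_def)

lemma topology_transitive:
  assumes "grothendieck_topology C J" "X \<in> Ob C" "S \<in> J X" "is_sieve C X R"
    "\<And>f. f \<in> S \<Longrightarrow> pullback_sieve C f R \<in> J (Dom C f)"
  shows "R \<in> J X"
proof -
  have "\<forall>X \<in> Ob C. \<forall>S \<in> J X. \<forall>R. is_sieve C X R \<and>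
      (\<forall>f \<in> S. pullback_sieve C f R \<in> J (Dom C f)) \<longrightarrow> R \<in> J X"
    using assms(1) unfolding grothendieck_topology_def by (elim conjE)
  from this[rule_format, OF assms(2,3)] show ?thesis
    using assms(4,5) by blast
qed

text \<open>The larger sieve pulls back to the maximal sieve along each arrow of the smaller one.\<close>

lemma topology_superset:
  assumes J: "grothendieck_topology C J" and X: "X \<in> Ob C" and S: "S \<in> J X"
    and R: "is_sieve C X R" "S \<subseteq> R"
  shows "R \<in> J X"
proof (rule topology_transitive[OF J X S R(1)])
  fix f assume "f \<in> S"
  then have "f \<in> R" using R(2) by blast
  then show "pullback_sieve C f R \<in> J (Dom C f)"
    using pullback_sieve_member[OF R(1)] topology_maximal[OF J Dom_in_Ob] is_sieveD(1)[OF R(1)]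
    by simp
qed

lemma grothendieck_topology_all_sieves:
  "grothendieck_topology C (\<lambda>X. {S. is_sieve C X S})"
  using is_sieve_pullback_sieve is_sieve_maximal by (simp add: grothendieck_topology_def)

text \<open>The finest topology for which \<open>G\<close> is a sheaf. The sheaf condition alone is not stable under
  pullback, hence it is imposed on all pullbacks of the sieve.\<close>

definition presheaf_topology :: "('o, 'm, 'v) presheaf \<Rightarrow> 'o \<Rightarrow> 'm set set" where
  "presheaf_topology G X = {S. is_sieve C X S \<and>
     (\<forall>f \<in> Ar C. Cod C f = X \<longrightarrow> sheaf_for_sieve C G (Dom C f) (pullback_sieve C f S))}"

lemma presheaf_topology_pullback:
  assumes "S \<in> presheaf_topology G (Cod C f)" "f \<in> Ar C"
  shows "pullback_sieve C f S \<in> presheaf_topology G (Dom C f)"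
proof -
  have "sheaf_for_sieve C G (Dom C g) (pullback_sieve C (f \<cdot> g) S)"
    if "g \<in> Ar C" "Cod C g = Dom C f" for g
    using assms that Comp_simps[OF assms(2) that] by (auto simp: presheaf_topology_def)
  then show ?thesis
    using assms by (auto simp: presheaf_topology_def is_sieve_pullback_sieve pullback_sieve_Comp)
qed

lemma presheaf_topology_sheaf:
  assumes "S \<in> presheaf_topology G X" "X \<in> Ob C"
  shows "sheaf_for_sieve C G X S"
proof -
  have S: "is_sieve C X S"
    "\<forall>f \<in> Ar C. Cod C f = X \<longrightarrow> sheaf_for_sieve C G (Dom C f) (pullback_sieve C f S)"
    using assms(1) by (simp_all add: presheaf_topology_def)
  show ?thesis
    using S(2)[rule_format, of "Idn C X"] assms(2)
    by (simp add: Idn_simps pullback_sieve_Idn[OF S(1)])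
qed

lemma sheaf_for_maximal_sieve:
  assumes G: "is_presheaf C G" and X: "X \<in> Ob C"
  shows "sheaf_for_sieve C G X {f \<in> Ar C. Cod C f = X}"
  unfolding sheaf_for_sieve_def
proof (intro allI impI ex1I)
  let ?i = "Idn C X"
  fix x assume x: "matching_family C G {f \<in> Ar C. Cod C f = X} x"
  note xD = matching_familyD[OF x]
  show "x ?i \<in> fobj G X \<and> (\<forall>f \<in> {f \<in> Ar C. Cod C f = X}. app (fmap G f) (x ?i) = x f)"
    using xD(1)[of ?i] xD(2)[of ?i] X by (auto simp: Idn_simps Idn_Comp)
  show "a = x ?i"
    if "a \<in> fobj G X \<and> (\<forall>f \<in> {f \<in> Ar C. Cod C f = X}. app (fmap G f) a = x f)" for a
  proof -
    have "app (fmap G ?i) a = x ?i" using that Idn_simps[OF X] by blast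
    then show ?thesis using that restr_Idn[OF G X] by simp
  qed
qed

text \<open>Amalgamation in two steps: a matching family on \<open>R\<close> is first glued along the pullback of \<open>R\<close> to
  the source of each \<open>f \<in> S\<close>, and the resulting elements \<open>b f\<close> are then glued along \<open>S\<close>. That the outcome
  restricts correctly to an \<open>r \<in> R\<close> outside \<open>S\<close> is checked on the pullback of \<open>S\<close> along \<open>r\<close>.\<close>

lemma sheaf_for_sieve_transitive:
  assumes G: "is_presheaf C G" and X: "X \<in> Ob C" and S: "S \<in> presheaf_topology G X"
    and R: "is_sieve C X R"
    and RS: "\<And>f. f \<in> S \<Longrightarrow> pullback_sieve C f R \<in> presheaf_topology G (Dom C f)"
  shows "sheaf_for_sieve C G X R"
  unfolding sheaf_for_sieve_def
proof (intro allI impI)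
  fix x assume x: "matching_family C G R x"
  have S_sieve: "is_sieve C X S" using S by (simp add: presheaf_topology_def)
  note SD = is_sieveD[OF S_sieve] and RD = is_sieveD[OF R]
  have Rf_sieve: "is_sieve C (Dom C f) (pullback_sieve C f R)" if "f \<in> Ar C" "Cod C f = X" for f
    using is_sieve_pullback_sieve[OF R that] .
  have Rf: "sheaf_for_sieve C G (Dom C f) (pullback_sieve C f R)" if "f \<in> S" for f
    using presheaf_topology_sheaf[OF RS] that SD(1) by (simp add: Dom_in_Ob)
  have "\<exists>b. b \<in> fobj G (Dom C f) \<and> (\<forall>g \<in> pullback_sieve C f R. app (fmap G g) b = x (f \<cdot> g))"
    if f: "f \<in> S" for f
  proof -
    have "matching_family C G (pullback_sieve C f R) (\<lambda>g. x (f \<cdot> g))"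
      unfolding matching_family_def
    proof (intro conjI ballI impI)
      fix g assume "g \<in> pullback_sieve C f R"
      then have g: "g \<in> Ar C" "Cod C g = Dom C f" "f \<cdot> g \<in> R" by (simp_all add: pullback_sieve_iff)
      show "x (f \<cdot> g) \<in> fobj G (Dom C g)"
        using matching_familyD(1)[OF x g(3)] g SD(1)[OF f] by (simp add: Comp_simps)
      fix h assume h: "h \<in> Ar C" "Cod C h = Dom C g"
      show "app (fmap G h) (x (f \<cdot> g)) = x (f \<cdot> (g \<cdot> h))"
        using matching_familyD(2)[OF x g(3), of h] h g(1,2) SD(1)[OF f]
        by (simp add: Comp_simps Comp_assoc_Ar)
    qed
    then show ?thesis using Rf[OF f] unfolding sheaf_for_sieve_def by blast
  qed
  then obtain b where b_in: "\<And>f. f \<in> S \<Longrightarrow> b f \<in> fobj G (Dom C f)"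
    and b: "\<And>f g. \<lbrakk>f \<in> S; g \<in> pullback_sieve C f R\<rbrakk> \<Longrightarrow> app (fmap G g) (b f) = x (f \<cdot> g)"
    by metis
  have "matching_family C G S b"
    unfolding matching_family_def
  proof (intro conjI ballI impI)
    fix f g assume f: "f \<in> S" and g: "g \<in> Ar C" "Cod C g = Dom C f"
    have fg: "f \<cdot> g \<in> S" "Dom C (f \<cdot> g) = Dom C g" using SD[OF f] g by (simp_all add: Comp_simps)
    show "app (fmap G g) (b f) = b (f \<cdot> g)"
    proof (rule sheaf_for_sieve_eq[OF Rf[OF fg(1)] G Rf_sieve])
      show "f \<cdot> g \<in> Ar C" "Cod C (f \<cdot> g) = X" using SD(1,2)[OF fg(1)] .
      show "app (fmap G g) (b f) \<in> fobj G (Dom C (f \<cdot> g))"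
        using restr_in[OF G g(1)] b_in[OF f] g fg(2) by simp
      show "b (f \<cdot> g) \<in> fobj G (Dom C (f \<cdot> g))" using b_in[OF fg(1)] .
      fix h assume h: "h \<in> pullback_sieve C (f \<cdot> g) R"
      then have h': "h \<in> Ar C" "Cod C h = Dom C g" by (simp_all add: pullback_sieve_iff fg(2))
      have assoc: "(f \<cdot> g) \<cdot> h = f \<cdot> (g \<cdot> h)"
        using Comp_assoc_Ar[of f g h] SD(1)[OF f] g h' by simp
      then have "g \<cdot> h \<in> pullback_sieve C f R"
        using h h' g by (simp add: pullback_sieve_iff Comp_simps)
      then show "app (fmap G h) (app (fmap G g) (b f)) = app (fmap G h) (b (f \<cdot> g))"
        using b[OF f] b[OF fg(1) h] restr_Comp[OF G g(1) h'(1) h'(2), of "b f"] b_in[OF f] g assoc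
        by simp
    qed
  qed (rule b_in)
  then obtain a where a: "a \<in> fobj G X" and aS: "\<And>f. f \<in> S \<Longrightarrow> app (fmap G f) a = b f"
    using presheaf_topology_sheaf[OF S X] unfolding sheaf_for_sieve_def by blast
  have aR: "app (fmap G r) a = x r" if r: "r \<in> R" for r
  proof (rule sheaf_for_sieve_eq)
    let ?T = "pullback_sieve C r S"
    have r_Ar: "r \<in> Ar C" "Cod C r = X" using RD[OF r] by simp_all
    show "sheaf_for_sieve C G (Dom C r) ?T"
      using presheaf_topology_sheaf[OF presheaf_topology_pullback[of S G r]] S r_Ar
      by (simp add: Dom_in_Ob)
    show "is_presheaf C G" by (rule G)
    show "is_sieve C (Dom C r) ?T" using is_sieve_pullback_sieve[OF S_sieve r_Ar] .
    show "app (fmap G r) a \<in> fobj G (Dom C r)" using restr_in[OF G r_Ar(1)] a r_Ar by simp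
    show "x r \<in> fobj G (Dom C r)" using matching_familyD(1)[OF x r] .
    fix h assume "h \<in> ?T"
    then have h: "h \<in> Ar C" "Cod C h = Dom C r" "r \<cdot> h \<in> S" by (simp_all add: pullback_sieve_iff)
    let ?i = "Idn C (Dom C h)"
    have rh: "r \<cdot> h \<in> R" "Dom C (r \<cdot> h) = Dom C h" "r \<cdot> h \<in> Ar C"
      using RD[OF r] h by (simp_all add: Comp_simps)
    have i: "?i \<in> Ar C" "Dom C ?i = Dom C h" "Cod C ?i = Dom C h" "(r \<cdot> h) \<cdot> ?i = r \<cdot> h"
      using Idn_simps[OF Dom_in_Ob[OF h(1)]] Comp_Idn[OF rh(3,2)] by simp_all
    \<comment> \<open>As \<open>r \<cdot> h\<close> lies in both \<open>R\<close> and \<open>S\<close>, the identity is in the sieve that defines \<open>b (r \<cdot> h)\<close>.\<close>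
    have "?i \<in> pullback_sieve C (r \<cdot> h) R" using i rh by (simp add: pullback_sieve_iff)
    from b[OF h(3) this] have "b (r \<cdot> h) = x (r \<cdot> h)"
      using restr_Idn[OF G Dom_in_Ob[OF h(1)]] b_in[OF h(3)] rh(2) i(4) by simp
    then show "app (fmap G h) (app (fmap G r) a) = app (fmap G h) (x r)"
      using restr_Comp[OF G r_Ar(1) h(1,2)] a r_Ar(2) aS[OF h(3)] matching_familyD(2)[OF x r h(1,2)]
      by simp
  qed
  show "\<exists>!a. a \<in> fobj G X \<and> (\<forall>f \<in> R. app (fmap G f) a = x f)"
  proof (rule ex1I[of _ a])
    show "a \<in> fobj G X \<and> (\<forall>f \<in> R. app (fmap G f) a = x f)" using a aR by simp
    fix a' assume a': "a' \<in> fobj G X \<and> (\<forall>f \<in> R. app (fmap G f) a' = x f)"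
    show "a' = a"
    proof (rule sheaf_for_sieve_eq[OF presheaf_topology_sheaf[OF S X] G S_sieve])
      fix f assume f: "f \<in> S"
      have f_Ar: "f \<in> Ar C" "Cod C f = X" using SD[OF f] by simp_all
      show "app (fmap G f) a' = app (fmap G f) a"
      proof (rule sheaf_for_sieve_eq[OF Rf[OF f] G Rf_sieve[OF f_Ar]])
        show "app (fmap G f) a' \<in> fobj G (Dom C f)" "app (fmap G f) a \<in> fobj G (Dom C f)"
          using restr_in[OF G f_Ar(1)] a a' f_Ar by simp_all
        fix g assume "g \<in> pullback_sieve C f R"
        then have g: "g \<in> Ar C" "Cod C g = Dom C f" "f \<cdot> g \<in> R"
          by (simp_all add: pullback_sieve_iff)
        show "app (fmap G g) (app (fmap G f) a') = app (fmap G g) (app (fmap G f) a)"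
          using restr_Comp[OF G f_Ar(1) g(1,2), of a] restr_Comp[OF G f_Ar(1) g(1,2), of a']
            a a' f_Ar(2) g(3) aR by simp
      qed
    qed (use a a' in simp_all)
  qed
qed

lemma grothendieck_topology_presheaf_topology:
  assumes G: "is_presheaf C G"
  shows "grothendieck_topology C (presheaf_topology G)"
  unfolding grothendieck_topology_def
proof (intro conjI ballI allI impI)
  show "is_sieve C X S" if "S \<in> presheaf_topology G X" for X S
    using that by (simp add: presheaf_topology_def)
  show "{f \<in> Ar C. Cod C f = X} \<in> presheaf_topology G X" if "X \<in> Ob C" for X
    using sheaf_for_maximal_sieve[OF G]
    by (auto simp: presheaf_topology_def is_sieve_maximal Dom_in_Ob
        pullback_sieve_member[OF is_sieve_maximal])
  show "pullback_sieve C f S \<in> presheaf_topology G (Dom C f)"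
    if "f \<in> Ar C" "S \<in> presheaf_topology G (Cod C f)" for f S
    using presheaf_topology_pullback that by blast
  fix X S R
  assume X: "X \<in> Ob C" and S: "S \<in> presheaf_topology G X"
    and "is_sieve C X R \<and> (\<forall>f \<in> S. pullback_sieve C f R \<in> presheaf_topology G (Dom C f))"
  then have R: "is_sieve C X R"
    and RS: "\<And>f. f \<in> S \<Longrightarrow> pullback_sieve C f R \<in> presheaf_topology G (Dom C f)" by blast+
  have "sheaf_for_sieve C G (Dom C g) (pullback_sieve C g R)" if g: "g \<in> Ar C" "Cod C g = X" for g
  proof (rule sheaf_for_sieve_transitive[OF G Dom_in_Ob[OF g(1)]])
    show "pullback_sieve C g S \<in> presheaf_topology G (Dom C g)"
      using presheaf_topology_pullback[of S G g] S g by simp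
    show "is_sieve C (Dom C g) (pullback_sieve C g R)" using is_sieve_pullback_sieve[OF R g] .
    fix h assume "h \<in> pullback_sieve C g S"
    then have h: "h \<in> Ar C" "Cod C h = Dom C g" "g \<cdot> h \<in> S" by (simp_all add: pullback_sieve_iff)
    show "pullback_sieve C h (pullback_sieve C g R) \<in> presheaf_topology G (Dom C h)"
      using RS[OF h(3)] pullback_sieve_Comp[OF g(1) h(1,2)] g(1) h(1,2) by (simp add: Comp_simps)
  qed
  then show "R \<in> presheaf_topology G X" using R by (simp add: presheaf_topology_def)
qed

section \<open>Precoherent categories and the coherent topology\<close>

definition is_coherent_coverage :: "('o \<Rightarrow> 'm set set) \<Rightarrow> bool" where
  "is_coherent_coverage J \<longleftrightarrow> (\<forall>B. \<forall>I :: nat set. \<forall>\<pi>. finite I \<and> effective_epi_family C B I \<pi> \<longrightarrow>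
     generated_sieve C B I \<pi> \<in> J B)"

lemma coherent_topology_eq:
  "coherent_topology C X = \<Inter> {J X | J. grothendieck_topology C J \<and> is_coherent_coverage J}"
  by (simp add: coherent_topology_def is_coherent_coverage_def)

lemma coherent_topology_least:
  assumes "grothendieck_topology C J" "is_coherent_coverage J" "S \<in> coherent_topology C X"
  shows "S \<in> J X"
  using assms by (auto simp: coherent_topology_eq)

lemma coherent_topologyI:
  assumes "\<And>J. \<lbrakk>grothendieck_topology C J; is_coherent_coverage J\<rbrakk> \<Longrightarrow> S \<in> J X"
  shows "S \<in> coherent_topology C X"
  using assms by (auto simp: coherent_topology_eq)

lemma effective_epi_familyD:
  assumes "effective_epi_family C B I \<pi>"
  shows "family_over C B I \<pi>" "B \<in> Ob C" "i \<in> I \<Longrightarrow> \<pi> i \<in> Ar C" "i \<in> I \<Longrightarrow> Cod C (\<pi> i) = B"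
  using assms by (simp_all add: effective_epi_family_def family_over_def)

lemma generated_sieve_coherent:
  assumes "finite (I :: nat set)" "effective_epi_family C B I \<pi>"
  shows "generated_sieve C B I \<pi> \<in> coherent_topology C B"
  using assms by (auto intro!: coherent_topologyI simp: is_coherent_coverage_def)

lemma grothendieck_topology_coherent: "grothendieck_topology C (coherent_topology C)"
proof -
  \<comment> \<open>So the topologies that are intersected exist, and the intersection consists of sieves.\<close>
  have all: "is_coherent_coverage (\<lambda>X. {S. is_sieve C X S})"
    by (auto simp: is_coherent_coverage_def
        intro: is_sieve_generated_sieve effective_epi_familyD(1))
  show ?thesis
    unfolding grothendieck_topology_def
  proof (intro conjI ballI allI impI)
    show "is_sieve C X S" if "S \<in> coherent_topology C X" for X S
      using coherent_topology_least[OF grothendieck_topology_all_sieves all that] by simp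
    show "{f \<in> Ar C. Cod C f = X} \<in> coherent_topology C X" if "X \<in> Ob C" for X
      using topology_maximal that by (blast intro: coherent_topologyI)
    show "pullback_sieve C f S \<in> coherent_topology C (Dom C f)"
      if "f \<in> Ar C" "S \<in> coherent_topology C (Cod C f)" for f S
      using topology_pullback that coherent_topology_least by (blast intro: coherent_topologyI)
    show "R \<in> coherent_topology C X"
      if X: "X \<in> Ob C" and S: "S \<in> coherent_topology C X"
        and R: "is_sieve C X R \<and> (\<forall>f \<in> S. pullback_sieve C f R \<in> coherent_topology C (Dom C f))"
      for X S R
    proof (rule coherent_topologyI)
      fix J assume J: "grothendieck_topology C J" "is_coherent_coverage J"
      show "R \<in> J X"
        using R coherent_topology_least[OF J]
        by (intro topology_transitive[OF J(1) X coherent_topology_least[OF J S]]) blast+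
    qed
  qed
qed

end

lemma precoherentE:
  assumes C: "precoherent C" and \<pi>: "finite (I :: nat set)" "effective_epi_family C B I \<pi>"
    and f: "f \<in> Ar C" "Cod C f = B"
  obtains J :: "nat set" and \<pi>' where "finite J" "effective_epi_family C (Dom C f) J \<pi>'"
    "\<forall>j \<in> J. \<exists>i \<in> I. \<exists>h \<in> hom C (Dom C (\<pi>' j)) (Dom C (\<pi> i)). f \<cdot>\<^bsub>C\<^esub> \<pi>' j = \<pi> i \<cdot>\<^bsub>C\<^esub> h"
proof -
  have "\<exists>J :: nat set. \<exists>\<pi>'. finite J \<and> effective_epi_family C (Dom C f) J \<pi>' \<and>
      (\<forall>j \<in> J. \<exists>i \<in> I. \<exists>h \<in> hom C (Dom C (\<pi>' j)) (Dom C (\<pi> i)). f \<cdot>\<^bsub>C\<^esub> \<pi>' j = \<pi> i \<cdot>\<^bsub>C\<^esub> h)"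
    using C[unfolded precoherent_def] \<pi> f by simp
  then show thesis using that by blast
qed

context category
begin

lemma pullback_contains_effective_epi_family:
  assumes "precoherent C" "finite (I :: nat set)" "effective_epi_family C B I \<pi>"
    and f: "f \<in> Ar C" "Cod C f = B"
  obtains J :: "nat set" and \<pi>' where "finite J" "effective_epi_family C (Dom C f) J \<pi>'"
    "generated_sieve C (Dom C f) J \<pi>' \<subseteq> pullback_sieve C f (generated_sieve C B I \<pi>)"
proof -
  obtain J :: "nat set" and \<pi>' where J: "finite J" "effective_epi_family C (Dom C f) J \<pi>'"
    and fac: "\<forall>j \<in> J. \<exists>i \<in> I. \<exists>h \<in> hom C (Dom C (\<pi>' j)) (Dom C (\<pi> i)). f \<cdot> \<pi>' j = \<pi> i \<cdot> h"
    using assms by (rule precoherentE)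
  note \<pi> = effective_epi_familyD[OF assms(3)] and \<pi>' = effective_epi_familyD[OF J(2)]
  have "generated_sieve C (Dom C f) J \<pi>' \<subseteq> pullback_sieve C f (generated_sieve C B I \<pi>)"
  proof (rule generated_sieve_subset)
    show "is_sieve C (Dom C f) (pullback_sieve C f (generated_sieve C B I \<pi>))"
      using is_sieve_pullback_sieve[OF is_sieve_generated_sieve[OF \<pi>(1)] f] .
    fix j assume j: "j \<in> J"
    then obtain i h where ih: "i \<in> I" "h \<in> hom C (Dom C (\<pi>' j)) (Dom C (\<pi> i))" "f \<cdot> \<pi>' j = \<pi> i \<cdot> h"
      using fac by blast
    show "\<pi>' j \<in> pullback_sieve C f (generated_sieve C B I \<pi>)"
      using generated_sieve_member[OF \<pi>(1) ih(1) homD(1,3)[OF ih(2)]] ih(3) \<pi>'(3,4)[OF j]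
      by (simp add: pullback_sieve_iff)
  qed
  then show thesis using J that by blast
qed

text \<open>The sieves generated by finite effective epimorphic families have to be shown to lie in
  \<open>presheaf_topology G\<close>, that is, \<open>G\<close> has to satisfy the sheaf condition for each pullback \<open>R\<close> of such a
  sieve. By precoherence \<open>R\<close> contains a sieve \<open>T\<close> generated by another such family, on which matching
  families amalgamate. By precoherence again, the pullback of \<open>T\<close> along an \<open>r \<in> R\<close> contains a
  third such sieve, on which one checks that the amalgamation restricts correctly along \<open>r\<close>.\<close>

lemma sheaf_if_sheaf_for_families:
  assumes C: "precoherent C" and G: "is_presheaf C G"
    and fam: "\<And>B (I :: nat set) \<pi>. \<lbrakk>finite I; effective_epi_family C B I \<pi>\<rbrakk>
      \<Longrightarrow> sheaf_for_family C G B I \<pi>"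
  shows "is_sheaf C (coherent_topology C) G"
proof -
  have gen: "sheaf_for_sieve C G B (generated_sieve C B I \<pi>)"
    if "finite I" "effective_epi_family C B I \<pi>" for B \<pi> and I :: "nat set"
    using sheaf_for_generated_sieve_if_family[OF G effective_epi_familyD(1)[OF that(2)] fam[OF that]] .
  have pull: "sheaf_for_sieve C G (Dom C f) (pullback_sieve C f (generated_sieve C B I \<pi>))"
    if I: "finite I" "effective_epi_family C B I \<pi>" and f: "f \<in> Ar C" "Cod C f = B"
    for B \<pi> f and I :: "nat set"
    unfolding sheaf_for_sieve_def
  proof (intro allI impI)
    let ?S = "generated_sieve C B I \<pi>"
    let ?R = "pullback_sieve C f ?S"
    fix x assume x: "matching_family C G ?R x"
    have S_sieve: "is_sieve C B ?S"
      using is_sieve_generated_sieve[OF effective_epi_familyD(1)[OF I(2)]] .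
    obtain K :: "nat set" and \<kappa> where K: "finite K" "effective_epi_family C (Dom C f) K \<kappa>"
      and TR: "generated_sieve C (Dom C f) K \<kappa> \<subseteq> ?R"
      using C I f by (rule pullback_contains_effective_epi_family)
    let ?T = "generated_sieve C (Dom C f) K \<kappa>"
    have T_sieve: "is_sieve C (Dom C f) ?T"
      using is_sieve_generated_sieve[OF effective_epi_familyD(1)[OF K(2)]] .
    have "matching_family C G ?T x"
      using x TR unfolding matching_family_def by blast
    then obtain a where a: "a \<in> fobj G (Dom C f)" and aT: "\<And>t. t \<in> ?T \<Longrightarrow> app (fmap G t) a = x t"
      using gen[OF K] unfolding sheaf_for_sieve_def by blast
    have aR: "app (fmap G r) a = x r" if r: "r \<in> ?R" for r
    proof -
      have r_Ar: "r \<in> Ar C" "Cod C r = Dom C f" using r by (simp_all add: pullback_sieve_iff)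
      obtain L :: "nat set" and \<mu> where L: "finite L" "effective_epi_family C (Dom C r) L \<mu>"
        and UT: "generated_sieve C (Dom C r) L \<mu> \<subseteq> pullback_sieve C r ?T"
        using C K r_Ar by (rule pullback_contains_effective_epi_family)
      show ?thesis
      proof (rule sheaf_for_sieve_eq[OF gen[OF L] G])
        show "is_sieve C (Dom C r) (generated_sieve C (Dom C r) L \<mu>)"
          using is_sieve_generated_sieve[OF effective_epi_familyD(1)[OF L(2)]] .
        show "app (fmap G r) a \<in> fobj G (Dom C r)" using restr_in[OF G r_Ar(1)] a r_Ar by simp
        show "x r \<in> fobj G (Dom C r)" using matching_familyD(1)[OF x r] .
        fix h assume "h \<in> generated_sieve C (Dom C r) L \<mu>"
        then have h: "h \<in> Ar C" "Cod C h = Dom C r" "r \<cdot> h \<in> ?T"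
          using UT by (auto simp: pullback_sieve_iff)
        show "app (fmap G h) (app (fmap G r) a) = app (fmap G h) (x r)"
          using restr_Comp[OF G r_Ar(1) h(1,2)] a r_Ar(2) aT[OF h(3)]
            matching_familyD(2)[OF x r h(1,2)] by simp
      qed
    qed
    show "\<exists>!a. a \<in> fobj G (Dom C f) \<and> (\<forall>r \<in> ?R. app (fmap G r) a = x r)"
    proof (rule ex1I[of _ a])
      show "a \<in> fobj G (Dom C f) \<and> (\<forall>r \<in> ?R. app (fmap G r) a = x r)" using a aR by simp
      fix a' assume a': "a' \<in> fobj G (Dom C f) \<and> (\<forall>r \<in> ?R. app (fmap G r) a' = x r)"
      show "a' = a"
      proof (rule sheaf_for_sieve_eq[OF gen[OF K] G T_sieve _ a])
        fix t assume t: "t \<in> ?T"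
        then have "t \<in> ?R" using TR by blast
        then show "app (fmap G t) a' = app (fmap G t) a" using a' aT[OF t] by simp
      qed (use a' in simp)
    qed
  qed
  have "is_coherent_coverage (presheaf_topology G)"
    using pull
    by (auto simp: is_coherent_coverage_def presheaf_topology_def
        intro: is_sieve_generated_sieve effective_epi_familyD(1))
  then have "sheaf_for_sieve C G X S" if "X \<in> Ob C" "S \<in> coherent_topology C X" for X S
    using coherent_topology_least[OF grothendieck_topology_presheaf_topology[OF G] _ that(2)]
      presheaf_topology_sheaf[OF _ that(1)] by blast
  then show ?thesis
    using G by (simp add: is_sheaf_iff)
qed

lemma sheaf_for_family_if_covering:
  assumes "is_sheaf C (coherent_topology C) G" "family_over C B I \<pi>"
    "generated_sieve C B I \<pi> \<in> coherent_topology C B"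
  shows "sheaf_for_family C G B I \<pi>"
  using assms sheaf_for_family_if_generated_sieve[of G B I \<pi>]
  by (simp add: is_sheaf_iff family_over_def)

definition hom_presheaf :: "'o \<Rightarrow> ('o, 'm, 'm) presheaf" where
  "hom_presheaf W = mk_presheaf C (\<lambda>X. hom C X W) (\<lambda>f a. a \<cdot> f)"

lemma is_presheaf_hom_presheaf: "is_presheaf C (hom_presheaf W)"
  unfolding hom_presheaf_def
  by (rule is_presheaf_mk_presheaf) (auto simp: hom_def Comp_simps Comp_assoc_Ar Comp_Idn)

lemma effective_epi_family_iff:
  "effective_epi_family C B I \<pi> \<longleftrightarrow>
     family_over C B I \<pi> \<and> (\<forall>W \<in> Ob C. sheaf_for_family C (hom_presheaf W) B I \<pi>)"
proof -
  have "sheaf_for_family C (hom_presheaf W) B I \<pi> \<longleftrightarrow>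
     (\<forall>e. (\<forall>i \<in> I. e i \<in> hom C (Dom C (\<pi> i)) W) \<longrightarrow>
        (\<forall>i \<in> I. \<forall>j \<in> I. \<forall>Z \<in> Ob C.
           \<forall>g \<in> hom C Z (Dom C (\<pi> i)). \<forall>h \<in> hom C Z (Dom C (\<pi> j)).
             \<pi> i \<cdot> g = \<pi> j \<cdot> h \<longrightarrow> e i \<cdot> g = e j \<cdot> h) \<longrightarrow>
        (\<exists>!d. d \<in> hom C B W \<and> (\<forall>i \<in> I. d \<cdot> \<pi> i = e i)))"
    if \<pi>: "family_over C B I \<pi>" for W
  proof -
    have obj: "fobj (hom_presheaf W) X = hom C X W" if "X \<in> Ob C" for X
      using that by (simp add: hom_presheaf_def mk_presheaf_simps)
    have map: "app (fmap (hom_presheaf W) f) a = a \<cdot> f" if "f \<in> hom C X Y" "a \<in> hom C Y W" for f a X Y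
      using that by (simp add: hom_presheaf_def mk_presheaf_simps hom_def)
    have \<pi>_hom: "\<pi> i \<in> hom C (Dom C (\<pi> i)) B" "Dom C (\<pi> i) \<in> Ob C" if "i \<in> I" for i
      using \<pi> that by (simp_all add: family_over_def hom_def Dom_in_Ob)
    have B: "B \<in> Ob C" using \<pi> by (simp add: family_over_def)
    have map_\<pi>: "app (fmap (hom_presheaf W) (\<pi> i)) a = a \<cdot> \<pi> i" if "i \<in> I" "a \<in> hom C B W" for i a
      using map[OF \<pi>_hom(1)] that by simp
    show ?thesis
      unfolding sheaf_for_family_def
      by (intro all_cong1 imp_cong ball_cong refl arg_cong[where f = Ex1] ext conj_cong)
        (auto simp: obj B \<pi>_hom map map_\<pi>)
  qed
  then show ?thesis
    unfolding effective_epi_family_def by (intro conj_cong refl ball_cong) simp_all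
qed

text \<open>The coherent topology is subcanonical: representable presheaves satisfy the sheaf condition for
  finite effective epimorphic families by the definition of these, hence for all covering sieves.\<close>

lemma effective_epi_family_if_covering:
  assumes "precoherent C" "family_over C B I \<pi>" "generated_sieve C B I \<pi> \<in> coherent_topology C B"
  shows "effective_epi_family C B I \<pi>"
proof -
  have sheaf: "is_sheaf C (coherent_topology C) (hom_presheaf W)" if "W \<in> Ob C" for W
    using that
    by (intro sheaf_if_sheaf_for_families[OF assms(1) is_presheaf_hom_presheaf])
      (simp add: effective_epi_family_iff)
  have "sheaf_for_family C (hom_presheaf W) B I \<pi>" if "W \<in> Ob C" for W
    using sheaf_for_family_if_covering[OF sheaf[OF that] assms(2,3)] .
  then show ?thesis
    using assms(2) by (simp add: effective_epi_family_iff)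
qed

lemma effective_epi_family_singleton:
  assumes p: "effective_epi C p"
  shows "effective_epi_family C (Cod C p) {i} (\<lambda>_. p)"
  unfolding effective_epi_family_def
proof (intro conjI ballI allI impI)
  have p_Ar: "p \<in> Ar C" using p by (simp add: effective_epi_def)
  then show "family_over C (Cod C p) {i} (\<lambda>_. p)" by (simp add: family_over_def Cod_in_Ob)
  fix W e
  assume W: "W \<in> Ob C" and e: "\<forall>j \<in> {i}. e j \<in> hom C (Dom C p) W"
    and compat: "\<forall>j \<in> {i}. \<forall>k \<in> {i}. \<forall>Z \<in> Ob C. \<forall>g \<in> hom C Z (Dom C p). \<forall>h \<in> hom C Z (Dom C p).
      p \<cdot> g = p \<cdot> h \<longrightarrow> e j \<cdot> g = e k \<cdot> h"
  have e_i: "e i \<in> hom C (Dom C p) W" using e by simp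
  have "\<forall>Z \<in> Ob C. \<forall>g \<in> hom C Z (Dom C p). \<forall>h \<in> hom C Z (Dom C p).
      p \<cdot> g = p \<cdot> h \<longrightarrow> e i \<cdot> g = e i \<cdot> h"
    using compat[THEN bspec[of _ _ i], THEN bspec[of _ _ i]] by blast
  then have "\<exists>!d. d \<in> hom C (Cod C p) W \<and> d \<cdot> p = e i"
    by (rule p[unfolded effective_epi_def, THEN conjunct2, THEN bspec, OF W, THEN bspec, OF e_i,
          THEN mp])
  then show "\<exists>!d. d \<in> hom C (Cod C p) W \<and> (\<forall>j \<in> {i}. d \<cdot> p = e j)" by simp
qed

text \<open>By transitivity it suffices that the composite sieve \<open>R\<close> covers after pulling back along
  \<open>\<pi> j \<cdot> h\<close>; its pullback along \<open>\<pi> j\<close> contains \<open>p j\<close>.\<close>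

lemma generated_sieve_covering_if_composite:
  assumes J: "grothendieck_topology C T" and \<pi>: "family_over C B J \<pi>"
    and S: "generated_sieve C B J \<pi> \<in> T B"
    and p: "\<And>j. j \<in> J \<Longrightarrow> p j \<in> Ar C" "\<And>j. j \<in> J \<Longrightarrow> Cod C (p j) = Dom C (\<pi> j)"
    and cov: "\<And>j. j \<in> J \<Longrightarrow> generated_sieve C (Dom C (\<pi> j)) {j} p \<in> T (Dom C (\<pi> j))"
    and q: "\<And>j. j \<in> J \<Longrightarrow> q j = \<pi> j \<cdot> p j"
  shows "family_over C B J q" "generated_sieve C B J q \<in> T B"
proof -
  have \<pi>_Ar: "\<pi> j \<in> Ar C" "Cod C (\<pi> j) = B" if "j \<in> J" for j
    using \<pi> that by (simp_all add: family_over_def)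
  have B: "B \<in> Ob C" using \<pi> by (simp add: family_over_def)
  show fam: "family_over C B J q"
    using B \<pi>_Ar p q by (simp add: family_over_def Comp_simps)
  let ?R = "generated_sieve C B J q"
  have R_sieve: "is_sieve C B ?R" using is_sieve_generated_sieve[OF fam] .
  show "?R \<in> T B"
  proof (rule topology_transitive[OF J B S R_sieve])
    fix f assume "f \<in> generated_sieve C B J \<pi>"
    then obtain j h where j: "j \<in> J" and h: "h \<in> Ar C" "Cod C h = Dom C (\<pi> j)" and f: "f = \<pi> j \<cdot> h"
      by (rule generated_sieveE)
    have sv: "is_sieve C (Dom C (\<pi> j)) (pullback_sieve C (\<pi> j) ?R)"
      using is_sieve_pullback_sieve[OF R_sieve \<pi>_Ar[OF j]] .
    have "p j \<in> pullback_sieve C (\<pi> j) ?R"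
      using generated_sieve_generator[OF fam j] p[OF j] q[OF j] by (simp add: pullback_sieve_iff)
    then have "generated_sieve C (Dom C (\<pi> j)) {j} p \<subseteq> pullback_sieve C (\<pi> j) ?R"
      by (intro generated_sieve_subset[OF sv]) simp
    then have "pullback_sieve C (\<pi> j) ?R \<in> T (Dom C (\<pi> j))"
      using topology_superset[OF J _ cov[OF j] sv] \<pi>_Ar[OF j] by (simp add: Dom_in_Ob)
    then have "pullback_sieve C h (pullback_sieve C (\<pi> j) ?R) \<in> T (Dom C h)"
      using topology_pullback[OF J h(1)] h(2) by simp
    then show "pullback_sieve C f ?R \<in> T (Dom C f)"
      using pullback_sieve_Comp[OF \<pi>_Ar(1)[OF j] h] Comp_simps(2)[OF \<pi>_Ar(1)[OF j] h] f by simp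
  qed
qed

text \<open>The universal property of the composite cannot be read off from those of its parts: the kernel
  pairs of \<open>\<pi>\<close> have to be covered, too. Passing through covering sieves takes care of this.\<close>

lemma effective_epi_family_composite:
  assumes C: "precoherent C" and \<pi>: "finite (J :: nat set)" "effective_epi_family C B J \<pi>"
    and p: "\<And>j. j \<in> J \<Longrightarrow> effective_epi C (p j)" "\<And>j. j \<in> J \<Longrightarrow> Cod C (p j) = Dom C (\<pi> j)"
    and q: "\<And>j. j \<in> J \<Longrightarrow> q j = \<pi> j \<cdot> p j"
  shows "effective_epi_family C B J q"
proof -
  have cov: "generated_sieve C (Dom C (\<pi> j)) {j} p \<in> coherent_topology C (Dom C (\<pi> j))"
    if j: "j \<in> J" for j
  proof -
    have "generated_sieve C (Dom C (\<pi> j)) {j} p = generated_sieve C (Cod C (p j)) {j} (\<lambda>_. p j)"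
      using p(2)[OF j] by (simp add: generated_sieve_def)
    then show ?thesis
      using generated_sieve_coherent[OF _ effective_epi_family_singleton[OF p(1)[OF j]], of j] p(2)[OF j]
      by simp
  qed
  have p_Ar: "p j \<in> Ar C" if "j \<in> J" for j using p(1)[OF that] by (simp add: effective_epi_def)
  note comp = generated_sieve_covering_if_composite[OF grothendieck_topology_coherent
      effective_epi_familyD(1)[OF \<pi>(2)] generated_sieve_coherent[OF \<pi>] p_Ar p(2) cov q]
  show ?thesis
    using effective_epi_family_if_covering[OF C comp] .
qed

lemma sheaf_ex1_amalgamation:
  assumes G: "is_sheaf C (coherent_topology C) G" and p: "effective_epi C p"
    and x: "x \<in> fobj G (Dom C p)"
    and compat: "\<And>Z g h. \<lbrakk>Z \<in> Ob C; g \<in> hom C Z (Dom C p); h \<in> hom C Z (Dom C p); p \<cdot> g = p \<cdot> h\<rbrakk>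
      \<Longrightarrow> app (fmap G g) x = app (fmap G h) x"
  shows "\<exists>!a. a \<in> fobj G (Cod C p) \<and> app (fmap G p) a = x"
proof -
  have eff: "effective_epi_family C (Cod C p) {0 :: nat} (\<lambda>_. p)"
    using effective_epi_family_singleton[OF p] .
  have "sheaf_for_family C G (Cod C p) {0 :: nat} (\<lambda>_. p)"
    using sheaf_for_family_if_covering[OF G effective_epi_familyD(1)[OF eff]
        generated_sieve_coherent[OF _ eff]] by simp
  then have "\<exists>!a. a \<in> fobj G (Cod C p) \<and> (\<forall>i \<in> {0 :: nat}. app (fmap G p) a = x)"
    by (rule sheaf_for_familyD) (use x compat in blast)+
  then show ?thesis by simp
qed

lemma sheaf_eq_on_effective_epi:
  assumes G: "is_sheaf C (coherent_topology C) G" and p: "effective_epi C p"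
    and a: "a \<in> fobj G (Cod C p)" "b \<in> fobj G (Cod C p)" "app (fmap G p) a = app (fmap G p) b"
  shows "a = b"
proof -
  have pre: "is_presheaf C G" using G by (simp add: is_sheaf_iff)
  have p_Ar: "p \<in> Ar C" using p by (simp add: effective_epi_def)
  have "\<exists>!c. c \<in> fobj G (Cod C p) \<and> app (fmap G p) c = app (fmap G p) a"
  proof (rule sheaf_ex1_amalgamation[OF G p])
    show "app (fmap G p) a \<in> fobj G (Dom C p)" using restr_in[OF pre p_Ar a(1)] .
    show "app (fmap G g) (app (fmap G p) a) = app (fmap G h) (app (fmap G p) a)"
      if "g \<in> hom C Z (Dom C p)" "h \<in> hom C Z (Dom C p)" "p \<cdot> g = p \<cdot> h" for Z g h
      using restr_Comp[OF pre p_Ar _ _ a(1), of g] restr_Comp[OF pre p_Ar _ _ a(1), of h]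
        homD(1,3)[OF that(1)] homD(1,3)[OF that(2)] that(3) by metis
  qed
  then show ?thesis using a by metis
qed

lemma sheaf_for_covering:
  assumes "is_sheaf C J G" "X \<in> Ob C" "S \<in> J X"
  shows "sheaf_for_sieve C G X S"
  using assms by (simp add: is_sheaf_iff)

end

section \<open>Full functors that cover a precoherent category\<close>

text \<open>The standing hypotheses on \<open>F : C \<rightarrow> D\<close>. Together they say that \<open>C\<close> is a full subcategory of
  \<open>D\<close>, up to isomorphism of objects, which carries the induced effective epimorphic families and covers
  every object of \<open>D\<close>.\<close>

locale covering_functor = cat_functor C D F
  for C :: "('o1, 'm1) cat" and D :: "('o2, 'm2) cat" and F +
  assumes precoherent_D: "precoherent D"
    and ff: "fully_faithful C D F"
    and preserves: "preserves_finite_eff_epi_families C D F"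
    and reflects: "reflects_finite_eff_epi_families C D F"
    and covers: "\<And>Y. Y \<in> Ob D \<Longrightarrow> \<exists>X \<in> Ob C. \<exists>p \<in> hom D (fobj F X) Y. effective_epi D p"
begin

abbreviation "J\<^sub>C \<equiv> coherent_topology C"
abbreviation "J\<^sub>D \<equiv> coherent_topology D"

lemma lift:
  assumes "X \<in> Ob C" "Y \<in> Ob C" "h \<in> hom D (fobj F X) (fobj F Y)"
  obtains f where "f \<in> Ar C" "Dom C f = X" "Cod C f = Y" "fmap F f = h"
  using ff_lift[OF ff assms] homD by metis

lemma cover:
  assumes "Y \<in> Ob D"
  obtains X p where "X \<in> Ob C" "p \<in> Ar D" "Dom D p = fobj F X" "Cod D p = Y" "effective_epi D p"
  using covers[OF assms] homD by metis

text \<open>Precoherence of \<open>D\<close> provides a family over \<open>F X\<close> that factors through \<open>\<pi>\<close> after composing with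
  \<open>p\<close>. Its members have sources covered by images of \<open>F\<close>; the composites with these covers are
  images of arrows of \<open>C\<close> and form an effective epimorphic family, which \<open>F\<close> reflects.\<close>

lemma effective_epi_family_lift:
  assumes X: "X \<in> Ob C" and p: "p \<in> Ar D" "Dom D p = fobj F X"
    and \<pi>: "finite (I :: nat set)" "effective_epi_family D (Cod D p) I \<pi>"
  obtains J :: "nat set" and q where "finite J" "effective_epi_family C X J q"
    "\<forall>j \<in> J. \<exists>i \<in> I. \<exists>h \<in> hom D (fobj F (Dom C (q j))) (Dom D (\<pi> i)).
       p \<cdot>\<^bsub>D\<^esub> fmap F (q j) = \<pi> i \<cdot>\<^bsub>D\<^esub> h"
proof -
  obtain J :: "nat set" and \<pi>' where J: "finite J" "effective_epi_family D (fobj F X) J \<pi>'"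
    and fac: "\<forall>j \<in> J. \<exists>i \<in> I. \<exists>h \<in> hom D (Dom D (\<pi>' j)) (Dom D (\<pi> i)).
      p \<cdot>\<^bsub>D\<^esub> \<pi>' j = \<pi> i \<cdot>\<^bsub>D\<^esub> h"
    using precoherentE[OF precoherent_D \<pi> p(1) refl] p(2) by metis
  note \<pi>' = D.effective_epi_familyD[OF J(2)] and \<pi>D = D.effective_epi_familyD[OF \<pi>(2)]
  have "\<forall>j \<in> J. \<exists>c q. effective_epi D c \<and> c \<in> Ar D \<and> Cod D c = Dom D (\<pi>' j) \<and>
      q \<in> Ar C \<and> Cod C q = X \<and> Dom D c = fobj F (Dom C q) \<and> fmap F q = \<pi>' j \<cdot>\<^bsub>D\<^esub> c"
  proof
    fix j assume j: "j \<in> J"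
    have "Dom D (\<pi>' j) \<in> Ob D" using \<pi>'(3)[OF j] by (simp add: D.Dom_in_Ob)
    then obtain Z c where Z: "Z \<in> Ob C" and c: "c \<in> Ar D" "Dom D c = fobj F Z"
        "Cod D c = Dom D (\<pi>' j)" "effective_epi D c"
      by (rule cover)
    have "\<pi>' j \<cdot>\<^bsub>D\<^esub> c \<in> hom D (fobj F Z) (fobj F X)"
      using D.Comp_simps[OF \<pi>'(3)[OF j] c(1,3)] c(2) \<pi>'(4)[OF j] by (simp add: hom_def)
    then obtain q where "q \<in> Ar C" "Dom C q = Z" "Cod C q = X" "fmap F q = \<pi>' j \<cdot>\<^bsub>D\<^esub> c"
      using lift[OF Z X] by metis
    then show "\<exists>c q. effective_epi D c \<and> c \<in> Ar D \<and> Cod D c = Dom D (\<pi>' j) \<and>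
      q \<in> Ar C \<and> Cod C q = X \<and> Dom D c = fobj F (Dom C q) \<and> fmap F q = \<pi>' j \<cdot>\<^bsub>D\<^esub> c"
      using c by blast
  qed
  then obtain c q where cq: "\<And>j. j \<in> J \<Longrightarrow> effective_epi D (c j) \<and> c j \<in> Ar D \<and>
      Cod D (c j) = Dom D (\<pi>' j) \<and> q j \<in> Ar C \<and> Cod C (q j) = X \<and>
      Dom D (c j) = fobj F (Dom C (q j)) \<and> fmap F (q j) = \<pi>' j \<cdot>\<^bsub>D\<^esub> c j"
    by metis
  have "effective_epi_family D (fobj F X) J (\<lambda>j. fmap F (q j))"
    using cq by (intro D.effective_epi_family_composite[OF precoherent_D J, of c]) simp_all
  moreover have "family_over C X J q" using cq X by (simp add: family_over_def)
  ultimately have q: "effective_epi_family C X J q"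
    using reflects J(1) unfolding reflects_finite_eff_epi_families_def by blast
  have "\<exists>i \<in> I. \<exists>h \<in> hom D (fobj F (Dom C (q j))) (Dom D (\<pi> i)). p \<cdot>\<^bsub>D\<^esub> fmap F (q j) = \<pi> i \<cdot>\<^bsub>D\<^esub> h"
    if j: "j \<in> J" for j
  proof -
    obtain i h where i: "i \<in> I" and h: "h \<in> hom D (Dom D (\<pi>' j)) (Dom D (\<pi> i))"
      and eq: "p \<cdot>\<^bsub>D\<^esub> \<pi>' j = \<pi> i \<cdot>\<^bsub>D\<^esub> h"
      using fac j by blast
    have c: "c j \<in> hom D (fobj F (Dom C (q j))) (Dom D (\<pi>' j))"
      using cq[OF j] by (simp add: hom_def)
    have "p \<cdot>\<^bsub>D\<^esub> fmap F (q j) = (p \<cdot>\<^bsub>D\<^esub> \<pi>' j) \<cdot>\<^bsub>D\<^esub> c j"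
      using D.Comp_assoc_Ar[of p "\<pi>' j" "c j"] cq[OF j] p \<pi>'(3,4)[OF j] by simp
    also have "\<dots> = \<pi> i \<cdot>\<^bsub>D\<^esub> (h \<cdot>\<^bsub>D\<^esub> c j)"
      using D.Comp_assoc_Ar[of "\<pi> i" h "c j"] cq[OF j] \<pi>D(3)[OF i] homD[OF h] eq by simp
    finally show ?thesis
      using i D.Comp_in_hom[OF h c] by blast
  qed
  then show thesis using that[OF J(1) q] by blast
qed

lemma precoherent_C: "precoherent C"
  unfolding precoherent_def
proof (intro conjI allI impI ballI)
  show "category C" by (rule C.category_axioms)
  fix B \<pi> f and I :: "nat set"
  assume "finite I \<and> effective_epi_family C B I \<pi>" and f: "f \<in> Ar C" "Cod C f = B"
  then have \<pi>: "finite I" "effective_epi_family C B I \<pi>" by simp_all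
  note \<pi>D = C.effective_epi_familyD[OF \<pi>(2)]
  have "effective_epi_family D (Cod D (fmap F f)) I (\<lambda>i. fmap F (\<pi> i))"
    using preserves \<pi> \<pi>D(1) f fmap_simps(3)[OF f(1)]
    unfolding preserves_finite_eff_epi_families_def by simp
  then obtain J :: "nat set" and q where J: "finite J" "effective_epi_family C (Dom C f) J q"
    and fac: "\<forall>j \<in> J. \<exists>i \<in> I. \<exists>h \<in> hom D (fobj F (Dom C (q j))) (Dom D (fmap F (\<pi> i))).
       fmap F f \<cdot>\<^bsub>D\<^esub> fmap F (q j) = fmap F (\<pi> i) \<cdot>\<^bsub>D\<^esub> h"
    using effective_epi_family_lift[OF C.Dom_in_Ob[OF f(1)] fmap_simps(1,2)[OF f(1)] \<pi>(1)] by metis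
  note qD = C.effective_epi_familyD[OF J(2)]
  have "\<exists>i \<in> I. \<exists>h \<in> hom C (Dom C (q j)) (Dom C (\<pi> i)). f \<cdot>\<^bsub>C\<^esub> q j = \<pi> i \<cdot>\<^bsub>C\<^esub> h"
    if j: "j \<in> J" for j
  proof -
    obtain i h where i: "i \<in> I" and h: "h \<in> hom D (fobj F (Dom C (q j))) (Dom D (fmap F (\<pi> i)))"
      and eq: "fmap F f \<cdot>\<^bsub>D\<^esub> fmap F (q j) = fmap F (\<pi> i) \<cdot>\<^bsub>D\<^esub> h"
      using fac j by blast
    note \<pi>i = \<pi>D(3,4)[OF i] and qj = qD(3,4)[OF j]
    have "h \<in> hom D (fobj F (Dom C (q j))) (fobj F (Dom C (\<pi> i)))"
      using h fmap_simps(2)[OF \<pi>i(1)] by simp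
    then obtain k where k: "k \<in> Ar C" "Dom C k = Dom C (q j)" "Cod C k = Dom C (\<pi> i)" "fmap F k = h"
      using lift[OF C.Dom_in_Ob[OF qj(1)] C.Dom_in_Ob[OF \<pi>i(1)]] by metis
    have "f \<cdot>\<^bsub>C\<^esub> q j = \<pi> i \<cdot>\<^bsub>C\<^esub> k"
    proof (rule ff_eq[OF ff])
      show "f \<cdot>\<^bsub>C\<^esub> q j \<in> hom C (Dom C (q j)) B"
        using C.Comp_simps[OF f(1) qj(1)] qj(2) f(2) by (simp add: hom_def)
      show "\<pi> i \<cdot>\<^bsub>C\<^esub> k \<in> hom C (Dom C (q j)) B"
        using C.Comp_simps[OF \<pi>i(1) k(1,3)] \<pi>i(2) k(2) by (simp add: hom_def)
      show "fmap F (f \<cdot>\<^bsub>C\<^esub> q j) = fmap F (\<pi> i \<cdot>\<^bsub>C\<^esub> k)"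
        using fmap_Comp_Ar[OF f(1) qj(1)] fmap_Comp_Ar[OF \<pi>i(1) k(1,3)] qj(2) k(4) eq by simp
    qed
    moreover have "k \<in> hom C (Dom C (q j)) (Dom C (\<pi> i))" using k by (simp add: hom_def)
    ultimately show ?thesis using i by blast
  qed
  then show "\<exists>J :: nat set. \<exists>q. finite J \<and> effective_epi_family C (Dom C f) J q \<and>
      (\<forall>j \<in> J. \<exists>i \<in> I. \<exists>h \<in> hom C (Dom C (q j)) (Dom C (\<pi> i)). f \<cdot>\<^bsub>C\<^esub> q j = \<pi> i \<cdot>\<^bsub>C\<^esub> h)"
    using J by blast
qed

lemma comp_ftr_simps:
  "X \<in> Ob C \<Longrightarrow> fobj (comp_ftr C G F) X = fobj G (fobj F X)"
  "f \<in> Ar C \<Longrightarrow> fmap (comp_ftr C G F) f = fmap G (fmap F f)"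
  by (simp_all add: comp_ftr_def)

text \<open>Given a family compatible with respect to arrows of \<open>C\<close>, one needs compatibility for all pairs of
  arrows \<open>g, h\<close> of \<open>D\<close> with a common source \<open>Z\<close>. After composing with an effective epimorphism
  \<open>q : F X \<rightarrow> Z\<close> they come from \<open>C\<close>, and restriction of \<open>G\<close> along \<open>q\<close> is injective.\<close>

lemma is_sheaf_comp_ftr:
  assumes G: "is_sheaf D J\<^sub>D G"
  shows "is_sheaf C J\<^sub>C (comp_ftr C G F)"
proof -
  have pre: "is_presheaf D G" using G by (simp add: is_sheaf_iff)
  have preC: "is_presheaf C (comp_ftr C G F)"
    using is_presheaf_comp_ftr[OF cat_functor_axioms pre] .
  have "sheaf_for_family C (comp_ftr C G F) B I \<pi>"
    if \<pi>: "finite I" "effective_epi_family C B I \<pi>" for B \<pi> and I :: "nat set"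
    unfolding sheaf_for_family_def
  proof (intro allI impI)
    fix x
    assume x: "\<forall>i \<in> I. x i \<in> fobj (comp_ftr C G F) (Dom C (\<pi> i))"
      and compat: "\<forall>i \<in> I. \<forall>j \<in> I. \<forall>Z \<in> Ob C.
           \<forall>g \<in> hom C Z (Dom C (\<pi> i)). \<forall>h \<in> hom C Z (Dom C (\<pi> j)).
             \<pi> i \<cdot>\<^bsub>C\<^esub> g = \<pi> j \<cdot>\<^bsub>C\<^esub> h \<longrightarrow>
             app (fmap (comp_ftr C G F) g) (x i) = app (fmap (comp_ftr C G F) h) (x j)"
    note \<pi>D = C.effective_epi_familyD[OF \<pi>(2)]
    have F\<pi>: "fmap F (\<pi> i) \<in> Ar D" "Dom D (fmap F (\<pi> i)) = fobj F (Dom C (\<pi> i))"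
      "Cod D (fmap F (\<pi> i)) = fobj F B" "Dom C (\<pi> i) \<in> Ob C" if "i \<in> I" for i
      using fmap_simps[OF \<pi>D(3)[OF that]] \<pi>D(4)[OF that] C.Dom_in_Ob[OF \<pi>D(3)[OF that]] by simp_all
    have xG: "x i \<in> fobj G (fobj F (Dom C (\<pi> i)))" if "i \<in> I" for i
      using bspec[OF x that] F\<pi>(4)[OF that] by (simp add: comp_ftr_simps)
    have eff: "effective_epi_family D (fobj F B) I (\<lambda>i. fmap F (\<pi> i))"
      using preserves \<pi> \<pi>D(1) unfolding preserves_finite_eff_epi_families_def by simp
    have "sheaf_for_family D G (fobj F B) I (\<lambda>i. fmap F (\<pi> i))"
      using D.sheaf_for_family_if_covering[OF G D.effective_epi_familyD(1)[OF eff]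
          D.generated_sieve_coherent[OF \<pi>(1) eff]] .
    then have "\<exists>!a. a \<in> fobj G (fobj F B) \<and> (\<forall>i \<in> I. app (fmap G (fmap F (\<pi> i))) a = x i)"
    proof (rule sheaf_for_familyD)
      show "x i \<in> fobj G (Dom D (fmap F (\<pi> i)))" if "i \<in> I" for i
        using xG[OF that] F\<pi>(2)[OF that] by simp
      fix i j Z g h
      assume i: "i \<in> I" and j: "j \<in> I" and Z: "Z \<in> Ob D"
        and "g \<in> hom D Z (Dom D (fmap F (\<pi> i)))" "h \<in> hom D Z (Dom D (fmap F (\<pi> j)))"
        and eq: "fmap F (\<pi> i) \<cdot>\<^bsub>D\<^esub> g = fmap F (\<pi> j) \<cdot>\<^bsub>D\<^esub> h"
      then have g: "g \<in> Ar D" "Dom D g = Z" "Cod D g = fobj F (Dom C (\<pi> i))"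
        and h: "h \<in> Ar D" "Dom D h = Z" "Cod D h = fobj F (Dom C (\<pi> j))"
        using F\<pi>(2) by (simp_all add: hom_def)
      obtain X q where X: "X \<in> Ob C" and q: "q \<in> Ar D" "Dom D q = fobj F X" "Cod D q = Z"
        "effective_epi D q" using Z by (rule cover)
      have "g \<cdot>\<^bsub>D\<^esub> q \<in> hom D (fobj F X) (fobj F (Dom C (\<pi> i)))"
        "h \<cdot>\<^bsub>D\<^esub> q \<in> hom D (fobj F X) (fobj F (Dom C (\<pi> j)))"
        using D.Comp_simps[of g q] D.Comp_simps[of h q] g h q by (simp_all add: hom_def)
      then obtain k l where k: "k \<in> Ar C" "Dom C k = X" "Cod C k = Dom C (\<pi> i)" "fmap F k = g \<cdot>\<^bsub>D\<^esub> q"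
        and l: "l \<in> Ar C" "Dom C l = X" "Cod C l = Dom C (\<pi> j)" "fmap F l = h \<cdot>\<^bsub>D\<^esub> q"
        using lift[OF X F\<pi>(4)[OF i]] lift[OF X F\<pi>(4)[OF j]] by metis
      have "\<pi> i \<cdot>\<^bsub>C\<^esub> k = \<pi> j \<cdot>\<^bsub>C\<^esub> l"
      proof (rule ff_eq[OF ff])
        show "\<pi> i \<cdot>\<^bsub>C\<^esub> k \<in> hom C X B" "\<pi> j \<cdot>\<^bsub>C\<^esub> l \<in> hom C X B"
          using C.Comp_simps[OF \<pi>D(3)[OF i] k(1,3)] C.Comp_simps[OF \<pi>D(3)[OF j] l(1,3)]
            \<pi>D(4)[OF i] \<pi>D(4)[OF j] k(2) l(2) by (simp_all add: hom_def)
        have "fmap F (\<pi> i \<cdot>\<^bsub>C\<^esub> k) = (fmap F (\<pi> i) \<cdot>\<^bsub>D\<^esub> g) \<cdot>\<^bsub>D\<^esub> q"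
          using fmap_Comp_Ar[OF \<pi>D(3)[OF i] k(1,3)] k(4)
            D.Comp_assoc_Ar[of "fmap F (\<pi> i)" g q] F\<pi>(1,2)[OF i] g q by simp
        moreover have "fmap F (\<pi> j \<cdot>\<^bsub>C\<^esub> l) = (fmap F (\<pi> j) \<cdot>\<^bsub>D\<^esub> h) \<cdot>\<^bsub>D\<^esub> q"
          using fmap_Comp_Ar[OF \<pi>D(3)[OF j] l(1,3)] l(4)
            D.Comp_assoc_Ar[of "fmap F (\<pi> j)" h q] F\<pi>(1,2)[OF j] h q by simp
        ultimately show "fmap F (\<pi> i \<cdot>\<^bsub>C\<^esub> k) = fmap F (\<pi> j \<cdot>\<^bsub>C\<^esub> l)" using eq by simp
      qed
      moreover have "k \<in> hom C X (Dom C (\<pi> i))" "l \<in> hom C X (Dom C (\<pi> j))"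
        using k l by (simp_all add: hom_def)
      ultimately have "app (fmap (comp_ftr C G F) k) (x i) = app (fmap (comp_ftr C G F) l) (x j)"
        using compat i j X by blast
      then have kl: "app (fmap G (g \<cdot>\<^bsub>D\<^esub> q)) (x i) = app (fmap G (h \<cdot>\<^bsub>D\<^esub> q)) (x j)"
        using k(1,4) l(1,4) by (simp add: comp_ftr_simps)
      show "app (fmap G g) (x i) = app (fmap G h) (x j)"
      proof (rule D.sheaf_eq_on_effective_epi[OF G q(4)])
        show "app (fmap G g) (x i) \<in> fobj G (Cod D q)" "app (fmap G h) (x j) \<in> fobj G (Cod D q)"
          using D.restr_in[OF pre g(1)] D.restr_in[OF pre h(1)] xG[OF i] xG[OF j] g h q(3) by simp_all
        show "app (fmap G q) (app (fmap G g) (x i)) = app (fmap G q) (app (fmap G h) (x j))"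
          using D.restr_Comp[OF pre g(1) q(1)] D.restr_Comp[OF pre h(1) q(1)] xG[OF i] xG[OF j]
            g h q(3) kl by simp
      qed
    qed
    then show "\<exists>!a. a \<in> fobj (comp_ftr C G F) B \<and>
        (\<forall>i \<in> I. app (fmap (comp_ftr C G F) (\<pi> i)) a = x i)"
      using \<pi>D(2,3) by (simp add: comp_ftr_simps cong: ball_cong)
  qed
  then show ?thesis
    by (rule C.sheaf_if_sheaf_for_families[OF precoherent_C preC])
qed

text \<open>The object \<open>X\<close> is not determined by \<open>p : F X \<rightarrow> Y\<close>, since \<open>F\<close> may identify objects.\<close>

definition preimage_sieve :: "'o1 \<Rightarrow> 'm2 \<Rightarrow> 'm2 set \<Rightarrow> 'm1 set" where
  "preimage_sieve X p S = {k \<in> Ar C. Cod C k = X \<and> p \<cdot>\<^bsub>D\<^esub> fmap F k \<in> S}"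

lemma Comp_fmap:
  assumes "p \<in> hom D (fobj F X) Y" "k \<in> Ar C" "Cod C k = X"
  shows "p \<cdot>\<^bsub>D\<^esub> fmap F k \<in> hom D (fobj F (Dom C k)) Y"
  using assms D.Comp_simps[of p "fmap F k"] fmap_simps[OF assms(2)] by (simp add: hom_def)

lemma Comp_fmap_Comp:
  assumes "p \<in> hom D (fobj F X) Y" "k \<in> Ar C" "Cod C k = X" "l \<in> Ar C" "Cod C l = Dom C k"
  shows "p \<cdot>\<^bsub>D\<^esub> fmap F (k \<cdot>\<^bsub>C\<^esub> l) = p \<cdot>\<^bsub>D\<^esub> fmap F k \<cdot>\<^bsub>D\<^esub> fmap F l"
  using assms D.Comp_assoc_Ar[of p "fmap F k" "fmap F l"] fmap_simps[OF assms(2)]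
    fmap_simps[OF assms(4)] fmap_Comp_Ar[OF assms(2,4,5)] by (simp add: hom_def)

lemma is_sieve_preimage_sieve:
  assumes S: "is_sieve D Y S" and p: "p \<in> hom D (fobj F X) Y"
  shows "is_sieve C X (preimage_sieve X p S)"
proof -
  have "k \<cdot>\<^bsub>C\<^esub> l \<in> preimage_sieve X p S"
    if k: "k \<in> preimage_sieve X p S" and l: "l \<in> Ar C" "Cod C l = Dom C k" for k l
  proof -
    have k': "k \<in> Ar C" "Cod C k = X" "p \<cdot>\<^bsub>D\<^esub> fmap F k \<in> S"
      using k by (simp_all add: preimage_sieve_def)
    have "p \<cdot>\<^bsub>D\<^esub> fmap F k \<cdot>\<^bsub>D\<^esub> fmap F l \<in> S"
      using D.is_sieveD(3)[OF S k'(3), of "fmap F l"] fmap_simps[OF l(1)] l(2)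
        homD(2)[OF Comp_fmap[OF p k'(1,2)]] by simp
    then show ?thesis
      using Comp_fmap_Comp[OF p k'(1,2) l] C.Comp_simps[OF k'(1) l] k'(2)
      by (simp add: preimage_sieve_def)
  qed
  then show ?thesis by (auto simp: is_sieve_def preimage_sieve_def)
qed

text \<open>The sieves of \<open>D\<close> all of whose preimages cover form a topology \<open>K\<close>. It contains the sieves
  generated by finite effective epimorphic families because these lift to \<open>C\<close>, hence it contains the
  coherent topology.\<close>

lemma preimage_sieve_covering:
  assumes S: "S \<in> J\<^sub>D Y" and X: "X \<in> Ob C" and p: "p \<in> hom D (fobj F X) Y"
  shows "preimage_sieve X p S \<in> J\<^sub>C X"
proof -
  define K where "K Y = {S. is_sieve D Y S \<and>
    (\<forall>X \<in> Ob C. \<forall>p \<in> hom D (fobj F X) Y. preimage_sieve X p S \<in> J\<^sub>C X)}" for Y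
  note JC = C.grothendieck_topology_coherent
  have "grothendieck_topology D K"
    unfolding grothendieck_topology_def
  proof (intro conjI ballI allI impI)
    show "is_sieve D Y S" if "S \<in> K Y" for Y S using that by (simp add: K_def)
    show "{f \<in> Ar D. Cod D f = Y} \<in> K Y" for Y
    proof -
      have "preimage_sieve X p {f \<in> Ar D. Cod D f = Y} = {k \<in> Ar C. Cod C k = X}"
        if "p \<in> hom D (fobj F X) Y" for X p
        using Comp_fmap[OF that] by (auto simp: preimage_sieve_def hom_def)
      then show ?thesis
        using C.topology_maximal[OF JC] by (simp add: K_def D.is_sieve_maximal)
    qed
    show "pullback_sieve D f S \<in> K (Dom D f)" if f: "f \<in> Ar D" and S: "S \<in> K (Cod D f)" for f S
    proof -
      have "preimage_sieve X p (pullback_sieve D f S) \<in> J\<^sub>C X"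
        if X: "X \<in> Ob C" and p: "p \<in> hom D (fobj F X) (Dom D f)" for X p
      proof -
        have fh: "f \<in> hom D (Dom D f) (Cod D f)" using f by (simp add: hom_def)
        have "k \<in> preimage_sieve X p (pullback_sieve D f S) \<longleftrightarrow> k \<in> preimage_sieve X (f \<cdot>\<^bsub>D\<^esub> p) S" for k
        proof (cases "k \<in> Ar C \<and> Cod C k = X")
          case True
          then have k: "fmap F k \<in> hom D (fobj F (Dom C k)) (fobj F X)"
            using fmap_simps[of k] by (simp add: hom_def)
          show ?thesis
            using True D.Comp_assoc[OF fh p k] homD[OF D.Comp_in_hom[OF p k]]
            by (simp add: preimage_sieve_def D.pullback_sieve_iff)
        qed (auto simp: preimage_sieve_def)
        then have "preimage_sieve X p (pullback_sieve D f S) = preimage_sieve X (f \<cdot>\<^bsub>D\<^esub> p) S"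
          by blast
        then show ?thesis using S X D.Comp_in_hom[OF fh p] by (simp add: K_def)
      qed
      moreover have "is_sieve D (Cod D f) S" using S by (simp add: K_def)
      ultimately show ?thesis
        using D.is_sieve_pullback_sieve[OF _ f refl] by (simp add: K_def)
    qed
    show "R \<in> K Y"
      if Y: "Y \<in> Ob D" and S: "S \<in> K Y"
        and R: "is_sieve D Y R \<and> (\<forall>f \<in> S. pullback_sieve D f R \<in> K (Dom D f))" for Y S R
    proof -
      have "preimage_sieve X p R \<in> J\<^sub>C X" if X: "X \<in> Ob C" and p: "p \<in> hom D (fobj F X) Y" for X p
      proof (rule C.topology_transitive[OF JC X])
        show "preimage_sieve X p S \<in> J\<^sub>C X" using S X p by (simp add: K_def)
        show "is_sieve C X (preimage_sieve X p R)" using is_sieve_preimage_sieve R p by blast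
        fix k assume "k \<in> preimage_sieve X p S"
        then have k: "k \<in> Ar C" "Cod C k = X" "p \<cdot>\<^bsub>D\<^esub> fmap F k \<in> S"
          by (simp_all add: preimage_sieve_def)
        let ?Z = "Dom C k"
        let ?i = "Idn D (fobj F ?Z)"
        have Z: "?Z \<in> Ob C" "fobj F ?Z \<in> Ob D" using C.Dom_in_Ob[OF k(1)] fobj_in_Ob by simp_all
        have pk: "Dom D (p \<cdot>\<^bsub>D\<^esub> fmap F k) = fobj F ?Z" using homD[OF Comp_fmap[OF p k(1,2)]] by simp
        \<comment> \<open>Preimages of sieves on \<open>F Z\<close> itself are preimages along the identity.\<close>
        have "preimage_sieve ?Z ?i (pullback_sieve D (p \<cdot>\<^bsub>D\<^esub> fmap F k) R) \<in> J\<^sub>C ?Z"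
          using R k(3) pk Z D.Idn_in_hom[OF Z(2)] by (auto simp: K_def)
        moreover have "l \<in> preimage_sieve ?Z ?i (pullback_sieve D (p \<cdot>\<^bsub>D\<^esub> fmap F k) R)
            \<longleftrightarrow> l \<in> pullback_sieve C k (preimage_sieve X p R)" for l
        proof (cases "l \<in> Ar C \<and> Cod C l = ?Z")
          case True
          then have l: "l \<in> Ar C" "Cod C l = ?Z" by simp_all
          show ?thesis
            using l fmap_simps[OF l(1)] D.Idn_Comp[of "fmap F l" "fobj F ?Z"] pk
              Comp_fmap_Comp[OF p k(1,2) l] C.Comp_simps[OF k(1) l] k(2)
            by (simp add: preimage_sieve_def D.pullback_sieve_iff C.pullback_sieve_iff)
        qed (auto simp: preimage_sieve_def C.pullback_sieve_iff)
        ultimately show "pullback_sieve C k (preimage_sieve X p R) \<in> J\<^sub>C ?Z"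
          by (metis subsetI subset_antisym)
      qed
      then show ?thesis using R by (simp add: K_def)
    qed
  qed
  moreover have "D.is_coherent_coverage K"
    unfolding D.is_coherent_coverage_def
  proof (intro allI impI)
    fix B \<pi> and I :: "nat set"
    assume "finite I \<and> effective_epi_family D B I \<pi>"
    then have \<pi>: "finite I" "effective_epi_family D B I \<pi>" by simp_all
    note \<pi>D = D.effective_epi_familyD[OF \<pi>(2)]
    let ?S = "generated_sieve D B I \<pi>"
    have S_sieve: "is_sieve D B ?S" using D.is_sieve_generated_sieve[OF \<pi>D(1)] .
    have "preimage_sieve X p ?S \<in> J\<^sub>C X" if X: "X \<in> Ob C" and p: "p \<in> hom D (fobj F X) B" for X p
    proof -
      have "effective_epi_family D (Cod D p) I \<pi>" using \<pi>(2) homD(3)[OF p] by simp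
      then obtain J :: "nat set" and q where J: "finite J" "effective_epi_family C X J q"
        and fac: "\<forall>j \<in> J. \<exists>i \<in> I. \<exists>h \<in> hom D (fobj F (Dom C (q j))) (Dom D (\<pi> i)).
          p \<cdot>\<^bsub>D\<^esub> fmap F (q j) = \<pi> i \<cdot>\<^bsub>D\<^esub> h"
        by (rule effective_epi_family_lift[OF X homD(1,2)[OF p] \<pi>(1)])
      have sv: "is_sieve C X (preimage_sieve X p ?S)" using is_sieve_preimage_sieve[OF S_sieve p] .
      have "q j \<in> preimage_sieve X p ?S" if j: "j \<in> J" for j
      proof -
        obtain i h where "i \<in> I" "h \<in> hom D (fobj F (Dom C (q j))) (Dom D (\<pi> i))"
          "p \<cdot>\<^bsub>D\<^esub> fmap F (q j) = \<pi> i \<cdot>\<^bsub>D\<^esub> h"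
          using fac j by blast
        then have "p \<cdot>\<^bsub>D\<^esub> fmap F (q j) \<in> ?S"
          using D.generated_sieve_member[OF \<pi>D(1), of i h] homD(1,3) by metis
        then show ?thesis
          using C.effective_epi_familyD(3,4)[OF J(2) j] by (simp add: preimage_sieve_def)
      qed
      then show ?thesis
        using C.topology_superset[OF JC X C.generated_sieve_coherent[OF J] sv
            C.generated_sieve_subset[OF sv]] by blast
    qed
    then show "?S \<in> K B" using S_sieve by (simp add: K_def)
  qed
  ultimately have "S \<in> K Y" using D.coherent_topology_least S by blast
  then show ?thesis using X p by (simp add: K_def)
qed

section \<open>Sheaves on the target as right Kan extensions\<close>

text \<open>A natural transformation from \<open>X \<mapsto> hom D (F X) Y\<close> to \<open>H\<close>, that is, an element at \<open>Y\<close> of the right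
  Kan extension of \<open>H\<close> along \<open>F\<close>. The object \<open>X\<close> is an argument of \<open>y\<close> because it is not determined
  by \<open>p : F X \<rightarrow> Y\<close>.\<close>

definition ran_element :: "('o1, 'm1, 'v) presheaf \<Rightarrow> 'o2 \<Rightarrow> ('o1 \<Rightarrow> 'm2 \<Rightarrow> 'v) \<Rightarrow> bool" where
  "ran_element H Y y \<longleftrightarrow>
     (\<forall>X \<in> Ob C. \<forall>p \<in> hom D (fobj F X) Y. y X p \<in> fobj H X \<and>
        (\<forall>k \<in> Ar C. Cod C k = X \<longrightarrow> app (fmap H k) (y X p) = y (Dom C k) (p \<cdot>\<^bsub>D\<^esub> fmap F k)))"

lemma ran_elementD:
  assumes "ran_element H Y y" "X \<in> Ob C" "p \<in> hom D (fobj F X) Y"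
  shows "y X p \<in> fobj H X"
    and "\<lbrakk>k \<in> Ar C; Cod C k = X\<rbrakk> \<Longrightarrow> app (fmap H k) (y X p) = y (Dom C k) (p \<cdot>\<^bsub>D\<^esub> fmap F k)"
  using assms by (simp_all add: ran_element_def)

lemma preimage_sieve_iff:
  "k \<in> preimage_sieve X p S \<longleftrightarrow> k \<in> Ar C \<and> Cod C k = X \<and> p \<cdot>\<^bsub>D\<^esub> fmap F k \<in> S"
  by (simp add: preimage_sieve_def)

lemma sheaf_eq_on_preimage_sieve:
  assumes H: "is_sheaf C J\<^sub>C H" and X: "X \<in> Ob C" and p: "p \<in> hom D (fobj F X) Y"
    and S: "Y \<in> Ob D" "S \<in> J\<^sub>D Y" and a: "a \<in> fobj H X" "b \<in> fobj H X"
    and eq: "\<And>k. \<lbrakk>k \<in> Ar C; Cod C k = X; p \<cdot>\<^bsub>D\<^esub> fmap F k \<in> S\<rbrakk>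
      \<Longrightarrow> app (fmap H k) a = app (fmap H k) b"
  shows "a = b"
proof (rule C.sheaf_for_sieve_eq[OF _ _ _ a])
  show "sheaf_for_sieve C H X (preimage_sieve X p S)"
    using C.sheaf_for_covering[OF H X preimage_sieve_covering[OF S(2) X p]] .
  show "is_presheaf C H" using H by (simp add: is_sheaf_iff)
  show "is_sieve C X (preimage_sieve X p S)"
    using is_sieve_preimage_sieve[OF D.topology_sieve[OF D.grothendieck_topology_coherent S] p] .
qed (use eq in \<open>simp add: preimage_sieve_iff\<close>)

text \<open>The preimage of \<open>S\<close> along \<open>p\<close> covers \<open>X\<close>, and on it \<open>y\<close> and \<open>y'\<close> agree by naturality.\<close>

lemma ran_element_eq_on_covering:
  assumes H: "is_sheaf C J\<^sub>C H" and y: "ran_element H Y y" "ran_element H Y y'"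
    and S: "Y \<in> Ob D" "S \<in> J\<^sub>D Y"
    and eq: "\<And>X p. \<lbrakk>X \<in> Ob C; p \<in> hom D (fobj F X) Y; p \<in> S\<rbrakk> \<Longrightarrow> y X p = y' X p"
    and X: "X \<in> Ob C" and p: "p \<in> hom D (fobj F X) Y"
  shows "y X p = y' X p"
proof (rule sheaf_eq_on_preimage_sieve[OF H X p S])
  show "y X p \<in> fobj H X" "y' X p \<in> fobj H X" using ran_elementD(1) y X p by blast+
  fix k assume k: "k \<in> Ar C" "Cod C k = X" "p \<cdot>\<^bsub>D\<^esub> fmap F k \<in> S"
  show "app (fmap H k) (y X p) = app (fmap H k) (y' X p)"
    using ran_elementD(2)[OF y(1) X p k(1,2)] ran_elementD(2)[OF y(2) X p k(1,2)]
      eq[OF C.Dom_in_Ob[OF k(1)] Comp_fmap[OF p k(1,2)] k(3)] by simp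
qed

lemma effective_epi_covering:
  assumes "effective_epi D q"
  shows "generated_sieve D (Cod D q) {0 :: nat} (\<lambda>_. q) \<in> J\<^sub>D (Cod D q)"
  using D.generated_sieve_coherent[OF _ D.effective_epi_family_singleton[OF assms]] by simp

text \<open>An arrow \<open>q \<cdot> h\<close> of the sieve generated by \<open>q\<close> whose source is an image has \<open>h\<close> in the image of \<open>F\<close>,
  so that the value there is a restriction of the value at \<open>q\<close>.\<close>

lemma ran_element_eq_on_effective_epi:
  assumes H: "is_sheaf C J\<^sub>C H" and y: "ran_element H Y y" "ran_element H Y y'"
    and Z: "Z \<in> Ob C" and q: "q \<in> hom D (fobj F Z) Y" "effective_epi D q"
    and eq: "y Z q = y' Z q"
    and X: "X \<in> Ob C" and p: "p \<in> hom D (fobj F X) Y"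
  shows "y X p = y' X p"
proof (rule ran_element_eq_on_covering[OF H y _ _ _ X p])
  let ?S = "generated_sieve D Y {0 :: nat} (\<lambda>_. q)"
  show "Y \<in> Ob D" using D.hom_Ob[OF q(1)] by simp
  show "?S \<in> J\<^sub>D Y" using effective_epi_covering[OF q(2)] homD(3)[OF q(1)] by simp
  fix X p assume X: "X \<in> Ob C" and p: "p \<in> hom D (fobj F X) Y" and "p \<in> ?S"
  then obtain h where h: "h \<in> Ar D" "Cod D h = Dom D q" "p = q \<cdot>\<^bsub>D\<^esub> h"
    by (metis D.generated_sieveE)
  have "Dom D h = fobj F X"
    using D.Comp_simps(2)[OF homD(1)[OF q(1)] h(1,2)] h(3) homD(2)[OF p] by simp
  then have "h \<in> hom D (fobj F X) (fobj F Z)" using h homD(2)[OF q(1)] by (simp add: hom_def)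
  then obtain l where l: "l \<in> Ar C" "Dom C l = X" "Cod C l = Z" "fmap F l = h"
    using lift[OF X Z] by metis
  show "y X p = y' X p"
    using ran_elementD(2)[OF y(1) Z q(1) l(1,3)] ran_elementD(2)[OF y(2) Z q(1) l(1,3)] eq l h(3)
    by simp
qed

lemma ran_element_restrict:
  assumes y: "ran_element H Y y" and f: "f \<in> hom D Y' Y"
  shows "ran_element H Y' (\<lambda>X p. y X (f \<cdot>\<^bsub>D\<^esub> p))"
  unfolding ran_element_def
proof (intro ballI conjI impI)
  fix X p assume X: "X \<in> Ob C" and p: "p \<in> hom D (fobj F X) Y'"
  have fp: "f \<cdot>\<^bsub>D\<^esub> p \<in> hom D (fobj F X) Y" using D.Comp_in_hom[OF f p] .
  show "y X (f \<cdot>\<^bsub>D\<^esub> p) \<in> fobj H X" using ran_elementD(1)[OF y X fp] .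
  fix k assume k: "k \<in> Ar C" "Cod C k = X"
  have "fmap F k \<in> hom D (fobj F (Dom C k)) (fobj F X)" using fmap_simps[OF k(1)] k(2) by (simp add: hom_def)
  then show "app (fmap H k) (y X (f \<cdot>\<^bsub>D\<^esub> p)) = y (Dom C k) (f \<cdot>\<^bsub>D\<^esub> (p \<cdot>\<^bsub>D\<^esub> fmap F k))"
    using ran_elementD(2)[OF y X fp k] D.Comp_assoc[OF f p] by simp
qed

lemma ran_element_of_sheaf_element:
  assumes G: "is_presheaf D G" and b: "b \<in> fobj G Y"
  shows "ran_element (comp_ftr C G F) Y (\<lambda>X p. app (fmap G p) b)"
  unfolding ran_element_def
proof (intro ballI conjI impI)
  fix X p assume X: "X \<in> Ob C" and p: "p \<in> hom D (fobj F X) Y"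
  note pD = homD[OF p]
  show "app (fmap G p) b \<in> fobj (comp_ftr C G F) X"
    using D.restr_in[OF G pD(1)] b pD X by (simp add: comp_ftr_simps)
  fix k assume k: "k \<in> Ar C" "Cod C k = X"
  show "app (fmap (comp_ftr C G F) k) (app (fmap G p) b) = app (fmap G (p \<cdot>\<^bsub>D\<^esub> fmap F k)) b"
    using D.restr_Comp[OF G pD(1) fmap_simps(1)[OF k(1)]] fmap_simps(3)[OF k(1)] b pD k
    by (simp add: comp_ftr_simps)
qed

text \<open>A sheaf on \<open>D\<close> is the right Kan extension of its restriction to \<open>C\<close>. For an effective
  epimorphism \<open>q : F Z \<rightarrow> Y\<close>, the value \<open>y Z q\<close> descends along \<open>q\<close>; compatibility is checked after
  covering the source of the two arrows to be compared. The values of \<open>y\<close> at \<open>q\<close> determine all others.\<close>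

lemma ran_element_represented:
  assumes G: "is_sheaf D J\<^sub>D G" and Y: "Y \<in> Ob D" and y: "ran_element (comp_ftr C G F) Y y"
  shows "\<exists>!b. b \<in> fobj G Y \<and> (\<forall>X \<in> Ob C. \<forall>p \<in> hom D (fobj F X) Y. app (fmap G p) b = y X p)"
proof -
  have pre: "is_presheaf D G" using G by (simp add: is_sheaf_iff)
  note GC = is_sheaf_comp_ftr[OF G]
  obtain Z q where Z: "Z \<in> Ob C" and q: "q \<in> Ar D" "Dom D q = fobj F Z" "Cod D q = Y"
    "effective_epi D q"
    using Y by (rule cover)
  have qh: "q \<in> hom D (fobj F Z) Y" using q by (simp add: hom_def)
  have y0: "y Z q \<in> fobj G (fobj F Z)"
    using ran_elementD(1)[OF y Z qh] Z by (simp add: comp_ftr_simps)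
  have "\<exists>!b. b \<in> fobj G (Cod D q) \<and> app (fmap G q) b = y Z q"
  proof (rule D.sheaf_ex1_amalgamation[OF G q(4)])
    show "y Z q \<in> fobj G (Dom D q)" using y0 q(2) by simp
    fix W g h
    assume W: "W \<in> Ob D" and gh: "g \<in> hom D W (Dom D q)" "h \<in> hom D W (Dom D q)"
      and eq: "q \<cdot>\<^bsub>D\<^esub> g = q \<cdot>\<^bsub>D\<^esub> h"
    obtain V r where V: "V \<in> Ob C" and r: "r \<in> Ar D" "Dom D r = fobj F V" "Cod D r = W"
      "effective_epi D r"
      using W by (rule cover)
    have rh: "r \<in> hom D (fobj F V) W" using r by (simp add: hom_def)
    have "app (fmap G r) (app (fmap G g) (y Z q)) = y V (q \<cdot>\<^bsub>D\<^esub> (g \<cdot>\<^bsub>D\<^esub> r))"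
      if g: "g \<in> hom D W (Dom D q)" for g
    proof -
      have "g \<cdot>\<^bsub>D\<^esub> r \<in> hom D (fobj F V) (fobj F Z)" using D.Comp_in_hom[OF g rh] q(2) by simp
      then obtain k where k: "k \<in> Ar C" "Dom C k = V" "Cod C k = Z" "fmap F k = g \<cdot>\<^bsub>D\<^esub> r"
        using lift[OF V Z] by metis
      have "app (fmap G r) (app (fmap G g) (y Z q)) = app (fmap G (g \<cdot>\<^bsub>D\<^esub> r)) (y Z q)"
        using D.restr_Comp[OF pre homD(1)[OF g] r(1)] r(3) homD(2,3)[OF g] y0 q(2) by simp
      then show ?thesis
        using ran_elementD(2)[OF y Z qh k(1,3)] k by (simp add: comp_ftr_simps)
    qed
    moreover have "q \<cdot>\<^bsub>D\<^esub> (g \<cdot>\<^bsub>D\<^esub> r) = q \<cdot>\<^bsub>D\<^esub> (h \<cdot>\<^bsub>D\<^esub> r)"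
      using D.Comp_assoc_Ar[of q g r] D.Comp_assoc_Ar[of q h r] q(1) r(1,3)
        homD[OF gh(1)] homD[OF gh(2)] eq by simp
    ultimately have "app (fmap G r) (app (fmap G g) (y Z q)) = app (fmap G r) (app (fmap G h) (y Z q))"
      using gh by simp
    moreover have "app (fmap G g) (y Z q) \<in> fobj G (Cod D r)" "app (fmap G h) (y Z q) \<in> fobj G (Cod D r)"
      using D.restr_in[OF pre homD(1)[OF gh(1)], of "y Z q"] homD(2,3)[OF gh(1)]
        D.restr_in[OF pre homD(1)[OF gh(2)], of "y Z q"] homD(2,3)[OF gh(2)] y0 q(2) r(3) by simp_all
    ultimately show "app (fmap G g) (y Z q) = app (fmap G h) (y Z q)"
      using D.sheaf_eq_on_effective_epi[OF G r(4)] by blast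
  qed
  then obtain b where b: "b \<in> fobj G Y" "app (fmap G q) b = y Z q" using q(3) by blast
  show ?thesis
  proof (rule ex1I[of _ b])
    show "b \<in> fobj G Y \<and> (\<forall>X \<in> Ob C. \<forall>p \<in> hom D (fobj F X) Y. app (fmap G p) b = y X p)"
      using ran_element_eq_on_effective_epi[OF GC ran_element_of_sheaf_element[OF pre b(1)] y Z qh q(4)]
        b by blast
    fix b' assume b': "b' \<in> fobj G Y \<and> (\<forall>X \<in> Ob C. \<forall>p \<in> hom D (fobj F X) Y. app (fmap G p) b' = y X p)"
    then have "app (fmap G q) b' = app (fmap G q) b" using b(2) Z qh by simp
    then show "b' = b" using D.sheaf_eq_on_effective_epi[OF G q(4)] b' b(1) q(3) by simp
  qed
qed

section \<open>Restriction of sheaves is an equivalence\<close>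

abbreviation "Sh\<^sub>D \<equiv> sheaf_cat D J\<^sub>D"
abbreviation "Sh\<^sub>C \<equiv> sheaf_cat C J\<^sub>C"
abbreviation "restriction \<equiv> precomp_ftr C Sh\<^sub>D F"

lemma restriction_simps:
  "is_sheaf D J\<^sub>D G \<Longrightarrow> fobj restriction G = comp_ftr C G F"
  "(G, H, \<tau>) \<in> Ar Sh\<^sub>D \<Longrightarrow>
     fmap restriction (G, H, \<tau>) = (comp_ftr C G F, comp_ftr C H F, \<lambda>X \<in> Ob C. \<tau> (fobj F X))"
  by (simp_all add: precomp_ftr_def sheaf_cat_Ob)

lemma restriction_nat_trans:
  assumes "nat_trans (op_cat D) set_cat G H \<tau>"
  shows "nat_trans (op_cat C) set_cat (comp_ftr C G F) (comp_ftr C H F) (\<lambda>X \<in> Ob C. \<tau> (fobj F X))"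
proof -
  note \<tau> = D.presheaf_nat_transD[OF assms]
  show ?thesis
  proof (rule C.presheaf_nat_transI)
    show "is_presheaf C (comp_ftr C G F)" "is_presheaf C (comp_ftr C H F)"
      using is_presheaf_comp_ftr[OF cat_functor_axioms] \<tau>(1,2) by blast+
    fix f a assume f: "f \<in> Ar C" and a: "a \<in> fobj (comp_ftr C G F) (Cod C f)"
    then have "a \<in> fobj G (Cod D (fmap F f))"
      using fmap_simps(3)[OF f] C.Cod_in_Ob[OF f] by (simp add: comp_ftr_simps)
    then show "app ((\<lambda>X \<in> Ob C. \<tau> (fobj F X)) (Dom C f)) (app (fmap (comp_ftr C G F) f) a)
        = app (fmap (comp_ftr C H F) f) (app ((\<lambda>X \<in> Ob C. \<tau> (fobj F X)) (Cod C f)) a)"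
      using \<tau>(6)[OF fmap_simps(1)[OF f]] fmap_simps(2,3)[OF f] C.Dom_in_Ob[OF f] C.Cod_in_Ob[OF f] f
      by (simp add: comp_ftr_simps)
  qed (use \<tau>(4) in \<open>simp_all add: comp_ftr_simps fobj_in_Ob\<close>)
qed

lemma cat_functor_restriction:
  "cat_functor (Sh\<^sub>D :: (('o2, 'm2, 'v) presheaf, ('o2, 'm2, 'v) presheaf_map) cat) Sh\<^sub>C restriction"
proof -
  interpret ShD: category "Sh\<^sub>D :: (('o2, 'm2, 'v) presheaf, ('o2, 'm2, 'v) presheaf_map) cat"
    by (rule D.category_sheaf_cat)
  interpret ShC: category "Sh\<^sub>C :: (('o1, 'm1, 'v) presheaf, ('o1, 'm1, 'v) presheaf_map) cat"
    by (rule C.category_sheaf_cat)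
  show ?thesis
  proof
    fix G assume "G \<in> Ob (Sh\<^sub>D :: (('o2, 'm2, 'v) presheaf, ('o2, 'm2, 'v) presheaf_map) cat)"
    then have G: "is_sheaf D J\<^sub>D G" by (simp add: sheaf_cat_Ob)
    show "fobj restriction G \<in> Ob Sh\<^sub>C"
      using is_sheaf_comp_ftr[OF G] by (simp add: sheaf_cat_Ob restriction_simps G)
    have "Idn Sh\<^sub>D G \<in> Ar Sh\<^sub>D" using ShD.Idn_simps(1) G by (simp add: sheaf_cat_Ob)
    then show "fmap restriction (Idn Sh\<^sub>D G) = Idn Sh\<^sub>C (fobj restriction G)"
      using G
      by (auto simp: sheaf_cat_Idn restriction_simps comp_ftr_simps fobj_in_Ob restrict_def fun_eq_iff)
  next
    fix m :: "('o2, 'm2, 'v) presheaf_map" and G H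
    assume m: "m \<in> hom Sh\<^sub>D G H"
    then obtain \<tau> where G: "is_sheaf D J\<^sub>D G" and H: "is_sheaf D J\<^sub>D H" and m_eq: "m = (G, H, \<tau>)"
      and \<tau>: "nat_trans (op_cat D) set_cat G H \<tau>"
      by (auto simp: sheaf_cat_hom)
    show "fmap restriction m \<in> hom Sh\<^sub>C (fobj restriction G) (fobj restriction H)"
      using homD(1)[OF m] restriction_nat_trans[OF \<tau>] is_sheaf_comp_ftr[OF G] is_sheaf_comp_ftr[OF H] G H
      by (simp add: m_eq restriction_simps sheaf_cat_hom)
  next
    fix n m :: "('o2, 'm2, 'v) presheaf_map" and G H K
    assume n: "n \<in> hom Sh\<^sub>D H K" and m: "m \<in> hom Sh\<^sub>D G H"
    obtain \<sigma> \<tau> where eqs: "n = (H, K, \<sigma>)" "m = (G, H, \<tau>)" using m n by (auto simp: sheaf_cat_hom)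
    have "n \<cdot>\<^bsub>Sh\<^sub>D\<^esub> m \<in> Ar Sh\<^sub>D" using homD(1)[OF ShD.Comp_in_hom[OF n m]] .
    then show "fmap restriction (n \<cdot>\<^bsub>Sh\<^sub>D\<^esub> m) = fmap restriction n \<cdot>\<^bsub>Sh\<^sub>C\<^esub> fmap restriction m"
      using homD(1)[OF m] homD(1)[OF n] unfolding eqs
      by (auto simp: sheaf_cat_Comp restriction_simps fobj_in_Ob restrict_def fun_eq_iff)
  qed (simp_all add: precomp_ftr_def)
qed

lemma restriction_faithful:
  assumes G: "is_sheaf D J\<^sub>D G" and H: "is_sheaf D J\<^sub>D H"
    and \<tau>: "nat_trans (op_cat D) set_cat G H \<tau>" and \<tau>': "nat_trans (op_cat D) set_cat G H \<tau>'"
    and eq: "\<And>X. X \<in> Ob C \<Longrightarrow> \<tau> (fobj F X) = \<tau>' (fobj F X)"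
  shows "\<tau> = \<tau>'"
proof -
  note \<tau>D = D.presheaf_nat_transD[OF \<tau>] and \<tau>'D = D.presheaf_nat_transD[OF \<tau>']
  have "\<tau> Y = \<tau>' Y" if Y: "Y \<in> Ob D" for Y
  proof (rule set_map_eqI[OF \<tau>D(4)[OF Y] \<tau>'D(4)[OF Y]])
    fix a assume a: "a \<in> fobj G Y"
    obtain X q where X: "X \<in> Ob C" and q: "q \<in> Ar D" "Dom D q = fobj F X" "Cod D q = Y"
      "effective_epi D q" using Y by (rule cover)
    show "app (\<tau> Y) a = app (\<tau>' Y) a"
    proof (rule D.sheaf_eq_on_effective_epi[OF H q(4)])
      show "app (\<tau> Y) a \<in> fobj H (Cod D q)" "app (\<tau>' Y) a \<in> fobj H (Cod D q)"
        using \<tau>D(5)[OF Y a] \<tau>'D(5)[OF Y a] q(3) by simp_all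
      show "app (fmap H q) (app (\<tau> Y) a) = app (fmap H q) (app (\<tau>' Y) a)"
        using \<tau>D(6)[OF q(1), of a] \<tau>'D(6)[OF q(1), of a] a q(2,3) eq[OF X] by simp
    qed
  qed
  then show ?thesis using \<tau>D(3) \<tau>'D(3) by (rule extensionalityI[rotated -1])
qed

text \<open>For \<open>a \<in> G Y\<close> the elements \<open>\<sigma> X (G p a)\<close>, where \<open>p : F X \<rightarrow> Y\<close>, form an element of the right Kan
  extension of the restriction of \<open>H\<close>, hence come from a unique \<open>b \<in> H Y\<close>; this is the image of \<open>a\<close>.
  The description of \<open>b\<close> involves no choices, which makes naturality and the extension property
  immediate.\<close>

lemma restriction_full:
  assumes G: "is_sheaf D J\<^sub>D G" and H: "is_sheaf D J\<^sub>D H"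
    and \<sigma>: "nat_trans (op_cat C) set_cat (comp_ftr C G F) (comp_ftr C H F) \<sigma>"
  obtains \<tau> where "nat_trans (op_cat D) set_cat G H \<tau>"
    "\<And>X. X \<in> Ob C \<Longrightarrow> \<tau> (fobj F X) = \<sigma> X"
proof -
  have preG: "is_presheaf D G" and preH: "is_presheaf D H" using G H by (simp_all add: is_sheaf_iff)
  note \<sigma>D = C.presheaf_nat_transD[OF \<sigma>]
  have \<sigma>_in: "app (\<sigma> X) a \<in> fobj H (fobj F X)" if "X \<in> Ob C" "a \<in> fobj G (fobj F X)" for X a
    using \<sigma>D(5)[of X a] that by (simp add: comp_ftr_simps)
  have \<sigma>_nat: "app (\<sigma> (Dom C k)) (app (fmap G (fmap F k)) a)
      = app (fmap H (fmap F k)) (app (\<sigma> (Cod C k)) a)"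
    if "k \<in> Ar C" "a \<in> fobj G (fobj F (Cod C k))" for k a
    using \<sigma>D(6)[OF that(1), of a] that C.Cod_in_Ob[OF that(1)] by (simp add: comp_ftr_simps)
  define is_value where "is_value Y a b \<longleftrightarrow> b \<in> fobj H Y \<and>
    (\<forall>X \<in> Ob C. \<forall>p \<in> hom D (fobj F X) Y. app (fmap H p) b = app (\<sigma> X) (app (fmap G p) a))" for Y a b
  have G_in: "app (fmap G p) a \<in> fobj G (fobj F X)" if "a \<in> fobj G Y" "p \<in> hom D (fobj F X) Y" for p a X Y
    using D.restr_in[OF preG homD(1)[OF that(2)]] homD(2,3)[OF that(2)] that(1) by simp
  have ex1: "\<exists>!b. is_value Y a b" if Y: "Y \<in> Ob D" and a: "a \<in> fobj G Y" for Y a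
  proof -
    have "ran_element (comp_ftr C H F) Y (\<lambda>X p. app (\<sigma> X) (app (fmap G p) a))"
      unfolding ran_element_def
    proof (intro ballI conjI impI)
      fix X p assume X: "X \<in> Ob C" and p: "p \<in> hom D (fobj F X) Y"
      show "app (\<sigma> X) (app (fmap G p) a) \<in> fobj (comp_ftr C H F) X"
        using \<sigma>_in[OF X G_in[OF a p]] X by (simp add: comp_ftr_simps)
      fix k assume k: "k \<in> Ar C" "Cod C k = X"
      show "app (fmap (comp_ftr C H F) k) (app (\<sigma> X) (app (fmap G p) a))
          = app (\<sigma> (Dom C k)) (app (fmap G (p \<cdot>\<^bsub>D\<^esub> fmap F k)) a)"
        using \<sigma>_nat[OF k(1), of "app (fmap G p) a"] G_in[OF a p] k
          D.restr_Comp[OF preG homD(1)[OF p] fmap_simps(1)[OF k(1)], of a] fmap_simps(3)[OF k(1)]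
          homD(2,3)[OF p] a
        by (simp add: comp_ftr_simps)
    qed
    from ran_element_represented[OF H Y this] show ?thesis unfolding is_value_def .
  qed
  define val where "val Y a = (THE b. is_value Y a b)" for Y a
  have val: "is_value Y a (val Y a)" if "Y \<in> Ob D" "a \<in> fobj G Y" for Y a
    unfolding val_def using theI'[OF ex1[OF that]] .
  have val_eq: "val Y a = b" if "Y \<in> Ob D" "a \<in> fobj G Y" "is_value Y a b" for Y a b
    using ex1[OF that(1,2)] val[OF that(1,2)] that(3) by blast
  define \<tau> where "\<tau> = (\<lambda>Y \<in> Ob D. (fobj G Y, fobj H Y, \<lambda>a \<in> fobj G Y. val Y a))"
  have app_\<tau>: "app (\<tau> Y) a = val Y a" if "Y \<in> Ob D" "a \<in> fobj G Y" for Y a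
    using that by (simp add: \<tau>_def app_def)
  have \<tau>_hom: "\<tau> Y \<in> hom set_cat (fobj G Y) (fobj H Y)" if "Y \<in> Ob D" for Y
    using that val by (auto simp: \<tau>_def set_cat_hom is_value_def)
  have "nat_trans (op_cat D) set_cat G H \<tau>"
  proof (rule D.presheaf_nat_transI[OF preG preH _ \<tau>_hom])
    show "\<tau> \<in> extensional (Ob D)" by (simp add: \<tau>_def)
    fix f a assume f: "f \<in> Ar D" and a: "a \<in> fobj G (Cod D f)"
    have ob: "Dom D f \<in> Ob D" "Cod D f \<in> Ob D" using f by (simp_all add: D.Dom_in_Ob D.Cod_in_Ob)
    have fh: "f \<in> hom D (Dom D f) (Cod D f)" using f by (simp add: hom_def)
    have fa: "app (fmap G f) a \<in> fobj G (Dom D f)" using D.restr_in[OF preG f a] .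
    let ?b = "val (Cod D f) a"
    have b: "?b \<in> fobj H (Cod D f)"
      "\<And>X p. \<lbrakk>X \<in> Ob C; p \<in> hom D (fobj F X) (Cod D f)\<rbrakk>
        \<Longrightarrow> app (fmap H p) ?b = app (\<sigma> X) (app (fmap G p) a)"
      using val[OF ob(2) a] by (simp_all add: is_value_def)
    have "is_value (Dom D f) (app (fmap G f) a) (app (fmap H f) ?b)"
      unfolding is_value_def
    proof (intro conjI ballI)
      show "app (fmap H f) ?b \<in> fobj H (Dom D f)" using D.restr_in[OF preH f b(1)] .
      fix X p assume X: "X \<in> Ob C" and p: "p \<in> hom D (fobj F X) (Dom D f)"
      show "app (fmap H p) (app (fmap H f) ?b) = app (\<sigma> X) (app (fmap G p) (app (fmap G f) a))"
        using b(2)[OF X D.Comp_in_hom[OF fh p]] D.restr_Comp[OF preH f homD(1,3)[OF p] b(1)]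
          D.restr_Comp[OF preG f homD(1,3)[OF p] a] by simp
    qed
    then have "val (Dom D f) (app (fmap G f) a) = app (fmap H f) ?b"
      by (rule val_eq[OF ob(1) fa])
    then show "app (\<tau> (Dom D f)) (app (fmap G f) a) = app (fmap H f) (app (\<tau> (Cod D f)) a)"
      using app_\<tau>[OF ob(1) fa] app_\<tau>[OF ob(2) a] by simp
  qed
  moreover have "\<tau> (fobj F X) = \<sigma> X" if X: "X \<in> Ob C" for X
  proof (rule set_map_eqI[OF \<tau>_hom])
    show FX: "fobj F X \<in> Ob D" using fobj_in_Ob[OF X] .
    show "\<sigma> X \<in> hom set_cat (fobj G (fobj F X)) (fobj H (fobj F X))"
      using \<sigma>D(4)[OF X] X by (simp add: comp_ftr_simps)
    fix a assume a: "a \<in> fobj G (fobj F X)"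
    have "is_value (fobj F X) a (app (\<sigma> X) a)"
      unfolding is_value_def
    proof (intro conjI ballI \<sigma>_in[OF X a])
      fix Z p assume Z: "Z \<in> Ob C" and p: "p \<in> hom D (fobj F Z) (fobj F X)"
      obtain k where k: "k \<in> Ar C" "Dom C k = Z" "Cod C k = X" "fmap F k = p"
        using lift[OF Z X p] by metis
      show "app (fmap H p) (app (\<sigma> X) a) = app (\<sigma> Z) (app (fmap G p) a)"
        using \<sigma>_nat[OF k(1), of a] a k by simp
    qed
    then show "app (\<tau> (fobj F X)) a = app (\<sigma> X) a"
      using app_\<tau>[OF FX a] val_eq[OF FX a] by simp
  qed
  ultimately show thesis by (rule that)
qed

lemma fully_faithful_restriction:
  "fully_faithful (Sh\<^sub>D :: (('o2, 'm2, 'v) presheaf, ('o2, 'm2, 'v) presheaf_map) cat) Sh\<^sub>C restriction"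
  unfolding fully_faithful_def
proof (intro ballI)
  fix G H :: "('o2, 'm2, 'v) presheaf"
  assume "G \<in> Ob Sh\<^sub>D" "H \<in> Ob Sh\<^sub>D"
  then have G: "is_sheaf D J\<^sub>D G" and H: "is_sheaf D J\<^sub>D H" by (simp_all add: sheaf_cat_Ob)
  have map: "fmap restriction (G, H, \<tau>) = (comp_ftr C G F, comp_ftr C H F, \<lambda>X \<in> Ob C. \<tau> (fobj F X))"
    if "nat_trans (op_cat D) set_cat G H \<tau>" for \<tau>
  proof -
    have "(G, H, \<tau>) \<in> hom Sh\<^sub>D G H" using G H that by (simp add: sheaf_cat_hom)
    from restriction_simps(2)[OF homD(1)[OF this]] show ?thesis .
  qed
  show "bij_betw (fmap restriction) (hom Sh\<^sub>D G H) (hom Sh\<^sub>C (fobj restriction G) (fobj restriction H))"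
  proof (rule bij_betw_imageI)
    show "inj_on (fmap restriction) (hom Sh\<^sub>D G H)"
    proof (rule inj_onI)
      fix m n assume "m \<in> hom Sh\<^sub>D G H" "n \<in> hom Sh\<^sub>D G H" and eq: "fmap restriction m = fmap restriction n"
      then obtain \<tau> \<tau>' where m: "m = (G, H, \<tau>)" "nat_trans (op_cat D) set_cat G H \<tau>"
        and n: "n = (G, H, \<tau>')" "nat_trans (op_cat D) set_cat G H \<tau>'"
        by (auto simp: sheaf_cat_hom)
      have "(\<lambda>X \<in> Ob C. \<tau> (fobj F X)) = (\<lambda>X \<in> Ob C. \<tau>' (fobj F X))"
        using eq map[OF m(2)] map[OF n(2)] m(1) n(1) by simp
      then have "\<tau> (fobj F X) = \<tau>' (fobj F X)" if "X \<in> Ob C" for X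
        using that by (metis restrict_apply')
      then show "m = n" using restriction_faithful[OF G H m(2) n(2)] m(1) n(1) by simp
    qed
    show "fmap restriction ` hom Sh\<^sub>D G H = hom Sh\<^sub>C (fobj restriction G) (fobj restriction H)"
    proof
      show "fmap restriction ` hom Sh\<^sub>D G H \<subseteq> hom Sh\<^sub>C (fobj restriction G) (fobj restriction H)"
        using cat_functor.fmap_in_hom[OF cat_functor_restriction] by blast
      show "hom Sh\<^sub>C (fobj restriction G) (fobj restriction H) \<subseteq> fmap restriction ` hom Sh\<^sub>D G H"
      proof
        fix n assume "n \<in> hom Sh\<^sub>C (fobj restriction G) (fobj restriction H)"
        then obtain \<sigma> where n: "n = (comp_ftr C G F, comp_ftr C H F, \<sigma>)"
          and \<sigma>: "nat_trans (op_cat C) set_cat (comp_ftr C G F) (comp_ftr C H F) \<sigma>"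
          using G H by (auto simp: sheaf_cat_hom restriction_simps)
        obtain \<tau> where \<tau>: "nat_trans (op_cat D) set_cat G H \<tau>" and eq: "\<And>X. X \<in> Ob C \<Longrightarrow> \<tau> (fobj F X) = \<sigma> X"
          using restriction_full[OF G H \<sigma>] by blast
        have "(\<lambda>X \<in> Ob C. \<tau> (fobj F X)) = \<sigma>"
          using eq C.presheaf_nat_transD(3)[OF \<sigma>] by (auto simp: restrict_def extensional_def fun_eq_iff)
        then have "n = fmap restriction (G, H, \<tau>)" using map[OF \<tau>] n by simp
        moreover have "(G, H, \<tau>) \<in> hom Sh\<^sub>D G H" using G H \<tau> by (simp add: sheaf_cat_hom)
        ultimately show "n \<in> fmap restriction ` hom Sh\<^sub>D G H" by blast
      qed
    qed
  qed
qed

text \<open>The right Kan extension \<open>G\<close> of \<open>H\<close>, with \<open>G Y\<close> realised as a subset of \<open>H X\<close> by evaluating natural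
  families at a chosen effective epimorphism \<open>F X \<rightarrow> Y\<close>. For the sheaf condition on \<open>S\<close>, the value at
  \<open>p : F X \<rightarrow> Y\<close> of the amalgamation is glued along the preimage of \<open>S\<close>, which covers \<open>X\<close>.\<close>

lemma restriction_essentially_surjective:
  fixes H :: "('o1, 'm1, 'v) presheaf"
  assumes H: "is_sheaf C J\<^sub>C H"
  obtains G :: "('o2, 'm2, 'v) presheaf" and \<tau> where "is_sheaf D J\<^sub>D G"
    "nat_trans (op_cat C) set_cat (comp_ftr C G F) H \<tau>"
    "\<And>X. X \<in> Ob C \<Longrightarrow> bij_betw (app (\<tau> X)) (fobj (comp_ftr C G F) X) (fobj H X)"
proof -
  have preH: "is_presheaf C H" using H by (simp add: is_sheaf_iff)
  have "\<forall>Y \<in> Ob D. \<exists>X p. X \<in> Ob C \<and> p \<in> hom D (fobj F X) Y \<and> effective_epi D p"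
    using covers by blast
  then obtain X0 p0 where chosen: "\<forall>Y \<in> Ob D. X0 Y \<in> Ob C \<and> p0 Y \<in> hom D (fobj F (X0 Y)) Y \<and>
      effective_epi D (p0 Y)"
    by metis
  have X0: "X0 Y \<in> Ob C" and p0: "p0 Y \<in> hom D (fobj F (X0 Y)) Y" "effective_epi D (p0 Y)"
    if "Y \<in> Ob D" for Y
    using chosen that by blast+
  \<comment> \<open>\<open>E Y a\<close> is the natural family that the element \<open>a\<close> of \<open>P Y\<close> stands for.\<close>
  define P where "P Y = {y (X0 Y) (p0 Y) | y. ran_element H Y y}" for Y
  define E where "E Y a = (SOME y. ran_element H Y y \<and> y (X0 Y) (p0 Y) = a)" for Y a
  have E: "ran_element H Y (E Y a)" "E Y a (X0 Y) (p0 Y) = a" if "a \<in> P Y" for Y a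
  proof -
    have "\<exists>y. ran_element H Y y \<and> y (X0 Y) (p0 Y) = a" using that by (auto simp: P_def)
    from someI_ex[OF this] show "ran_element H Y (E Y a)" "E Y a (X0 Y) (p0 Y) = a"
      unfolding E_def by simp_all
  qed
  have P_intro: "y (X0 Y) (p0 Y) \<in> P Y" if "ran_element H Y y" for Y y
    using that by (auto simp: P_def)
  have E_eval: "E Y (y (X0 Y) (p0 Y)) X p = y X p"
    if y: "ran_element H Y y" and X: "X \<in> Ob C" and p: "p \<in> hom D (fobj F X) Y" for Y y X p
  proof -
    have Y: "Y \<in> Ob D" using D.hom_Ob[OF p] by simp
    show ?thesis
      using ran_element_eq_on_effective_epi[OF H E(1)[OF P_intro[OF y]] y X0[OF Y] p0[OF Y]
          E(2)[OF P_intro[OF y]] X p] .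
  qed
  have P_eqI: "a = b"
    if "Y \<in> Ob D" "a \<in> P Y" "b \<in> P Y"
      "\<And>X p. \<lbrakk>X \<in> Ob C; p \<in> hom D (fobj F X) Y\<rbrakk> \<Longrightarrow> E Y a X p = E Y b X p" for Y a b
    using that(4)[OF X0[OF that(1)] p0(1)[OF that(1)]] E(2)[OF that(2)] E(2)[OF that(3)] by simp
  \<comment> \<open>Restriction along \<open>f\<close> is precomposition of natural families with \<open>f\<close>, evaluated at the chosen arrow.\<close>
  define r where "r f a = E (Cod D f) a (X0 (Dom D f)) (f \<cdot>\<^bsub>D\<^esub> p0 (Dom D f))" for f a
  have r_in: "r f a \<in> P (Dom D f)"
    and E_r: "\<lbrakk>X \<in> Ob C; p \<in> hom D (fobj F X) (Dom D f)\<rbrakk>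
      \<Longrightarrow> E (Dom D f) (r f a) X p = E (Cod D f) a X (f \<cdot>\<^bsub>D\<^esub> p)"
    if f: "f \<in> Ar D" and a: "a \<in> P (Cod D f)" for f a X p
  proof -
    have fh: "f \<in> hom D (Dom D f) (Cod D f)" using f by (simp add: hom_def)
    note ran = ran_element_restrict[OF E(1)[OF a] fh]
    show "r f a \<in> P (Dom D f)" using P_intro[OF ran] by (simp add: r_def)
    show "E (Dom D f) (r f a) X p = E (Cod D f) a X (f \<cdot>\<^bsub>D\<^esub> p)"
      if "X \<in> Ob C" "p \<in> hom D (fobj F X) (Dom D f)"
      using E_eval[OF ran that] by (simp add: r_def)
  qed
  define G where "G = mk_presheaf D P r"
  have preG: "is_presheaf D G"
    unfolding G_def
  proof (rule D.is_presheaf_mk_presheaf)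
    show "r f a \<in> P (Dom D f)" if "f \<in> Ar D" "a \<in> P (Cod D f)" for f a using r_in[OF that] .
    show "r (Idn D Y) a = a" if Y: "Y \<in> Ob D" and a: "a \<in> P Y" for Y a
      using D.Idn_left[OF p0(1)[OF Y]] D.Idn_simps[OF Y] E(2)[OF a] by (simp add: r_def)
    show "r (g \<cdot>\<^bsub>D\<^esub> f) a = r f (r g a)"
      if g: "g \<in> Ar D" and f: "f \<in> Ar D" "Cod D f = Dom D g" and a: "a \<in> P (Cod D g)" for g f a
    proof -
      note Y = D.Dom_in_Ob[OF f(1)]
      have fh: "f \<in> hom D (Dom D f) (Dom D g)" and gh: "g \<in> hom D (Dom D g) (Cod D g)"
        using f g by (simp_all add: hom_def)
      show ?thesis
        using E_r[OF g a X0[OF Y] D.Comp_in_hom[OF fh p0(1)[OF Y]]] D.Comp_assoc[OF gh fh p0(1)[OF Y]]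
          D.Comp_simps[OF g f] f(2) by (simp add: r_def)
    qed
  qed
  have G_obj: "fobj G Y = P Y" if "Y \<in> Ob D" for Y
    using that by (simp add: G_def mk_presheaf_simps)
  have G_map: "app (fmap G f) a = r f a" if "f \<in> Ar D" "a \<in> P (Cod D f)" for f a
    using that by (simp add: G_def mk_presheaf_simps)
  \<comment> \<open>Evaluation at the identity of \<open>F X\<close>: the comparison map from the restriction of \<open>G\<close> to \<open>H\<close>.\<close>
  define ev where "ev X a = E (fobj F X) a X (Idn D (fobj F X))" for X a
  have id_F: "Idn D (fobj F X) \<in> hom D (fobj F X) (fobj F X)" if "X \<in> Ob C" for X
    using D.Idn_in_hom[OF fobj_in_Ob[OF that]] .
  have ev_in: "ev X a \<in> fobj H X" if "X \<in> Ob C" "a \<in> P (fobj F X)" for X a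
    using ran_elementD(1)[OF E(1)[OF that(2)] that(1) id_F[OF that(1)]] by (simp add: ev_def)
  have ev_r: "ev X (r p a) = E Y a X p" if X: "X \<in> Ob C" and p: "p \<in> hom D (fobj F X) Y"
    and a: "a \<in> P Y" for X p a Y
    using E_r[OF homD(1)[OF p], of a X "Idn D (fobj F X)"] homD(2,3)[OF p] a X id_F[OF X]
      D.Idn_right[OF p] by (simp add: ev_def)
  have ev_nat: "app (fmap H k) (ev (Cod C k) a) = ev (Dom C k) (r (fmap F k) a)"
    if k: "k \<in> Ar C" and a: "a \<in> P (fobj F (Cod C k))" for k a
  proof -
    note ob = C.Dom_in_Ob[OF k] C.Cod_in_Ob[OF k]
    have Fk: "fmap F k \<in> hom D (fobj F (Dom C k)) (fobj F (Cod C k))"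
      using fmap_simps[OF k] by (simp add: hom_def)
    show ?thesis
      using ran_elementD(2)[OF E(1)[OF a] ob(2) id_F[OF ob(2)] k refl] D.Idn_left[OF Fk]
        ev_r[OF ob(1) Fk a] by (simp add: ev_def)
  qed
  have "sheaf_for_sieve D G Y S" if Y: "Y \<in> Ob D" and S: "S \<in> J\<^sub>D Y" for Y S
    unfolding sheaf_for_sieve_def
  proof (intro allI impI)
    fix x assume x: "matching_family D G S x"
    have S_sieve: "is_sieve D Y S" using D.topology_sieve[OF D.grothendieck_topology_coherent Y S] .
    note SD = D.is_sieveD[OF S_sieve]
    have xP: "x f \<in> P (Dom D f)" if "f \<in> S" for f
      using matching_familyD(1)[OF x that] G_obj[OF D.Dom_in_Ob[OF SD(1)[OF that]]] by simp
    have xr: "r g (x f) = x (f \<cdot>\<^bsub>D\<^esub> g)" if "f \<in> S" "g \<in> Ar D" "Cod D g = Dom D f" for f g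
      using matching_familyD(2)[OF x that] G_map[OF that(2), of "x f"] xP[OF that(1)] that(3) by simp
    have z_in: "ev X (x p) \<in> fobj H X" if "X \<in> Ob C" "p \<in> hom D (fobj F X) Y" "p \<in> S" for X p
      using ev_in[OF that(1)] xP[OF that(3)] homD(2)[OF that(2)] by simp
    have z_map: "app (fmap H k) (ev X (x p)) = ev (Dom C k) (x (p \<cdot>\<^bsub>D\<^esub> fmap F k))"
      if "X \<in> Ob C" "p \<in> hom D (fobj F X) Y" "p \<in> S" "k \<in> Ar C" "Cod C k = X" for X p k
      using ev_nat[OF that(4), of "x p"] xP[OF that(3)] homD(2)[OF that(2)]
        xr[OF that(3) fmap_simps(1)[OF that(4)]] fmap_simps(3)[OF that(4)] that(5) by simp
    have "\<exists>b. b \<in> fobj H X \<and> (\<forall>k \<in> preimage_sieve X p S. app (fmap H k) b = ev (Dom C k) (x (p \<cdot>\<^bsub>D\<^esub> fmap F k)))"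
      if X: "X \<in> Ob C" and p: "p \<in> hom D (fobj F X) Y" for X p
    proof -
      have "matching_family C H (preimage_sieve X p S) (\<lambda>k. ev (Dom C k) (x (p \<cdot>\<^bsub>D\<^esub> fmap F k)))"
        unfolding matching_family_def
      proof (intro conjI ballI impI)
        fix k assume "k \<in> preimage_sieve X p S"
        then have k: "k \<in> Ar C" "Cod C k = X" "p \<cdot>\<^bsub>D\<^esub> fmap F k \<in> S" by (simp_all add: preimage_sieve_iff)
        note ob = C.Dom_in_Ob[OF k(1)] and pk = Comp_fmap[OF p k(1,2)]
        show "ev (Dom C k) (x (p \<cdot>\<^bsub>D\<^esub> fmap F k)) \<in> fobj H (Dom C k)" using z_in[OF ob pk k(3)] .
        fix l assume l: "l \<in> Ar C" "Cod C l = Dom C k"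
        show "app (fmap H l) (ev (Dom C k) (x (p \<cdot>\<^bsub>D\<^esub> fmap F k)))
            = ev (Dom C (k \<cdot>\<^bsub>C\<^esub> l)) (x (p \<cdot>\<^bsub>D\<^esub> fmap F (k \<cdot>\<^bsub>C\<^esub> l)))"
          using z_map[OF ob pk k(3) l] Comp_fmap_Comp[OF p k(1,2) l] C.Comp_simps(2)[OF k(1) l] by simp
      qed
      then show ?thesis
        using C.sheaf_for_covering[OF H X preimage_sieve_covering[OF S X p]]
        unfolding sheaf_for_sieve_def by blast
    qed
    \<comment> \<open>The amalgamation, as a natural family.\<close>
    then obtain y where y: "\<And>X p. \<lbrakk>X \<in> Ob C; p \<in> hom D (fobj F X) Y\<rbrakk> \<Longrightarrow> y X p \<in> fobj H X \<and>
        (\<forall>k \<in> preimage_sieve X p S. app (fmap H k) (y X p) = ev (Dom C k) (x (p \<cdot>\<^bsub>D\<^esub> fmap F k)))"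
      by metis
    have y_in: "y X p \<in> fobj H X" if "X \<in> Ob C" "p \<in> hom D (fobj F X) Y" for X p
      using y[OF that] by blast
    have y_map: "app (fmap H k) (y X p) = ev (Dom C k) (x (p \<cdot>\<^bsub>D\<^esub> fmap F k))"
      if "X \<in> Ob C" "p \<in> hom D (fobj F X) Y" "k \<in> Ar C" "Cod C k = X" "p \<cdot>\<^bsub>D\<^esub> fmap F k \<in> S" for X p k
      using y[OF that(1,2)] that(3-5) preimage_sieve_iff by blast
    have ran_y: "ran_element H Y y"
      unfolding ran_element_def
    proof (intro ballI conjI impI)
      fix X p assume X: "X \<in> Ob C" and p: "p \<in> hom D (fobj F X) Y"
      show "y X p \<in> fobj H X" using y_in[OF X p] .
      fix k assume k: "k \<in> Ar C" "Cod C k = X"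
      note ob = C.Dom_in_Ob[OF k(1)] and pk = Comp_fmap[OF p k]
      show "app (fmap H k) (y X p) = y (Dom C k) (p \<cdot>\<^bsub>D\<^esub> fmap F k)"
      proof (rule sheaf_eq_on_preimage_sieve[OF H ob pk Y S])
        show "app (fmap H k) (y X p) \<in> fobj H (Dom C k)"
          using C.restr_in[OF preH k(1)] y_in[OF X p] k(2) by simp
        show "y (Dom C k) (p \<cdot>\<^bsub>D\<^esub> fmap F k) \<in> fobj H (Dom C k)" using y_in[OF ob pk] .
        fix l assume l: "l \<in> Ar C" "Cod C l = Dom C k" "p \<cdot>\<^bsub>D\<^esub> fmap F k \<cdot>\<^bsub>D\<^esub> fmap F l \<in> S"
        have kl: "k \<cdot>\<^bsub>C\<^esub> l \<in> Ar C" "Cod C (k \<cdot>\<^bsub>C\<^esub> l) = X" "Dom C (k \<cdot>\<^bsub>C\<^esub> l) = Dom C l"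
          "p \<cdot>\<^bsub>D\<^esub> fmap F (k \<cdot>\<^bsub>C\<^esub> l) = p \<cdot>\<^bsub>D\<^esub> fmap F k \<cdot>\<^bsub>D\<^esub> fmap F l"
          using C.Comp_simps[OF k(1) l(1,2)] k(2) Comp_fmap_Comp[OF p k l(1,2)] by simp_all
        show "app (fmap H l) (app (fmap H k) (y X p)) = app (fmap H l) (y (Dom C k) (p \<cdot>\<^bsub>D\<^esub> fmap F k))"
          using C.restr_Comp[OF preH k(1) l(1,2), of "y X p"] y_in[OF X p] k(2)
            y_map[OF X p kl(1,2)] y_map[OF ob pk l] kl(3,4) l(3) by simp
      qed
    qed
    \<comment> \<open>For \<open>p \<in> S\<close> the preimage of \<open>S\<close> is maximal, and \<open>y X p\<close> is what \<open>x p\<close> prescribes.\<close>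
    have y_S: "y X p = ev X (x p)" if X: "X \<in> Ob C" and p: "p \<in> hom D (fobj F X) Y" "p \<in> S" for X p
    proof (rule sheaf_eq_on_preimage_sieve[OF H X p(1) Y S])
      show "y X p \<in> fobj H X" "ev X (x p) \<in> fobj H X" using y_in[OF X p(1)] z_in[OF X p] .
      show "app (fmap H k) (y X p) = app (fmap H k) (ev X (x p))"
        if "k \<in> Ar C" "Cod C k = X" "p \<cdot>\<^bsub>D\<^esub> fmap F k \<in> S" for k
        using y_map[OF X p(1) that] z_map[OF X p that(1,2)] by simp
    qed
    let ?a = "y (X0 Y) (p0 Y)"
    have a: "?a \<in> P Y" using P_intro[OF ran_y] .
    have amalg: "r f ?a = x f" if f: "f \<in> S" for f
    proof (rule P_eqI)
      note f_Ar = SD(1,2)[OF f]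
      show "Dom D f \<in> Ob D" using D.Dom_in_Ob[OF f_Ar(1)] .
      show "r f ?a \<in> P (Dom D f)" using r_in[OF f_Ar(1)] a f_Ar(2) by simp
      show "x f \<in> P (Dom D f)" using xP[OF f] .
      fix X p assume X: "X \<in> Ob C" and p: "p \<in> hom D (fobj F X) (Dom D f)"
      have fh: "f \<in> hom D (Dom D f) Y" using f_Ar by (simp add: hom_def)
      have fp: "f \<cdot>\<^bsub>D\<^esub> p \<in> hom D (fobj F X) Y" "f \<cdot>\<^bsub>D\<^esub> p \<in> S"
        using D.Comp_in_hom[OF fh p] SD(3)[OF f homD(1,3)[OF p]] by simp_all
      have "E (Dom D f) (r f ?a) X p = y X (f \<cdot>\<^bsub>D\<^esub> p)"
        using E_r[OF f_Ar(1), of ?a X p] a f_Ar(2) X p E_eval[OF ran_y X fp(1)] by simp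
      also have "\<dots> = ev X (r p (x f))"
        using y_S[OF X fp] xr[OF f homD(1,3)[OF p]] by simp
      finally show "E (Dom D f) (r f ?a) X p = E (Dom D f) (x f) X p"
        using ev_r[OF X p xP[OF f]] by simp
    qed
    show "\<exists>!a. a \<in> fobj G Y \<and> (\<forall>f \<in> S. app (fmap G f) a = x f)"
    proof (rule ex1I[of _ ?a])
      show "?a \<in> fobj G Y \<and> (\<forall>f \<in> S. app (fmap G f) ?a = x f)"
        using a G_obj[OF Y] amalg G_map SD(1,2) by simp
      fix a' assume a': "a' \<in> fobj G Y \<and> (\<forall>f \<in> S. app (fmap G f) a' = x f)"
      then have a'P: "a' \<in> P Y" using G_obj[OF Y] by simp
      have a'_r: "r f a' = x f" if "f \<in> S" for f
        using a' G_map[OF SD(1)[OF that], of a'] SD(2)[OF that] a'P that by simp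
      show "a' = ?a"
      proof (rule P_eqI[OF Y a'P a])
        fix X p assume X: "X \<in> Ob C" and p: "p \<in> hom D (fobj F X) Y"
        show "E Y a' X p = E Y ?a X p"
        proof (rule ran_element_eq_on_covering[OF H E(1)[OF a'P] E(1)[OF a] Y S _ X p])
          fix X p assume X: "X \<in> Ob C" and p: "p \<in> hom D (fobj F X) Y" "p \<in> S"
          show "E Y a' X p = E Y ?a X p"
            using ev_r[OF X p(1) a'P] ev_r[OF X p(1) a] a'_r[OF p(2)] amalg[OF p(2)] by simp
        qed
      qed
    qed
  qed
  then have G: "is_sheaf D J\<^sub>D G" using preG by (simp add: is_sheaf_iff)
  have GF: "fobj (comp_ftr C G F) X = P (fobj F X)" if "X \<in> Ob C" for X
    using that G_obj fobj_in_Ob by (simp add: comp_ftr_simps)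
  define \<tau> where "\<tau> = (\<lambda>X \<in> Ob C. (P (fobj F X), fobj H X, \<lambda>a \<in> P (fobj F X). ev X a))"
  have app_\<tau>: "app (\<tau> X) a = ev X a" if "X \<in> Ob C" "a \<in> P (fobj F X)" for X a
    using that by (simp add: \<tau>_def app_def)
  have "nat_trans (op_cat C) set_cat (comp_ftr C G F) H \<tau>"
  proof (rule C.presheaf_nat_transI[OF is_presheaf_comp_ftr[OF cat_functor_axioms preG] preH])
    show "\<tau> \<in> extensional (Ob C)" by (simp add: \<tau>_def)
    show "\<tau> X \<in> hom set_cat (fobj (comp_ftr C G F) X) (fobj H X)" if "X \<in> Ob C" for X
      using that ev_in[OF that] by (auto simp: GF \<tau>_def set_cat_hom)
    fix k a assume k: "k \<in> Ar C" and "a \<in> fobj (comp_ftr C G F) (Cod C k)"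
    then have a: "a \<in> P (fobj F (Cod C k))" using GF C.Cod_in_Ob by simp
    have "r (fmap F k) a \<in> P (fobj F (Dom C k))"
      using r_in[OF fmap_simps(1)[OF k], of a] fmap_simps(2,3)[OF k] a by simp
    then show "app (\<tau> (Dom C k)) (app (fmap (comp_ftr C G F) k) a) = app (fmap H k) (app (\<tau> (Cod C k)) a)"
      using G_map[OF fmap_simps(1)[OF k], of a] fmap_simps(3)[OF k] a k ev_nat[OF k a]
        app_\<tau>[OF C.Cod_in_Ob[OF k] a] app_\<tau>[OF C.Dom_in_Ob[OF k]] by (simp add: comp_ftr_simps)
  qed
  moreover have "bij_betw (app (\<tau> X)) (fobj (comp_ftr C G F) X) (fobj H X)" if X: "X \<in> Ob C" for X
  proof (rule bij_betw_imageI)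
    note FX = fobj_in_Ob[OF X]
    have E_ev: "E (fobj F X) a Z (fmap F k) = app (fmap H k) (ev X a)"
      if a: "a \<in> P (fobj F X)" and k: "k \<in> Ar C" "Dom C k = Z" "Cod C k = X" for a Z k
    proof -
      have "fmap F k \<in> hom D (fobj F Z) (fobj F X)" using fmap_simps[OF k(1)] k by (simp add: hom_def)
      then show ?thesis
        using ran_elementD(2)[OF E(1)[OF a] X id_F[OF X] k(1,3)] k(2) D.Idn_left by (simp add: ev_def)
    qed
    show "inj_on (app (\<tau> X)) (fobj (comp_ftr C G F) X)"
    proof (rule inj_onI)
      fix a b assume "a \<in> fobj (comp_ftr C G F) X" "b \<in> fobj (comp_ftr C G F) X"
        and "app (\<tau> X) a = app (\<tau> X) b"
      then have ab: "a \<in> P (fobj F X)" "b \<in> P (fobj F X)" "ev X a = ev X b"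
        using app_\<tau>[OF X] GF[OF X] by simp_all
      obtain k where k: "k \<in> Ar C" "Dom C k = X0 (fobj F X)" "Cod C k = X" "fmap F k = p0 (fobj F X)"
        using lift[OF X0[OF FX] X p0(1)[OF FX]] by metis
      show "a = b"
        using E_ev[OF ab(1) k(1-3)] E_ev[OF ab(2) k(1-3)] ab(3) k(4) E(2)[OF ab(1)] E(2)[OF ab(2)] by simp
    qed
    show "app (\<tau> X) ` fobj (comp_ftr C G F) X = fobj H X"
    proof
      show "app (\<tau> X) ` fobj (comp_ftr C G F) X \<subseteq> fobj H X"
        using app_\<tau>[OF X] GF[OF X] ev_in[OF X] by auto
      show "fobj H X \<subseteq> app (\<tau> X) ` fobj (comp_ftr C G F) X"
      proof
        fix b assume b: "b \<in> fobj H X"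
        \<comment> \<open>The Yoneda correspondence, as \<open>F\<close> is fully faithful.\<close>
        define y where "y Z p = app (fmap H (inv_into (hom C Z X) (fmap F) p)) b" for Z p
        have y: "y Z (fmap F k) = app (fmap H k) b" if k: "k \<in> hom C Z X" for Z k
        proof -
          have "inj_on (fmap F) (hom C Z X)" using ff_eq[OF ff] by (meson inj_onI)
          then show ?thesis using k by (simp add: y_def)
        qed
        have ran_y: "ran_element H (fobj F X) y"
          unfolding ran_element_def
        proof (intro ballI conjI impI)
          fix Z p assume Z: "Z \<in> Ob C" and p: "p \<in> hom D (fobj F Z) (fobj F X)"
          obtain k where k: "k \<in> Ar C" "Dom C k = Z" "Cod C k = X" "fmap F k = p"
            using lift[OF Z X p] by metis
          then have kh: "k \<in> hom C Z X" by (simp add: hom_def)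
          show "y Z p \<in> fobj H Z" using y[OF kh] k C.restr_in[OF preH k(1)] b by simp
          fix l assume l: "l \<in> Ar C" "Cod C l = Z"
          then have "l \<in> hom C (Dom C l) Z" by (simp add: hom_def)
          from y[OF C.Comp_in_hom[OF kh this]]
          show "app (fmap H l) (y Z p) = y (Dom C l) (p \<cdot>\<^bsub>D\<^esub> fmap F l)"
            using y[OF kh] C.restr_Comp[OF preH k(1) l(1)] fmap_Comp_Ar[OF k(1) l(1)] k l b by simp
        qed
        let ?a = "y (X0 (fobj F X)) (p0 (fobj F X))"
        have a: "?a \<in> P (fobj F X)" using P_intro[OF ran_y] .
        have "ev X ?a = y X (Idn D (fobj F X))" using E_eval[OF ran_y X id_F[OF X]] by (simp add: ev_def)
        also have "\<dots> = b"
          using y[OF C.Idn_in_hom[OF X]] fmap_Idn[OF X] C.restr_Idn[OF preH X b] by simp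
        finally have "app (\<tau> X) ?a = b" using app_\<tau>[OF X a] by simp
        then show "b \<in> app (\<tau> X) ` fobj (comp_ftr C G F) X" using a GF[OF X] by blast
      qed
    qed
  qed
  ultimately show thesis using that[OF G] by blast
qed

lemma is_equivalence_restriction:
  "is_equivalence (Sh\<^sub>D :: (('o2, 'm2, 'v) presheaf, ('o2, 'm2, 'v) presheaf_map) cat) Sh\<^sub>C restriction"
proof (rule is_equivalence_if_fully_faithful_ess_surj[OF cat_functor_restriction fully_faithful_restriction])
  fix H :: "('o1, 'm1, 'v) presheaf"
  assume "H \<in> Ob Sh\<^sub>C"
  then have H: "is_sheaf C J\<^sub>C H" by (simp add: sheaf_cat_Ob)
  obtain G :: "('o2, 'm2, 'v) presheaf" and \<tau> where G: "is_sheaf D J\<^sub>D G"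
    and \<tau>: "nat_trans (op_cat C) set_cat (comp_ftr C G F) H \<tau>"
    and bij: "\<And>X. X \<in> Ob C \<Longrightarrow> bij_betw (app (\<tau> X)) (fobj (comp_ftr C G F) X) (fobj H X)"
    using restriction_essentially_surjective[OF H] by blast
  note GF = is_sheaf_comp_ftr[OF G]
  have "is_iso Sh\<^sub>C (comp_ftr C G F, H, \<tau>)"
    using C.sheaf_cat_iso_if_bij[OF GF H \<tau> bij] .
  moreover have "(comp_ftr C G F, H, \<tau>) \<in> hom Sh\<^sub>C (fobj restriction G) H"
    using GF H \<tau> G by (simp add: sheaf_cat_hom restriction_simps)
  moreover have "G \<in> Ob Sh\<^sub>D" using G by (simp add: sheaf_cat_Ob)
  ultimately show "\<exists>G \<in> Ob Sh\<^sub>D. \<exists>e \<in> hom Sh\<^sub>C (fobj restriction G) H. is_iso Sh\<^sub>C e" by blast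
qed

end

theorem proposition6p15:
  fixes C :: "('o1, 'm1) cat" and D :: "('o2, 'm2) cat"
    and F :: "('o1, 'm1, 'o2, 'm2) ftr"
  assumes "category C"
    and "precoherent D"
    and "cat_functor C D F"
    and "fully_faithful C D F"
    and "preserves_finite_eff_epi_families C D F"
    and "reflects_finite_eff_epi_families C D F"
    and "\<forall>Y \<in> Ob D. \<exists>X \<in> Ob C. \<exists>p \<in> hom D (fobj F X) Y. effective_epi D p"
  shows "precoherent C \<and>
    (\<forall>G :: ('o2, 'm2, 'v) presheaf.
       is_sheaf D (coherent_topology D) G \<longrightarrow> is_sheaf C (coherent_topology C) (comp_ftr C G F)) \<and>
    is_equivalence
      (sheaf_cat D (coherent_topology D) ::
         (('o2, 'm2, 'v) presheaf, ('o2, 'm2, 'v) presheaf_map) cat)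
      (sheaf_cat C (coherent_topology C) ::
         (('o1, 'm1, 'v) presheaf, ('o1, 'm1, 'v) presheaf_map) cat)
      (precomp_ftr C (sheaf_cat D (coherent_topology D)) F)"
proof -
  interpret cat_functor C D F by fact
  interpret covering_functor C D F
    using assms by unfold_locales blast+
  show ?thesis
    using precoherent_C is_sheaf_comp_ftr is_equivalence_restriction by blast
qed

end
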